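(* Let $n$ be a positive integer and $\boldsymbol{x}=(x_1,\dots,x_n)$, $\boldsymbol{x}+\boldsymbol{x}^{-1}=(x_1+x_1^{-1},\dots,x_n+x_n^{-1})$. (1) Let $\mathcal F^B=\{f^B_d\}_{d=0}^\infty$ be the sequence of polynomials defined by $f^B_0=1$ and $$f^B_d(x+x^{-1})=(x^d-x^{-d})\frac{x^{1/2}+x^{-1/2}}{x^{1/2}-x^{-1/2}}\quad(d\ge1).$$ For a strict partition $\lambda$ of length $l\le n$, $\ \mathbb{P}^{\Phi(B_n)}_\lambda(\boldsymbol{x};-1)=P^{\mathcal F^B}_\lambda(\boldsymbol{x}+\boldsymbol{x}^{-1})$. (2) Let $\mathcal F^C=\{f^C_d\}_{d=0}^\infty$ be the sequence of polynomials defined by $f^C_0=1$ and $$f^C_d(x+x^{-1})=(x^d-x^{-d})\frac{x+x^{-1}}{x-x^{-1}}\quad(d\ge1).$$ For a strict partition $\lambda$ of length $l\le n$, $\ \mathbb{P}^{\Phi(C_n)}_\lambda(\boldsymbol{x};-1)=P^{\mathcal F^C}_\lambda(\boldsymbol{x}+\boldsymbol{x}^{-1})$. (3) Let $\mathcal F^D=\{f^D_d\}_{d=0}^\infty$ be the sequence of polynomials defined by $f^D_0=1$ and $$f^D_d(x+x^{-1})=x^d+x^{-d}\quad(d\ge1).$$ For a strict partition $\lambda$ of length $l<n$, $\ \mathbb{P}^{\Phi(D_n)}_\lambda(\boldsymbol{x};-1)=P^{\mathcal F^D}_\lambda(\boldsymbol{x}+\boldsymbol{x}^{-1})$, and for a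 strict partition $\lambda$ of length $n$, $$\mathbb{P}^{\Phi(D_n)}_\lambda(\boldsymbol{x};-1)+\mathbb{P}^{\Phi(D_n)}_{\lambda'}(\boldsymbol{x};-1)=P^{\mathcal F^D}_\lambda(\boldsymbol{x}+\boldsymbol{x}^{-1}),$$ where $\lambda'=\lambda_1\varepsilon_1+\dots+\lambda_{n-1}\varepsilon_{n-1}-\lambda_n\varepsilon_n$.
   Context: A strict partition of length $l$ is a strictly decreasing sequence $\lambda=(\lambda_1>\dots>\lambda_l)$ of positive integers (the empty sequence has length $0$). Generalized $P$-functions: let $\mathcal F=\{f_d\}_{d=0}^\infty$ be a sequence of polynomials over a field of characteristic $0$ with $f_0=1$ and $\deg f_d=d$ for $d\ge1$ (each of $\mathcal F^B,\mathcal F^C,\mathcal F^D$ is such a sequence over $\mathbb{Q}$). For $\boldsymbol{u}=(u_1,\dots,u_n)$ put $A(\boldsymbol{u})=\left(\frac{u_j-u_i}{u_j+u_i}\right)_{1\le i,j\le n}$, $\Delta(\boldsymbol{u})=\prod_{1\le i<j\le n}\frac{u_j-u_i}{u_j+u_i}$ and, for a sequence $\alpha=(\alpha_1,\dots,\alpha_r)$ of nonnegative integers, $V^{\mathcal F}_\alpha(\boldsymbol{u})=(f_{\alpha_j}(u_i))_{1\le i\le n,\,1\le j\le r}$. For a strict partition $\lambda$ of length $l$, $$P^{\mathcal F}_\lambda(\boldsymbol{u})=\frac{1}{\Delta(\boldsymbol{u})}\mathrm{Pf}\begin{pmatrix}A(\boldsymbol{u})&V^{\mathcal F}_{\lambda^*}(\boldsymbol{u})\\-{}^tV^{\mathcal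 F}_{\lambda^*}(\boldsymbol{u})&O\end{pmatrix},$$ where $\lambda^*=\lambda$ if $n+l$ is even and $\lambda^*=(\lambda_1,\dots,\lambda_l,0)$ if $n+l$ is odd (${}^t$ denotes transpose). Hall--Littlewood functions of root systems: let $V$ be the $n$-dimensional Euclidean space with orthonormal basis $\varepsilon_1,\dots,\varepsilon_n$. The root systems $\Phi(X_n)$ ($X=B,C,D$) have positive systems $\Phi^+(B_n)=\{\varepsilon_i\pm\varepsilon_j:1\le i<j\le n\}\cup\{\varepsilon_i:1\le i\le n\}$, $\Phi^+(C_n)=\{\varepsilon_i\pm\varepsilon_j:1\le i<j\le n\}\cup\{2\varepsilon_i:1\le i\le n\}$, $\Phi^+(D_n)=\{\varepsilon_i\pm\varepsilon_j:1\le i<j\le n\}$. The Weyl group $W$ acts on $V$ by permutations of the $\varepsilon_i$ and sign changes (all sign changes for $B_n$, $C_n$; an even number of sign changes for $D_n$). Write $e^\lambda$ for the basis element of the group algebra over $\mathbb{Q}(t)$ of the weight lattice corresponding to a weight $\lambda$, and $x_i=e^{\varepsilon_i}$. For $\Phi=\Phi(X_n)$ and a dominant weight $\lambda$, set $$\mathbb{P}^{\Phi}_\lambda(\boldsymbol{x};t)=\frac{1}{W_\lambda(t)}\sum_{w\in W}w\left(e^\lambda\prod_{\alpha\in\Phi^+}\frac{1-te^{-\alpha}}{1-e^{-\alpha}}\right),$$ where $W_\lambda=\{w\in W:w\lambda=\lambda\}$ and $W_\lambda(t)=\sum_{w\in W_\lambda}t^{l(w)}$, $l(w)$ being the length of $w$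 with respect to the simple reflections. $\mathbb{P}^\Phi_\lambda(\boldsymbol{x};-1)$ is the specialization $t=-1$ after cancelling common factors (for the weights above the function is regular there). A partition $\lambda$ of length $l\le n$ is identified with the dominant weight $\lambda_1\varepsilon_1+\dots+\lambda_l\varepsilon_l$. *)

theory Defs
  imports
    "HOL-Library.Poly_Mapping"
    "HOL-Computational_Algebra.Computational_Algebra"
    "HOL-Combinatorics.Permutations"
    "Jordan_Normal_Form.Matrix"
begin

section \<open>Generalized P-functions\<close>

definition strict_partition :: "nat list \<Rightarrow> bool" where
  "strict_partition lam \<longleftrightarrow> sorted_wrt (>) lam \<and> (\<forall>a\<in>set lam. 0 < a)"

text \<open>Rows and columns are numbered from 0, and the sum runs over the permutations that
  represent the perfect matchings of the index set. Meaningful for even size only.\<close>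

definition pfaffian :: "'a::comm_ring_1 mat \<Rightarrow> 'a" where
  "pfaffian M = (let m = dim_row M div 2 in
     \<Sum>\<sigma> | \<sigma> permutes {..<dim_row M} \<and> (\<forall>i<m. \<sigma> (2*i) < \<sigma> (2*i+1))
            \<and> (\<forall>i. Suc i < m \<longrightarrow> \<sigma> (2*i) < \<sigma> (2 * Suc i)).
       of_int (sign \<sigma>) * (\<Prod>i<m. M $$ (\<sigma> (2*i), \<sigma> (2*i+1))))"

definition schur_matrix :: "nat \<Rightarrow> (nat \<Rightarrow> 'a::field) \<Rightarrow> 'a mat" where
  "schur_matrix n u = mat n n (\<lambda>(i, j). (u j - u i) / (u j + u i))"

definition schur_product :: "nat \<Rightarrow> (nat \<Rightarrow> 'a::field) \<Rightarrow> 'a" where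
  "schur_product n u = (\<Prod>j<n. \<Prod>i<j. (u j - u i) / (u j + u i))"

definition value_matrix :: "(nat \<Rightarrow> 'a::field poly) \<Rightarrow> nat \<Rightarrow> (nat \<Rightarrow> 'a) \<Rightarrow> nat list \<Rightarrow> 'a mat" where
  "value_matrix F n u \<alpha> = mat n (length \<alpha>) (\<lambda>(i, j). poly (F (\<alpha> ! j)) (u i))"

text \<open>The variables are \<open>u 0, \<dots>, u (n - 1)\<close>, elements of a field containing the coefficients
  of \<open>F\<close> in which no sum \<open>u i + u j\<close> vanishes and the \<open>u i\<close> are distinct.\<close>

definition generalized_P :: "(nat \<Rightarrow> 'a::field poly) \<Rightarrow> nat \<Rightarrow> (nat \<Rightarrow> 'a) \<Rightarrow> nat list \<Rightarrow> 'a" where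
  "generalized_P F n u lam =
     (let lam' = (if even (n + length lam) then lam else lam @ [0]);
          V = value_matrix F n u lam'
      in pfaffian (four_block_mat (schur_matrix n u) V
                     (- transpose_mat V) (0\<^sub>m (length lam') (length lam')))
         / schur_product n u)"


section \<open>Root systems of types B, C, D\<close>

text \<open>The coordinate of index \<open>i < n\<close> belongs to the basis vector usually called
  \<open>\<epsilon>\<close> with index \<open>i + 1\<close>. All roots, and all weights given by partitions, lie in the lattice
  spanned by these vectors; it is stable under the Weyl group, so the half-integral weights
  of types B and D are not needed. For type B the element \<open>x\<close> to the power \<open>1/2\<close> only occurs in
  the definition of the polynomials \<open>fB\<close> below.\<close>

type_synonym weight = "nat \<Rightarrow>\<^sub>0 int"

datatype root_type = Type_B | Type_C | Type_D

definition eps :: "nat \<Rightarrow> weight" where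
  "eps i = Poly_Mapping.single i 1"

definition positive_roots :: "root_type \<Rightarrow> nat \<Rightarrow> weight set" where
  "positive_roots X n =
     {eps i - eps j | i j. i < j \<and> j < n} \<union> {eps i + eps j | i j. i < j \<and> j < n} \<union>
     (case X of
        Type_B \<Rightarrow> {eps i | i. i < n}
      | Type_C \<Rightarrow> {eps i + eps i | i. i < n}
      | Type_D \<Rightarrow> {})"

text \<open>\<open>w\<close> sends the basis vector of index \<open>i\<close> to \<open>s i\<close> times the one of index \<open>\<sigma> i\<close>.\<close>

definition weyl_group :: "root_type \<Rightarrow> nat \<Rightarrow> (weight \<Rightarrow> weight) set" where
  "weyl_group X n = {w. \<exists>\<sigma> s. \<sigma> permutes {..<n} \<and>
      (\<forall>i<n. s i = 1 \<or> s i = -1) \<and> (\<forall>i\<ge>n. s i = 1) \<and>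
      (X = Type_D \<longrightarrow> even (card {i. s i = -1})) \<and>
      (\<forall>v i. Poly_Mapping.lookup (w v) (\<sigma> i) = s i * Poly_Mapping.lookup v i)}"

definition weight_inner :: "weight \<Rightarrow> weight \<Rightarrow> int" where
  "weight_inner v w =
     (\<Sum>i\<in>Poly_Mapping.keys v. Poly_Mapping.lookup v i * Poly_Mapping.lookup w i)"

text \<open>The division is exact for every root \<open>\<alpha>\<close>; \<open>frag_cmul\<close> is multiplication by an integer.\<close>

definition reflection :: "weight \<Rightarrow> weight \<Rightarrow> weight" where
  "reflection \<alpha> v = v - frag_cmul (2 * weight_inner v \<alpha> div weight_inner \<alpha> \<alpha>) \<alpha>"

definition simple_roots :: "root_type \<Rightarrow> nat \<Rightarrow> weight set" where
  "simple_roots X n = {\<alpha> \<in> positive_roots X n.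
     \<not> (\<exists>\<beta>\<in>positive_roots X n. \<exists>\<gamma>\<in>positive_roots X n. \<alpha> = \<beta> + \<gamma>)}"

definition weyl_length :: "root_type \<Rightarrow> nat \<Rightarrow> (weight \<Rightarrow> weight) \<Rightarrow> nat" where
  "weyl_length X n w = (LEAST k. \<exists>as. length as = k \<and> set as \<subseteq> simple_roots X n \<and>
     w = foldr (\<circ>) (map reflection as) id)"

text \<open>The dominant weight given by a partition.\<close>

definition partition_weight :: "nat list \<Rightarrow> weight" where
  "partition_weight lam = (\<Sum>i<length lam. Poly_Mapping.single i (int (lam ! i)))"


section \<open>Hall--Littlewood functions\<close>

text \<open>The element \<open>e\<close> to the power \<open>\<mu>\<close> in the field of fractions of a group algebra.\<close>

definition wexp :: "weight \<Rightarrow> (weight \<Rightarrow>\<^sub>0 'a::idom) fract" where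
  "wexp \<mu> = to_fract (Poly_Mapping.single \<mu> 1)"

definition const_fract :: "'a::idom \<Rightarrow> (weight \<Rightarrow>\<^sub>0 'a) fract" where
  "const_fract c = to_fract (Poly_Mapping.single 0 c)"

text \<open>The rational functions in the indeterminates and in the parameter \<open>t\<close> are realized as
  fractions of elements of the group algebra over \<open>\<rat>[t]\<close> (with \<open>t = [:0, 1:]\<close>); this is also the
  field of fractions of the group algebra over \<open>\<rat>(t)\<close>. A Weyl group element \<open>w\<close> acts on this
  field by the automorphism that fixes \<open>t\<close> and sends \<open>wexp \<mu>\<close> to \<open>wexp (w \<mu>)\<close>; its action is
  written out in the summands.\<close>

definition hall_littlewood :: "root_type \<Rightarrow> nat \<Rightarrow> weight \<Rightarrow> (weight \<Rightarrow>\<^sub>0 rat poly) fract" where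
  "hall_littlewood X n lam =
     (\<Sum>w\<in>weyl_group X n. wexp (w lam) *
        (\<Prod>\<alpha>\<in>positive_roots X n.
           (1 - const_fract [:0, 1:] * wexp (w (- \<alpha>))) / (1 - wexp (w (- \<alpha>)))))
     / const_fract (\<Sum>w | w \<in> weyl_group X n \<and> w lam = lam. [:0, 1:] ^ weyl_length X n w)"

definition eval_coeffs :: "rat \<Rightarrow> (weight \<Rightarrow>\<^sub>0 rat poly) \<Rightarrow> (weight \<Rightarrow>\<^sub>0 rat)" where
  "eval_coeffs c = Poly_Mapping.map (\<lambda>p. poly p c)"

text \<open>\<open>f\<close> is regular at \<open>t = c\<close> and has the value \<open>g\<close> there.\<close>

definition specializes_to ::
  "rat \<Rightarrow> (weight \<Rightarrow>\<^sub>0 rat poly) fract \<Rightarrow> (weight \<Rightarrow>\<^sub>0 rat) fract \<Rightarrow> bool" where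
  "specializes_to c f g \<longleftrightarrow> (\<exists>p q. f = Fract p q \<and> eval_coeffs c q \<noteq> 0 \<and>
     g = Fract (eval_coeffs c p) (eval_coeffs c q))"

definition specialize :: "rat \<Rightarrow> (weight \<Rightarrow>\<^sub>0 rat poly) fract \<Rightarrow> (weight \<Rightarrow>\<^sub>0 rat) fract" where
  "specialize c f = (THE g. specializes_to c f g)"

lemma lookup_eval_coeffs:
  "Poly_Mapping.lookup (eval_coeffs c f) k = poly (Poly_Mapping.lookup f k) c"
  by (simp add: eval_coeffs_def map.rep_eq when_def)

lemma eval_coeffs_0: "eval_coeffs c 0 = 0"
  by (rule poly_mapping_eqI) (simp add: lookup_eval_coeffs)

lemma poly_Sum_any:
  assumes "finite {a. f a \<noteq> (0 :: rat poly)}"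
  shows "poly (Sum_any f) c = Sum_any (\<lambda>a. poly (f a) c)"
proof -
  have "Sum_any (\<lambda>a. poly (f a) c) = (\<Sum>a\<in>{a. f a \<noteq> 0}. poly (f a) c)"
    by (rule Sum_any.expand_superset[OF assms]) auto
  then show ?thesis by (simp add: Sum_any.expand_set poly_sum)
qed

lemma eval_coeffs_mult: "eval_coeffs c (f * g) = eval_coeffs c f * eval_coeffs c g"
proof (rule poly_mapping_eqI)
  fix k
  have inner: "poly (\<Sum>q. Poly_Mapping.lookup g q when k = l + q) c =
      (\<Sum>q. Poly_Mapping.lookup (eval_coeffs c g) q when k = l + q)" for l
  proof -
    have "finite {q. (Poly_Mapping.lookup g q when k = l + q) \<noteq> 0}"
      by (rule finite_subset[OF _ finite_lookup[of g]]) (auto simp: when_def)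
    then show ?thesis
      by (subst poly_Sum_any) (auto simp: lookup_eval_coeffs when_def intro!: Sum_any.cong)
  qed
  have "finite {l. Poly_Mapping.lookup f l * (\<Sum>q. Poly_Mapping.lookup g q when k = l + q) \<noteq> 0}"
    by (rule finite_subset[OF _ finite_lookup[of f]]) auto
  then show "Poly_Mapping.lookup (eval_coeffs c (f * g)) k =
      Poly_Mapping.lookup (eval_coeffs c f * eval_coeffs c g) k"
    by (simp add: lookup_eval_coeffs lookup_mult poly_Sum_any inner)
qed

lemma specializes_to_unique:
  assumes "specializes_to c f g" "specializes_to c f h"
  shows "g = h"
proof -
  obtain p q where pq: "f = Fract p q" "eval_coeffs c q \<noteq> 0"
      "g = Fract (eval_coeffs c p) (eval_coeffs c q)"
    using assms(1) unfolding specializes_to_def by blast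
  obtain r s where rs: "f = Fract r s" "eval_coeffs c s \<noteq> 0"
      "h = Fract (eval_coeffs c r) (eval_coeffs c s)"
    using assms(2) unfolding specializes_to_def by blast
  have "q \<noteq> 0" "s \<noteq> 0" using pq(2) rs(2) by (auto simp: eval_coeffs_0)
  then have "p * s = r * q" using pq(1) rs(1) by (simp add: eq_fract)
  then have "eval_coeffs c p * eval_coeffs c s = eval_coeffs c r * eval_coeffs c q"
    by (metis eval_coeffs_mult)
  then show ?thesis using pq rs by (simp add: eq_fract)
qed

lemma specialize_eqI: "specializes_to c f g \<Longrightarrow> specialize c f = g"
  unfolding specialize_def by (blast intro: the_equality specializes_to_unique)


section \<open>The three polynomial sequences\<close>

instance fract :: ("{idom, ring_char_0}") field_char_0
proof
  show "inj (of_nat :: nat \<Rightarrow> 'a fract)"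
    by (auto simp: inj_on_def of_nat_fract eq_fract)
qed

abbreviation rat_poly :: "rat poly \<Rightarrow> 'a::field_char_0 poly" where
  "rat_poly \<equiv> map_poly of_rat"

text \<open>The indeterminate of the field of rational functions in one variable. It is \<open>x\<close> in types
  C and D, and the square root of \<open>x\<close> in type B.\<close>

definition indet :: "rat poly fract" where
  "indet = to_fract [:0, 1:]"

definition is_fB :: "(nat \<Rightarrow> rat poly) \<Rightarrow> bool" where
  "is_fB F \<longleftrightarrow> F 0 = 1 \<and> (\<forall>d\<ge>1. let y = indet; x = y\<^sup>2 in
     poly (rat_poly (F d)) (x + inverse x) =
       (x ^ d - inverse x ^ d) * ((y + inverse y) / (y - inverse y)))"

definition is_fC :: "(nat \<Rightarrow> rat poly) \<Rightarrow> bool" where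
  "is_fC F \<longleftrightarrow> F 0 = 1 \<and> (\<forall>d\<ge>1. let x = indet in
     poly (rat_poly (F d)) (x + inverse x) =
       (x ^ d - inverse x ^ d) * ((x + inverse x) / (x - inverse x)))"

definition is_fD :: "(nat \<Rightarrow> rat poly) \<Rightarrow> bool" where
  "is_fD F \<longleftrightarrow> F 0 = 1 \<and> (\<forall>d\<ge>1. let x = indet in
     poly (rat_poly (F d)) (x + inverse x) = x ^ d + inverse x ^ d)"

definition fB :: "nat \<Rightarrow> rat poly" where "fB = (THE F. is_fB F)"
definition fC :: "nat \<Rightarrow> rat poly" where "fC = (THE F. is_fC F)"
definition fD :: "nat \<Rightarrow> rat poly" where "fD = (THE F. is_fD F)"

lemma of_rat_fract_poly: "(of_rat r :: rat poly fract) = to_fract [:r:]"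
proof (cases r)
  case (Fract p q)
  have c: "(of_int k :: rat poly fract) = to_fract [:of_int k:]" for k
    by (cases k rule: int_cases2) (simp_all add: of_nat_fract to_fract_def of_nat_poly)
  have q0: "(of_int q :: rat poly fract) \<noteq> 0" using Fract by simp
  have "to_fract [:r:] * of_int q = to_fract [:of_int p:]"
    using Fract by (simp add: c to_fract_mult[symmetric] Fract_of_int_quotient del: to_fract_mult)
  then have "to_fract [:r:] = of_int p / of_int q"
    using q0 by (simp add: c field_simps)
  then show ?thesis
    using Fract by (simp add: of_rat_rat)
qed

lemma rat_poly_diff: "rat_poly (p - q) = rat_poly p - rat_poly q"
  by (rule poly_eqI) (simp add: coeff_map_poly of_rat_diff)

lemma to_fract_power: "to_fract (a ^ k) = to_fract a ^ k"
  by (induction k) auto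

lemma to_fract_sum: "to_fract (sum f A) = (\<Sum>a\<in>A. to_fract (f a))"
  by (induction A rule: infinite_finite_induct) auto

lemma rat_poly_eval_nonzero:
  fixes f :: "rat poly" and u :: "rat poly fract"
  assumes u: "u * to_fract b = to_fract a" and b: "poly b 0 = 0" and a: "poly a 0 = 1"
    and f: "poly (rat_poly f) u = 0"
  shows "f = 0"
proof (rule ccontr)
  assume nz: "f \<noteq> 0"
  define k where "k = degree f"
  have deg: "degree (rat_poly f :: rat poly fract poly) = k"
    unfolding k_def by (rule degree_map_poly) auto
  define s where "s = (\<Sum>i\<le>k. [:coeff f i:] * a ^ i * b ^ (k - i))"
  have "to_fract s = (\<Sum>i\<le>k. of_rat (coeff f i) * u ^ i) * to_fract b ^ k"
    unfolding s_def to_fract_sum sum_distrib_right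
  proof (rule sum.cong[OF refl])
    fix i assume "i \<in> {..k}"
    then have "to_fract b ^ k = to_fract b ^ i * to_fract b ^ (k - i)"
      by (simp flip: power_add)
    moreover have "to_fract a ^ i = u ^ i * to_fract b ^ i"
      by (simp add: u[symmetric] power_mult_distrib)
    ultimately show "to_fract ([:coeff f i:] * a ^ i * b ^ (k - i)) =
        of_rat (coeff f i) * u ^ i * to_fract b ^ k"
      by (simp only: to_fract_mult to_fract_power of_rat_fract_poly mult_ac)
  qed
  also have "(\<Sum>i\<le>k. of_rat (coeff f i) * u ^ i) = poly (rat_poly f) u"
    by (simp add: poly_altdef deg coeff_map_poly)
  finally have "s = 0" using f by simp
  then have "poly s 0 = 0" by simp
  moreover have "poly s 0 = (\<Sum>i\<le>k. if i = k then coeff f i else 0)"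
    unfolding s_def poly_sum by (rule sum.cong) (auto simp: a b poly_power)
  ultimately have "coeff f k = 0" by simp
  then show False using nz by (simp add: k_def)
qed

lemma indet_nonzero: "indet \<noteq> 0"
  by (simp add: indet_def)

lemma indet_power: "indet ^ k = to_fract ([:0, 1:] ^ k)"
  by (simp add: indet_def to_fract_power)

lemma eval_at_x_inj:
  fixes f g :: "rat poly"
  assumes "m \<ge> 1" and "x = indet ^ m"
    and "poly (rat_poly f) (x + inverse x) = poly (rat_poly g) (x + inverse x)"
  shows "f = g"
proof -
  have x0: "x \<noteq> 0" by (simp add: assms(2) indet_nonzero)
  have "f - g = 0"
  proof (rule rat_poly_eval_nonzero)
    show "(x + inverse x) * to_fract ([:0, 1:] ^ m) = to_fract ([:0, 1:] ^ (2 * m) + 1)"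
      using x0 by (simp add: assms(2) indet_power[symmetric] field_simps power_mult power2_eq_square
        mult_2 power_add)
    show "poly ([:0, 1:] ^ m) (0::rat) = 0" "poly ([:0, 1:] ^ (2 * m) + 1) (0::rat) = 1"
      using assms(1) by (auto simp: poly_power)
    show "poly (rat_poly (f - g)) (x + inverse x) = 0"
      using assms(3) by (simp add: rat_poly_diff)
  qed
  then show ?thesis by simp
qed

lemma recurrence_polys:
  fixes h :: "nat \<Rightarrow> rat poly fract"
  assumes rec: "\<And>d. h (Suc (Suc d)) = u * h (Suc d) - h d"
    and 0: "poly (rat_poly p0) u = h 0" and 1: "poly (rat_poly p1) u = h 1"
  shows "\<exists>F. F 0 = 1 \<and> (\<forall>d\<ge>1. poly (rat_poly (F d)) u = h d)"
proof -
  have "(\<exists>p. poly (rat_poly p) u = h d) \<and> (\<exists>p. poly (rat_poly p) u = h (Suc d))" for d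
  proof (induction d)
    case 0 show ?case using assms by auto
  next
    case (Suc d)
    then obtain p q where "poly (rat_poly p) u = h d" "poly (rat_poly q) u = h (Suc d)" by blast
    then have "poly (rat_poly (pCons 0 q - p)) u = h (Suc (Suc d))"
      by (simp add: rec rat_poly_diff map_poly_pCons)
    then show ?case using Suc by blast
  qed
  then obtain F where "\<And>d. poly (rat_poly (F d)) u = h d" by metis
  then show ?thesis by (intro exI[of _ "F(0 := 1)"]) auto
qed

lemma power_recurrence:
  fixes x :: "'a::field"
  assumes "x \<noteq> 0"
  shows "(x ^ Suc (Suc d) - inverse x ^ Suc (Suc d)) * k =
     (x + inverse x) * ((x ^ Suc d - inverse x ^ Suc d) * k) - (x ^ d - inverse x ^ d) * k"
    and "x ^ Suc (Suc d) + inverse x ^ Suc (Suc d) =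
     (x + inverse x) * (x ^ Suc d + inverse x ^ Suc d) - (x ^ d + inverse x ^ d)"
proof -
  have [simp]: "x * (inverse x * z) = z" for z
    using assms by (simp flip: mult.assoc)
  show "(x ^ Suc (Suc d) - inverse x ^ Suc (Suc d)) * k =
     (x + inverse x) * ((x ^ Suc d - inverse x ^ Suc d) * k) - (x ^ d - inverse x ^ d) * k"
    and "x ^ Suc (Suc d) + inverse x ^ Suc (Suc d) =
     (x + inverse x) * (x ^ Suc d + inverse x ^ Suc d) - (x ^ d + inverse x ^ d)"
    by (simp_all add: algebra_simps)
qed

lemma indet_minus_inverse: "indet - inverse indet \<noteq> 0"
proof
  assume "indet - inverse indet = 0"
  then have "indet ^ 2 = 1" using indet_nonzero by (simp add: field_simps power2_eq_square)
  then have "to_fract ([:0, 1:] ^ 2 :: rat poly) = to_fract 1" by (simp add: indet_power)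
  then have "[:0, 1:] ^ 2 = (1 :: rat poly)" by (simp only: to_fract_eq_iff)
  then show False by (simp add: power2_eq_square one_pCons)
qed

lemma ex1_fB: "\<exists>!F. is_fB F"
proof -
  define y x :: "rat poly fract" where "y = indet" and "x = y\<^sup>2"
  have y: "y \<noteq> 0" "y - inverse y \<noteq> 0"
    using indet_nonzero indet_minus_inverse by (simp_all add: y_def)
  then have x: "x \<noteq> 0" by (simp add: x_def)
  define k where "k = (y + inverse y) / (y - inverse y)"
  have "(x - inverse x) = (y - inverse y) * (y + inverse y)"
    using y(1) by (simp add: x_def power2_eq_square algebra_simps)
  then have k: "(x - inverse x) * k = (y + inverse y) * (y + inverse y)"
    using y(2) by (simp add: k_def)
  have "\<exists>F. F 0 = 1 \<and> (\<forall>d\<ge>1. poly (rat_poly (F d)) (x + inverse x) =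
      (x ^ d - inverse x ^ d) * k)"
  proof (rule recurrence_polys)
    show "poly (rat_poly 0) (x + inverse x) = (x ^ 0 - inverse x ^ 0) * k" by simp
    show "poly (rat_poly [:2, 1:]) (x + inverse x) = (x ^ 1 - inverse x ^ 1) * k"
      using y(1) k by (simp add: map_poly_pCons x_def power2_eq_square algebra_simps)
  qed (rule power_recurrence(1)[OF x])
  then obtain F where F: "is_fB F" by (auto simp: is_fB_def x_def y_def k_def Let_def)
  have "G = F" if G: "is_fB G" for G
  proof
    fix d show "G d = F d"
    proof (cases "d \<ge> 1")
      case True
      then show ?thesis using F G eval_at_x_inj[of 2 x "G d" "F d"]
        by (simp add: is_fB_def x_def y_def Let_def)
    next
      case False
      then have "d = 0" by simp
      then show ?thesis using F G by (simp add: is_fB_def)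
    qed
  qed
  with F show ?thesis by blast
qed

lemma ex1_fC: "\<exists>!F. is_fC F"
proof -
  define x :: "rat poly fract" where "x = indet"
  have x: "x \<noteq> 0" "x - inverse x \<noteq> 0"
    using indet_nonzero indet_minus_inverse by (simp_all add: x_def)
  define k where "k = (x + inverse x) / (x - inverse x)"
  have "\<exists>F. F 0 = 1 \<and> (\<forall>d\<ge>1. poly (rat_poly (F d)) (x + inverse x) =
      (x ^ d - inverse x ^ d) * k)"
  proof (rule recurrence_polys)
    show "poly (rat_poly 0) (x + inverse x) = (x ^ 0 - inverse x ^ 0) * k" by simp
    show "poly (rat_poly [:0, 1:]) (x + inverse x) = (x ^ 1 - inverse x ^ 1) * k"
      using x(2) by (simp add: map_poly_pCons k_def)
  qed (rule power_recurrence(1)[OF x(1)])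
  then obtain F where F: "is_fC F" by (auto simp: is_fC_def x_def k_def Let_def)
  have "G = F" if G: "is_fC G" for G
  proof
    fix d show "G d = F d"
    proof (cases "d \<ge> 1")
      case True
      then show ?thesis using F G eval_at_x_inj[of 1 x "G d" "F d"]
        by (simp add: is_fC_def x_def Let_def)
    next
      case False
      then have "d = 0" by simp
      then show ?thesis using F G by (simp add: is_fC_def)
    qed
  qed
  with F show ?thesis by blast
qed

lemma ex1_fD: "\<exists>!F. is_fD F"
proof -
  define x :: "rat poly fract" where "x = indet"
  have x: "x \<noteq> 0" using indet_nonzero by (simp add: x_def)
  have "\<exists>F. F 0 = 1 \<and> (\<forall>d\<ge>1. poly (rat_poly (F d)) (x + inverse x) =
      x ^ d + inverse x ^ d)"
  proof (rule recurrence_polys)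
    show "poly (rat_poly [:2:]) (x + inverse x) = x ^ 0 + inverse x ^ 0"
      by (simp add: map_poly_pCons)
    show "poly (rat_poly [:0, 1:]) (x + inverse x) = x ^ 1 + inverse x ^ 1"
      by (simp add: map_poly_pCons)
  qed (rule power_recurrence(2)[OF x])
  then obtain F where F: "is_fD F" by (auto simp: is_fD_def x_def Let_def)
  have "G = F" if G: "is_fD G" for G
  proof
    fix d show "G d = F d"
    proof (cases "d \<ge> 1")
      case True
      then show ?thesis using F G eval_at_x_inj[of 1 x "G d" "F d"]
        by (simp add: is_fD_def x_def Let_def)
    next
      case False
      then have "d = 0" by simp
      then show ?thesis using F G by (simp add: is_fD_def)
    qed
  qed
  with F show ?thesis by blast
qed

lemma is_fB_fB: "is_fB fB" unfolding fB_def by (rule theI'[OF ex1_fB])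
lemma is_fC_fC: "is_fC fC" unfolding fC_def by (rule theI'[OF ex1_fC])
lemma is_fD_fD: "is_fD fD" unfolding fD_def by (rule theI'[OF ex1_fD])


section \<open>The two sides of the identities\<close>

definition hall_littlewood_minus_one :: "root_type \<Rightarrow> nat \<Rightarrow> weight \<Rightarrow> (weight \<Rightarrow>\<^sub>0 rat) fract" where
  "hall_littlewood_minus_one X n lam = specialize (-1) (hall_littlewood X n lam)"

text \<open>The generalized P-function in the \<open>n\<close> variables \<open>x + 1/x\<close>.\<close>

definition P_symmetrized :: "(nat \<Rightarrow> rat poly) \<Rightarrow> nat \<Rightarrow> nat list \<Rightarrow> (weight \<Rightarrow>\<^sub>0 rat) fract" where
  "P_symmetrized F n lam =
     generalized_P (\<lambda>d. rat_poly (F d)) n (\<lambda>i. wexp (eps i) + inverse (wexp (eps i))) lam"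

end

theory Submission
  imports Defs
begin

text \<open>
  A Weyl group element is recorded as a list \<open>y\<close> that contains, for every \<open>i\<close>, either \<open>x\<^sub>i\<close> or its
  inverse exactly once. Along this list the summand of the Hall--Littlewood function is the product of
  the factors
    \<open>y\<^sub>k ^ \<lambda>\<^sub>k * g y\<^sub>k * (\<Prod>m>k. G y\<^sub>k y\<^sub>m)\<close>  with  \<open>G a b = (a - t b)(a - t/b) / ((a - b)(a - 1/b))\<close>,
  where \<open>g\<close> comes from the roots proportional to a basis vector. Since \<open>G a b\<close> does not change when \<open>b\<close>
  is inverted, the factor of position \<open>k\<close> depends only on \<open>y\<^sub>k\<close> and on the set of variables that come
  later. Hence the sum over all lists can be evaluated one position at a time.

  At the positions beyond the length of \<open>\<lambda>\<close> the exponent is zero, and a partial fraction expansion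
  (\<open>coset_identity\<close>) says that each of these positions contributes a polynomial in \<open>t\<close> alone. The
  same polynomials arise from the same recursion for the sum of \<open>t\<close> to the power of the number of
  inversions (\<open>inversion_generating_function\<close>), and the number of inversions is the length
  (\<open>weyl_length_eq_inversions\<close>). So the contribution of these positions cancels against the Poincare
  polynomial of the stabilizer, and what remains is a sum over the first positions only, which is
  visibly regular at \<open>t = -1\<close> (\<open>hall_littlewood_eq_hl_coset_sum\<close>).

  At \<open>t = -1\<close> the factor \<open>G a b\<close> becomes \<open>(u + v) / (u - v)\<close> with \<open>u = a + 1/a\<close> and \<open>v = b + 1/b\<close>, so
  the sign of \<open>y\<^sub>k\<close> only enters through the one-variable factor, and summing over it gives the value at
  \<open>u\<^sub>k\<close> of the polynomial that belongs to \<open>\<lambda>\<^sub>k\<close> (\<open>coset_sum_minus_one\<close>). The result is a sum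
  over the choices of the first positions that is defined recursively in \<open>partition_sum\<close>.

  The generalized P-function satisfies the same recursion: expand the Pfaffian along the column of
  \<open>\<lambda>\<^sub>1\<close>. What is left in the end is Schur's Pfaffian, which is the product by which the definition
  divides (\<open>bordered_pfaffian\<close>, \<open>generalized_P_eq_partition_sum\<close>).

  In type D only the lists with an even number of inverses occur. If \<open>\<lambda>\<close> has fewer than \<open>n\<close> parts, the
  last entry may be inverted without changing the summand, so that numerator and denominator are both
  half of the sums over all lists. If \<open>\<lambda>\<close> has \<open>n\<close> parts, the lists with an odd number of inverses give
  the function of \<open>\<lambda>'\<close>, which explains the sum of two functions on the left-hand side.
\<close>

section \<open>Partial fractions\<close>

text \<open>Compare the leading coefficients of a polynomial and of its Lagrange interpolant. All partial
  fraction identities below are instances.\<close>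

lemma lagrange_leading_coeff:
  fixes y :: "'k \<Rightarrow> 'a::field"
  assumes "finite K" "inj_on y K" "degree p < card K"
  shows "(\<Sum>k\<in>K. poly p (y k) / (\<Prod>z\<in>K-{k}. y k - y z)) = coeff p (card K - 1)"
proof -
  define b where "b k = poly p (y k) / (\<Prod>z\<in>K-{k}. y k - y z)" for k
  define l where "l k = (\<Prod>z\<in>K-{k}. [:- y z, 1:])" for k
  define L where "L = (\<Sum>k\<in>K. Polynomial.smult (b k) (l k))"
  have deg_l: "degree (l k) = card K - 1" if "k \<in> K" for k
    unfolding l_def using assms(1) that by (subst degree_prod_eq_sum_degree) auto
  have lead_l: "coeff (l k) (card K - 1) = 1" if "k \<in> K" for k
  proof -
    have "lead_coeff (l k) = 1" unfolding l_def by (subst lead_coeff_prod) simp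
    then show ?thesis using deg_l[OF that] by simp
  qed
  have "degree L \<le> card K - 1" unfolding L_def
    by (intro degree_sum_le assms(1)) (metis deg_l degree_smult_le)
  then have deg_L: "degree L < card K" using assms(3) by linarith
  have val: "poly L (y i) = poly p (y i)" if i: "i \<in> K" for i
  proof -
    have "poly (l k) (y i) = (if k = i then (\<Prod>z\<in>K-{i}. y i - y z) else 0)" if "k \<in> K" for k
      using i that assms(1) by (auto simp: l_def poly_prod intro!: prod_zero)
    then have "poly L (y i) = (\<Sum>k\<in>K. if k = i then b i * (\<Prod>z\<in>K-{i}. y i - y z) else 0)"
      unfolding L_def poly_sum by (intro sum.cong) auto
    also have "\<dots> = b i * (\<Prod>z\<in>K-{i}. y i - y z)" using i assms(1) by simp
    also have "\<dots> = poly p (y i)"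
    proof -
      have "(\<Prod>z\<in>K-{i}. y i - y z) \<noteq> 0"
        using assms(1,2) i by (auto simp: inj_on_def)
      then show ?thesis by (simp add: b_def)
    qed
    finally show ?thesis .
  qed
  have "L = p"
    by (rule poly_eqI_degree[of "y ` K"]) (use assms deg_L val in \<open>auto simp: card_image\<close>)
  then have "coeff p (card K - 1) = (\<Sum>k\<in>K. b k * coeff (l k) (card K - 1))"
    by (simp add: L_def coeff_sum flip: \<open>L = p\<close>)
  also have "\<dots> = (\<Sum>k\<in>K. b k)" by (intro sum.cong) (use lead_l in auto)
  finally show ?thesis by (simp add: b_def)
qed

definition node_poly :: "('k \<Rightarrow> 'a::field) \<Rightarrow> 'k set \<Rightarrow> 'a poly" where
  "node_poly y K = (\<Prod>z\<in>K. [:- y z, 1:])"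

lemma degree_node_poly [simp]: "degree (node_poly y K) = card K"
  by (cases "finite K") (simp_all add: node_poly_def degree_prod_eq_sum_degree)

lemma coeff_node_poly_card [simp]: "coeff (node_poly y K) (card K) = 1"
  using lead_coeff_prod[of "\<lambda>z. [:- y z, 1:]" K] degree_node_poly[of y K]
  by (simp add: node_poly_def)

lemma poly_node_poly: "poly (node_poly y K) X = (\<Prod>z\<in>K. X - y z)"
  by (simp add: node_poly_def poly_prod)

lemma poly_node_poly_scaled_at_node:
  assumes "finite K" "k \<in> K"
  shows "poly (node_poly (\<lambda>z. t * y z) K) (y k) = (1 - t) * y k * (\<Prod>z\<in>K-{k}. y k - t * y z)"
  using assms by (simp add: poly_node_poly prod.remove[of K k] algebra_simps)

lemma poly_node_poly_at_node:
  assumes "finite K" "k \<in> K"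
  shows "poly (node_poly y K) (y k) = 0"
  using assms by (simp add: poly_node_poly prod.remove[of K k])

text \<open>Writing \<open>Q\<close> and \<open>D\<close> for the node polynomials of the scaled nodes \<open>t y\<^sub>z\<close> and of the nodes \<open>y\<^sub>z\<close>,
  the polynomial \<open>Q - t^N D\<close> vanishes at \<open>0\<close>. Its quotient by the indeterminate is interpolated at the
  nodes; there \<open>Q\<close> has the value \<open>(1 - t) y\<^sub>k\<close> times the numerator of the \<open>k\<close>-th product.\<close>

lemma sum_ratios_eq_geometric:
  fixes y :: "'k \<Rightarrow> 'a::field"
  assumes fin: "finite K" and inj: "inj_on y K" and nz: "\<And>k. k \<in> K \<Longrightarrow> y k \<noteq> 0"
  shows "(1 - t) * (\<Sum>k\<in>K. \<Prod>z\<in>K-{k}. (y k - t * y z) / (y k - y z)) = 1 - t ^ card K"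
proof (cases "K = {}")
  case False
  then obtain n where n: "card K = Suc n" using fin by (metis card_gt_0_iff gr0_conv_Suc)
  define Q where "Q = node_poly (\<lambda>z. t * y z) K"
  define D where "D = node_poly y K"
  have "poly (Q - Polynomial.smult (t ^ card K) D) 0 = 0"
    by (simp add: Q_def D_def poly_node_poly prod_uminus power_mult_distrib prod.distrib
        flip: mult_minus_right)
  then obtain q where q: "Q - Polynomial.smult (t ^ card K) D = [:0, 1:] * q"
    by (metis poly_eq_0_iff_dvd dvdE minus_zero)
  have "degree (pCons 0 q) \<le> card K"
    using q degree_diff_le[of Q "card K" "Polynomial.smult (t ^ card K) D"]
    by (simp add: Q_def D_def)
  then have dq: "degree q < card K" using n by (cases "q = 0") auto
  have "coeff q (card K - 1) = coeff ([:0, 1:] * q) (card K)"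
    using n by simp
  also have "\<dots> = 1 - t ^ card K"
    unfolding q[symmetric] by (simp add: Q_def D_def)
  finally have cq: "coeff q (card K - 1) = 1 - t ^ card K" .
  have val: "poly q (y k) = (1 - t) * (\<Prod>z\<in>K-{k}. y k - t * y z)" if k: "k \<in> K" for k
  proof -
    have "y k * poly q (y k) = poly (Q - Polynomial.smult (t ^ card K) D) (y k)" unfolding q by simp
    also have "\<dots> = y k * ((1 - t) * (\<Prod>z\<in>K-{k}. y k - t * y z))"
      by (simp add: Q_def D_def poly_node_poly_scaled_at_node[OF fin k]
          poly_node_poly_at_node[OF fin k])
    finally show ?thesis using nz[OF k] by simp
  qed
  show ?thesis
    unfolding cq[symmetric] lagrange_leading_coeff[OF fin inj dq, symmetric] sum_distrib_left
    by (intro sum.cong refl) (simp add: val prod_dividef)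
qed simp

text \<open>The sign \<open>True\<close> stands for the variable itself and \<open>False\<close> for its inverse.\<close>

definition signed :: "'a::field \<Rightarrow> bool \<Rightarrow> 'a" where
  "signed x b = (if b then x else inverse x)"

abbreviation nodes :: "('i \<Rightarrow> 'a::field) \<Rightarrow> 'i \<times> bool \<Rightarrow> 'a" where
  "nodes x \<equiv> (\<lambda>(i, b). signed (x i) b)"

definition generic_on :: "('i \<Rightarrow> 'a::field) \<Rightarrow> 'i set \<Rightarrow> bool" where
  "generic_on x I \<longleftrightarrow> (\<forall>i\<in>I. x i \<noteq> 0) \<and> inj_on (nodes x) (I \<times> UNIV)"

lemma prod_bool: "(\<Prod>b\<in>UNIV. f b) = f True * f False"
  by (simp add: UNIV_bool mult.commute)

lemma sum_bool: "(\<Sum>b\<in>UNIV. f b) = f True + f False"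
  by (simp add: UNIV_bool add.commute)

lemma prod_pairs: "finite I \<Longrightarrow> (\<Prod>z\<in>I \<times> UNIV. f z) = (\<Prod>i\<in>I. f (i, True) * f (i, False))"
  using prod.cartesian_product[of "\<lambda>i b. f (i, b)" "UNIV :: bool set" I]
  by (simp add: prod_bool)

lemma dvd_prod_diff:
  fixes c :: "'a::comm_ring_1"
  assumes "\<And>i. i \<in> I \<Longrightarrow> c dvd a i - b i"
  shows "c dvd prod a I - prod b I"
  using assms
proof (induction I rule: infinite_finite_induct)
  case (insert i I)
  have "prod a (insert i I) - prod b (insert i I) =
      a i * (prod a I - prod b I) + (a i - b i) * prod b I"
    using insert by (simp add: algebra_simps)
  then show ?case using insert by auto
qed auto

text \<open>For a pair of inverse nodes the scaled quadratic factor \<open>X^2 - t v X + t^2\<close> and the factor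
  \<open>t (X^2 - v X + 1)\<close> differ by a multiple of \<open>X^2 - t\<close>.\<close>

lemma paired_node_poly_congruence:
  fixes x :: "'i \<Rightarrow> 'a::field"
  assumes "finite I" "\<And>i. i \<in> I \<Longrightarrow> x i \<noteq> 0"
  shows "[:- t, 0, 1:] dvd node_poly (\<lambda>z. t * nodes x z) (I \<times> UNIV) -
    Polynomial.smult (t ^ card I) (node_poly (nodes x) (I \<times> UNIV))"
proof -
  define a where "a i = [:- (t * x i), 1:] * [:- (t * inverse (x i)), 1:]" for i
  define b where "b i = Polynomial.smult t ([:- x i, 1:] * [:- inverse (x i), 1:])" for i
  have "[:- t, 0, 1:] dvd a i - b i" if "i \<in> I" for i
  proof
    show "a i - b i = [:- t, 0, 1:] * [:1 - t:]"
      using assms(2)[OF that] by (simp add: a_def b_def algebra_simps)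
  qed
  then have "[:- t, 0, 1:] dvd prod a I - prod b I" by (rule dvd_prod_diff)
  moreover have "prod b I = Polynomial.smult (t ^ card I) (\<Prod>i\<in>I. [:- x i, 1:] * [:- inverse (x i), 1:])"
    unfolding b_def by (simp only: prod_smult prod_constant)
  ultimately show ?thesis
    using assms(1) by (simp add: node_poly_def prod_pairs a_def signed_def)
qed

text \<open>The quotient \<open>S\<close> in the preceding congruence has degree at most two less than the number of nodes.
  Interpolating \<open>S\<close> gives the first sum, and interpolating the quotient of \<open>S - S(0) D\<close> by the
  indeterminate gives the second one. The first sum is the correction needed in type B and the
  second one the correction needed in type D, relative to type C, where
  \<open>sum_ratios_eq_geometric\<close> applies directly to the nodes together with their inverses.\<close>

lemma sums_over_signed_nodes:
  fixes x :: "'i \<Rightarrow> 'a::field"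
  assumes fin: "finite I" and gen: "generic_on x I" and "I \<noteq> {}" and t: "t \<noteq> 0"
    and nt: "\<And>k. k \<in> I \<times> UNIV \<Longrightarrow> (nodes x k)\<^sup>2 \<noteq> t"
  defines "R \<equiv> \<lambda>k. \<Prod>z\<in>I\<times>UNIV-{k}. (nodes x k - t * nodes x z) / (nodes x k - nodes x z)"
  shows "(\<Sum>k\<in>I\<times>UNIV. (1 - t) * nodes x k / ((nodes x k)\<^sup>2 - t) * R k) = 0"
    and "t * (\<Sum>k\<in>I\<times>UNIV. (1 - t) / ((nodes x k)\<^sup>2 - t) * R k) = t ^ (2 * card I) - t ^ card I"
proof -
  define K where "K = I \<times> (UNIV :: bool set)"
  define y where "y = nodes x"
  have finK: "finite K" and inj: "inj_on y K" and nz: "\<And>k. k \<in> K \<Longrightarrow> y k \<noteq> 0"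
    and cK: "card K = 2 * card I"
    using fin gen by (auto simp: K_def y_def generic_on_def signed_def card_cartesian_product split: if_splits)
  obtain m where m: "card K = Suc (Suc m)"
    using cK fin \<open>I \<noteq> {}\<close> by (cases "card I") auto
  define Q where "Q = node_poly (\<lambda>z. t * y z) K"
  define D where "D = node_poly y K"
  obtain S where S: "Q - Polynomial.smult (t ^ card I) D = [:- t, 0, 1:] * S"
    using paired_node_poly_congruence[of I x t] fin gen
    unfolding Q_def D_def K_def y_def generic_on_def by (metis dvdE)
  have "degree ([:- t, 0, 1:] * S) \<le> card K"
    unfolding S[symmetric] by (intro degree_diff_le) (simp_all add: Q_def D_def)
  then have degS: "degree S \<le> m"
  proof (cases "S = 0")
    case False
    have "degree ([:- t, 0, 1:] * S) = degree [:- t, 0, 1:] + degree S"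
      by (rule degree_mult_eq) (use False in auto)
    moreover have "degree [:- t, 0, 1:] = 2" by simp
    ultimately show ?thesis using m \<open>degree ([:- t, 0, 1:] * S) \<le> card K\<close> by linarith
  qed simp
  have valS: "(1 - t) * y k * (\<Prod>z\<in>K-{k}. y k - t * y z) = ((y k)\<^sup>2 - t) * poly S (y k)"
    if k: "k \<in> K" for k
  proof -
    have "(1 - t) * y k * (\<Prod>z\<in>K-{k}. y k - t * y z) = poly (Q - Polynomial.smult (t ^ card I) D) (y k)"
      by (simp add: Q_def D_def poly_node_poly_scaled_at_node[OF finK k]
          poly_node_poly_at_node[OF finK k])
    also have "\<dots> = ((y k)\<^sup>2 - t) * poly S (y k)"
      unfolding S by (simp add: algebra_simps power2_eq_square)
    finally show ?thesis .
  qed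
  have quot: "(1 - t) * y k / ((y k)\<^sup>2 - t) * R k =
      poly S (y k) / (\<Prod>z\<in>K-{k}. y k - y z)" if k: "k \<in> K" for k
    using valS[OF k] nt[of k] k
    by (simp add: R_def K_def[symmetric] y_def[symmetric] prod_dividef divide_simps)
  \<comment> \<open>the degree of \<open>S\<close> is too small for a leading coefficient at the number of nodes less one\<close>
  show "(\<Sum>k\<in>I\<times>UNIV. (1 - t) * nodes x k / ((nodes x k)\<^sup>2 - t) * R k) = 0"
    unfolding K_def[symmetric] y_def[symmetric]
    using lagrange_leading_coeff[OF finK inj, of S] degS m
    by (subst sum.cong[OF refl quot]) (simp_all add: coeff_eq_0)
  have D0: "poly D 0 = 1" and Q0: "poly Q 0 = t ^ (2 * card I)"
    using fin gen
    by (simp_all add: D_def Q_def poly_node_poly K_def prod_pairs y_def signed_def generic_on_def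
        power_mult power2_eq_square power_mult_distrib mult_ac)
  define s where "s = poly S 0"
  have s: "t * s = t ^ card I - t ^ (2 * card I)"
    using arg_cong[OF S, of "\<lambda>p. poly p 0"] D0 Q0 by (simp add: s_def algebra_simps)
  have "poly (S - Polynomial.smult s D) 0 = 0" by (simp add: s_def D0)
  then obtain T where T: "S - Polynomial.smult s D = [:0, 1:] * T"
    by (metis poly_eq_0_iff_dvd dvdE minus_zero)
  have "degree (pCons 0 T) \<le> card K"
    using T degree_diff_le[of S "card K" "Polynomial.smult s D"] degS m by (simp add: D_def)
  then have degT: "degree T < card K" using m by (cases "T = 0") auto
  have "coeff T (card K - 1) = coeff ([:0, 1:] * T) (card K)" using m by simp
  also have "\<dots> = - s"
    unfolding T[symmetric] using degS m coeff_node_poly_card[of y K] by (simp add: D_def coeff_eq_0)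
  finally have cT: "coeff T (card K - 1) = - s" .
  have valT: "poly S (y k) = y k * poly T (y k)" if k: "k \<in> K" for k
  proof -
    have "poly (S - Polynomial.smult s D) (y k) = poly S (y k)"
      by (simp add: D_def poly_node_poly_at_node[OF finK k])
    then show ?thesis unfolding T by simp
  qed
  have "(1 - t) / ((y k)\<^sup>2 - t) * R k = poly T (y k) / (\<Prod>z\<in>K-{k}. y k - y z)"
    if k: "k \<in> K" for k
  proof -
    have "y k * ((1 - t) / ((y k)\<^sup>2 - t) * R k) = y k * (poly T (y k) / (\<Prod>z\<in>K-{k}. y k - y z))"
      using quot[OF k] by (simp add: valT[OF k] mult_ac)
    then show ?thesis using nz[OF k] by (simp only: mult_cancel_left) simp
  qed
  then have "(\<Sum>k\<in>K. (1 - t) / ((y k)\<^sup>2 - t) * R k) = - s"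
    using lagrange_leading_coeff[OF finK inj degT] cT by simp
  then show "t * (\<Sum>k\<in>I\<times>UNIV. (1 - t) / ((nodes x k)\<^sup>2 - t) * R k) =
      t ^ (2 * card I) - t ^ card I"
    unfolding K_def[symmetric] y_def[symmetric] using s by simp
qed


section \<open>Coset identities\<close>

definition pair_ratio :: "'a::field \<Rightarrow> 'a \<Rightarrow> 'a \<Rightarrow> 'a" where
  "pair_ratio t a b = ((a - t * b) * (a - t * inverse b)) / ((a - b) * (a - inverse b))"

definition self_ratio :: "root_type \<Rightarrow> 'a::field \<Rightarrow> 'a \<Rightarrow> 'a" where
  "self_ratio X t a = (case X of
     Type_B \<Rightarrow> (a - t) / (a - 1) | Type_C \<Rightarrow> (a\<^sup>2 - t) / (a\<^sup>2 - 1) | Type_D \<Rightarrow> 1)"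

text \<open>The quotient of the Poincare polynomials of two consecutive Weyl groups. In type D all sign changes
  are counted, which makes no difference for the quotient except in rank one, where it is \<open>2\<close>.\<close>

definition coset_poincare :: "root_type \<Rightarrow> 'a::comm_semiring_1 \<Rightarrow> nat \<Rightarrow> 'a" where
  "coset_poincare X t m = (case X of
     Type_D \<Rightarrow> (\<Sum>a<2*m-1. t ^ a) + t ^ (m - 1) | _ \<Rightarrow> (\<Sum>a<2*m. t ^ a))"

lemma pair_ratio_signed: "pair_ratio t a (signed b s) = pair_ratio t a b"
  by (simp add: pair_ratio_def signed_def mult.commute)

lemma generic_on_signed:
  assumes "generic_on x I" "i \<in> I"
  shows "signed (x i) b \<noteq> 0" and "(signed (x i) b)\<^sup>2 \<noteq> 1"
proof -
  have "x i \<noteq> 0" using assms by (auto simp: generic_on_def)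
  have "inj_on (nodes x) (I \<times> UNIV)" using assms by (auto simp: generic_on_def)
  from inj_onD[OF this, of "(i, True)" "(i, False)"] assms(2)
  have "x i \<noteq> inverse (x i)" by (auto simp: signed_def)
  with \<open>x i \<noteq> 0\<close> show "(signed (x i) b)\<^sup>2 \<noteq> 1"
    by (auto simp: signed_def power2_eq_square field_simps)
  show "signed (x i) b \<noteq> 0" using \<open>x i \<noteq> 0\<close> by (simp add: signed_def)
qed

text \<open>The product over all nodes other than \<open>y\<close> splits into the factor of the inverse of \<open>y\<close> and one
  factor \<open>pair_ratio\<close> for each other variable.\<close>

lemma node_ratios:
  fixes x :: "'i \<Rightarrow> 'a::field" and b :: bool
  assumes "finite I" "i \<in> I"
  defines "y \<equiv> signed (x i) b"
  shows "(\<Prod>z\<in>I\<times>UNIV-{(i, b)}. (y - t * nodes x z) / (y - nodes x z)) =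
    (y - t * inverse y) / (y - inverse y) * (\<Prod>j\<in>I-{i}. pair_ratio t y (x j))"
proof -
  have split: "I \<times> UNIV - {(i, b)} = insert (i, \<not> b) ((I - {i}) \<times> UNIV)"
    using assms(2) by auto
  have inv: "signed (x i) (\<not> b) = inverse y" by (simp add: y_def signed_def)
  show ?thesis
    unfolding split using assms(1)
    by (simp add: prod_pairs inv) (simp add: pair_ratio_def signed_def)
qed

text \<open>This is the sum over the possible first entries of a signed arrangement. In type C the factor of
  the inverse node is the factor of the long root, so the sum is the geometric one. The factors of
  types B and D are the factor of type C times \<open>1 + (1 - t) y / (y^2 - t)\<close> and
  \<open>1 - (1 - t) / (y^2 - t)\<close>.\<close>

lemma coset_identity:
  fixes x :: "'i \<Rightarrow> 'a::field"
  assumes fin: "finite I" and gen: "generic_on x I" and ne: "I \<noteq> {}" and t: "t \<noteq> 0" "t \<noteq> 1"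
    and nt: "\<And>k. k \<in> I \<times> UNIV \<Longrightarrow> (nodes x k)\<^sup>2 \<noteq> t"
  shows "(\<Sum>i\<in>I. \<Sum>b\<in>UNIV. self_ratio X t (signed (x i) b) *
            (\<Prod>j\<in>I-{i}. pair_ratio t (signed (x i) b) (x j))) = coset_poincare X t (card I)"
proof -
  define R where "R k = (\<Prod>z\<in>I\<times>UNIV-{k}. (nodes x k - t * nodes x z) / (nodes x k - nodes x z))" for k
  define P where "P k = (\<Prod>j\<in>I-{fst k}. pair_ratio t (nodes x k) (x j))" for k
  define m where "m = card I"
  have m: "m \<ge> 1" using fin ne by (simp add: m_def Suc_le_eq card_gt_0_iff)
  have lhs: "(\<Sum>i\<in>I. \<Sum>b\<in>UNIV. self_ratio X t (signed (x i) b) *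
       (\<Prod>j\<in>I-{i}. pair_ratio t (signed (x i) b) (x j))) =
      (\<Sum>k\<in>I\<times>UNIV. self_ratio X t (nodes x k) * P k)"
    unfolding sum.cartesian_product by (intro sum.cong) (auto simp: P_def)
  have y: "nodes x k \<noteq> 0" "(nodes x k)\<^sup>2 \<noteq> 1" "nodes x k \<noteq> 1" "nodes x k \<noteq> -1"
    and R: "R k = ((nodes x k)\<^sup>2 - t) / ((nodes x k)\<^sup>2 - 1) * P k"
    if "k \<in> I \<times> UNIV" for k
  proof -
    obtain i b where k: "k = (i, b)" "i \<in> I" using \<open>k \<in> I \<times> UNIV\<close> by auto
    show y1: "nodes x k \<noteq> 0" "(nodes x k)\<^sup>2 \<noteq> 1" using generic_on_signed[OF gen k(2)] k by auto
    then show "nodes x k \<noteq> 1" "nodes x k \<noteq> -1" by auto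
    have "(y - t * inverse y) / (y - inverse y) = (y\<^sup>2 - t) / (y\<^sup>2 - 1)" if "y \<noteq> 0" "y\<^sup>2 \<noteq> 1" for y
    proof -
      have "(y - t * inverse y) / (y - inverse y) = (y * (y - t * inverse y)) / (y * (y - inverse y))"
        using that(1) by simp
      also have "\<dots> = (y\<^sup>2 - t) / (y\<^sup>2 - 1)"
        using that(1) by (simp add: right_diff_distrib power2_eq_square mult.left_commute)
      finally show ?thesis .
    qed
    then show "R k = ((nodes x k)\<^sup>2 - t) / ((nodes x k)\<^sup>2 - 1) * P k"
      unfolding R_def P_def using node_ratios[OF fin k(2), of x b t] y1
      by (simp only: k prod.case fst_conv) simp
  qed
  have geo: "(\<Sum>k\<in>I\<times>UNIV. R k) = (\<Sum>a<2*m. t ^ a)"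
  proof -
    have "inj_on (nodes x) (I \<times> UNIV)" using gen by (simp add: generic_on_def)
    then have "(1 - t) * (\<Sum>k\<in>I\<times>UNIV. R k) = 1 - t ^ card (I \<times> (UNIV :: bool set))"
      unfolding R_def by (intro sum_ratios_eq_geometric) (use fin y in auto)
    also have "card (I \<times> (UNIV :: bool set)) = 2 * m" by (simp add: m_def card_cartesian_product)
    also have "1 - t ^ (2 * m) = (1 - t) * (\<Sum>a<2*m. t ^ a)" by (rule one_diff_power_eq)
    finally show ?thesis using t by simp
  qed
  note sums = sums_over_signed_nodes[OF fin gen ne t(1) nt, folded R_def m_def]
  show ?thesis
  proof (cases X)
    case Type_B
    have "self_ratio X t (nodes x k) * P k =
        R k + (1 - t) * nodes x k / ((nodes x k)\<^sup>2 - t) * R k" if k: "k \<in> I \<times> UNIV" for k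
    proof -
      define y where "y = nodes x k"
      have "(y - t) / (y - 1) = (y\<^sup>2 - t) / (y\<^sup>2 - 1) + (1 - t) * y / (y\<^sup>2 - t) * ((y\<^sup>2 - t) / (y\<^sup>2 - 1))"
      proof -
        have 1: "y\<^sup>2 - t \<noteq> 0" "y - 1 \<noteq> 0" "y + 1 \<noteq> 0" "y\<^sup>2 - 1 \<noteq> 0"
          using y[OF k] nt[OF k] by (auto simp: y_def eq_neg_iff_add_eq_0[symmetric])
        have "(y - t) / (y - 1) = ((y - t) * (y + 1)) / ((y - 1) * (y + 1))"
          using 1 by simp
        also have "\<dots> = (y\<^sup>2 - t + (1 - t) * y) / (y\<^sup>2 - 1)"
          by (simp add: algebra_simps power2_eq_square)
        finally show ?thesis using 1 by (simp add: add_divide_distrib)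
      qed
      then have "self_ratio X t y = (y\<^sup>2 - t) / (y\<^sup>2 - 1) +
          (1 - t) * y / (y\<^sup>2 - t) * ((y\<^sup>2 - t) / (y\<^sup>2 - 1))"
        by (simp add: self_ratio_def Type_B)
      then show ?thesis
        unfolding R[OF k] by (simp add: algebra_simps flip: y_def)
    qed
    then have "(\<Sum>k\<in>I\<times>UNIV. self_ratio X t (nodes x k) * P k) =
        (\<Sum>k\<in>I\<times>UNIV. R k) + (\<Sum>k\<in>I\<times>UNIV. (1 - t) * nodes x k / ((nodes x k)\<^sup>2 - t) * R k)"
      by (simp add: sum.distrib)
    then show ?thesis unfolding lhs using sums(1) geo by (simp add: coset_poincare_def Type_B m_def)
  next
    case Type_C
    have "self_ratio X t (nodes x k) * P k = R k" if k: "k \<in> I \<times> UNIV" for k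
      unfolding R[OF k] by (simp add: self_ratio_def Type_C)
    then show ?thesis unfolding lhs using geo by (simp add: coset_poincare_def Type_C m_def)
  next
    case Type_D
    have "self_ratio X t (nodes x k) * P k =
        R k - (1 - t) / ((nodes x k)\<^sup>2 - t) * R k" if k: "k \<in> I \<times> UNIV" for k
    proof -
      define y where "y = nodes x k"
      have 1: "y\<^sup>2 - t \<noteq> 0" "y\<^sup>2 - 1 \<noteq> 0" using y[OF k] nt[OF k] by (auto simp: y_def)
      have "(y\<^sup>2 - t) / (y\<^sup>2 - 1) - (1 - t) / (y\<^sup>2 - t) * ((y\<^sup>2 - t) / (y\<^sup>2 - 1)) =
          ((y\<^sup>2 - t) - (1 - t)) / (y\<^sup>2 - 1)"
      proof -
        have "(1 - t) / (y\<^sup>2 - t) * ((y\<^sup>2 - t) / (y\<^sup>2 - 1)) = (1 - t) / (y\<^sup>2 - 1)" using 1 by simp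
        then show ?thesis by (simp only: diff_divide_distrib[of "y\<^sup>2 - t"])
      qed
      also have "\<dots> = 1" using 1 by simp
      finally have "self_ratio X t y = (y\<^sup>2 - t) / (y\<^sup>2 - 1) -
          (1 - t) / (y\<^sup>2 - t) * ((y\<^sup>2 - t) / (y\<^sup>2 - 1))"
        by (simp add: self_ratio_def Type_D)
      then show ?thesis
        by (simp only: R[OF k] y_def[symmetric] left_diff_distrib mult.assoc)
    qed
    then have "(\<Sum>k\<in>I\<times>UNIV. self_ratio X t (nodes x k) * P k) =
        (\<Sum>k\<in>I\<times>UNIV. R k) - (\<Sum>k\<in>I\<times>UNIV. (1 - t) / ((nodes x k)\<^sup>2 - t) * R k)"
      by (simp add: sum_subtractf)
    moreover have "(\<Sum>k\<in>I\<times>UNIV. (1 - t) / ((nodes x k)\<^sup>2 - t) * R k) = t ^ (2 * m - 1) - t ^ (m - 1)"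
    proof -
      have "t * (t ^ (2 * m - 1) - t ^ (m - 1)) = t ^ (2 * m) - t ^ m"
        using m by (cases m) (simp_all add: algebra_simps)
      with sums(2) have "t * (\<Sum>k\<in>I\<times>UNIV. (1 - t) / ((nodes x k)\<^sup>2 - t) * R k) =
          t * (t ^ (2 * m - 1) - t ^ (m - 1))" by (rule trans[OF _ sym])
      then show ?thesis using t(1) by (simp only: mult_cancel_left) simp
    qed
    moreover have "(\<Sum>a<2*m. t ^ a) = (\<Sum>a<2*m-1. t ^ a) + t ^ (2 * m - 1)"
      using m by (cases "2 * m") auto
    ultimately show ?thesis unfolding lhs using geo by (simp add: coset_poincare_def Type_D m_def)
  qed
qed

section \<open>Signed arrangements\<close>

text \<open>The window notation of signed permutations of \<open>I\<close>: position \<open>k\<close> of the list shows the image of the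
  \<open>k\<close>-th basis vector.\<close>

definition arrangements :: "nat set \<Rightarrow> (nat \<times> bool) list set" where
  "arrangements I = {ys. distinct (map fst ys) \<and> fst ` set ys = I}"

lemma arrangements_empty [simp]: "arrangements {} = {[]}"
  by (auto simp: arrangements_def)

lemma arrangements_Cons:
  "(i, b) # ys \<in> arrangements I \<longleftrightarrow> i \<in> I \<and> ys \<in> arrangements (I - {i})"
  by (auto simp: arrangements_def)

lemma arrangements_eq_image:
  assumes "I \<noteq> {}"
  shows "bij_betw (\<lambda>(k, ys). k # ys) (SIGMA k:I\<times>UNIV. arrangements (I - {fst k})) (arrangements I)"
proof (intro bij_betw_imageI equalityI subsetI)
  fix ys assume ys: "ys \<in> arrangements I"
  then obtain k zs where "ys = k # zs"
    using assms by (cases ys) (auto simp: arrangements_def)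
  then show "ys \<in> (\<lambda>(k, ys). k # ys) ` (SIGMA k:I\<times>UNIV. arrangements (I - {fst k}))"
    using ys by (cases k) (auto simp: arrangements_Cons intro!: image_eqI[of _ _ "(k, zs)"])
qed (auto simp: inj_on_def arrangements_Cons)

lemma length_arrangement: "ys \<in> arrangements I \<Longrightarrow> length ys = card I"
  by (metis (mono_tags, lifting) arrangements_def distinct_card length_map list.set_map mem_Collect_eq)

lemma finite_arrangements: "finite I \<Longrightarrow> finite (arrangements I)"
  by (rule finite_subset[OF _ finite_lists_length_eq[of "I \<times> UNIV" "card I"]])
    (auto simp: length_arrangement, force simp: arrangements_def)

lemma sum_arrangements:
  assumes "finite I" "I \<noteq> {}"
  shows "(\<Sum>ys\<in>arrangements I. f ys) =
    (\<Sum>i\<in>I. \<Sum>b\<in>UNIV. \<Sum>ys\<in>arrangements (I - {i}). f ((i, b) # ys))"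
proof -
  have "(\<Sum>ys\<in>arrangements I. f ys) =
      (\<Sum>(k, ys)\<in>(SIGMA k:I\<times>UNIV. arrangements (I - {fst k})). f (k # ys))"
    using sum.reindex_bij_betw[OF arrangements_eq_image[OF assms(2)], of f]
    by (simp add: case_prod_unfold)
  also have "\<dots> = (\<Sum>k\<in>I\<times>UNIV. \<Sum>ys\<in>arrangements (I - {fst k}). f (k # ys))"
    using assms(1) by (subst sum.Sigma) (auto intro: finite_arrangements)
  also have "\<dots> = (\<Sum>i\<in>I. \<Sum>b\<in>UNIV. \<Sum>ys\<in>arrangements (I - {i}). f ((i, b) # ys))"
    using sum.cartesian_product[of "\<lambda>i b. \<Sum>ys\<in>arrangements (I - {i}). f ((i, b) # ys)" UNIV I]
    by (simp only: case_prod_unfold prod.collapse)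
  finally show ?thesis .
qed

text \<open>The second argument of \<open>h\<close> is an index without sign: a pair factor does not depend on the sign of
  the later entry. This is what makes the recursion over the first entry possible.\<close>

fun weight_product ::
  "(nat \<times> bool \<Rightarrow> 'a::comm_monoid_mult) \<Rightarrow> (nat \<times> bool \<Rightarrow> nat \<Rightarrow> 'a) \<Rightarrow> (nat \<times> bool) list \<Rightarrow> 'a" where
  "weight_product g h [] = 1"
| "weight_product g h (y # ys) = g y * prod_list (map (h y \<circ> fst) ys) * weight_product g h ys"

text \<open>Here \<open>ds\<close> is the list of exponents. Only as many entries are chosen as there are exponents, so that
  this is a sum over the cosets of the stabilizer.\<close>

fun coset_sum :: "(nat \<times> bool \<Rightarrow> 'a::comm_ring_1) \<Rightarrow> (nat \<times> bool \<Rightarrow> nat \<Rightarrow> 'a) \<Rightarrow>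
    (nat \<Rightarrow> nat \<times> bool \<Rightarrow> 'a) \<Rightarrow> nat list \<Rightarrow> nat set \<Rightarrow> 'a" where
  "coset_sum g h e [] I = 1"
| "coset_sum g h e (d # ds) I = (\<Sum>i\<in>I. \<Sum>b\<in>UNIV.
     e d (i, b) * (g (i, b) * (\<Prod>j\<in>I-{i}. h (i, b) j)) * coset_sum g h e ds (I - {i}))"

lemma prod_list_arrangement:
  assumes "ys \<in> arrangements I"
  shows "prod_list (map (f \<circ> fst) ys) = prod f I"
  using assms prod.distinct_set_conv_list[of "map fst ys" f] by (simp add: arrangements_def)

lemma sum_weight_product:
  fixes g :: "nat \<times> bool \<Rightarrow> 'a::comm_ring_1"
  assumes "finite I" and "\<And>J. J \<subseteq> I \<Longrightarrow> J \<noteq> {} \<Longrightarrow>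
    (\<Sum>i\<in>J. \<Sum>b\<in>UNIV. g (i, b) * (\<Prod>j\<in>J-{i}. h (i, b) j)) = c (card J)"
  shows "(\<Sum>ys\<in>arrangements I. weight_product g h ys) = (\<Prod>m=1..card I. c m)"
  using assms
proof (induction "card I" arbitrary: I)
  case (Suc n)
  have "I \<noteq> {}" using Suc.hyps(2) by auto
  have IH: "(\<Sum>ys\<in>arrangements (I - {i}). weight_product g h ys) = (\<Prod>m=1..n. c m)" if "i \<in> I" for i
  proof -
    have "n = card (I - {i})" using that Suc by simp
    moreover have "(\<Sum>ys\<in>arrangements (I - {i}). weight_product g h ys) = (\<Prod>m=1..card (I - {i}). c m)"
      by (rule Suc.hyps(1)) (use Suc.prems \<open>n = card (I - {i})\<close> in \<open>auto intro!: Suc.prems(2)\<close>)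
    ultimately show ?thesis by simp
  qed
  have "(\<Sum>ys\<in>arrangements I. weight_product g h ys) = (\<Sum>i\<in>I. \<Sum>b\<in>UNIV. g (i, b) *
      (\<Prod>j\<in>I-{i}. h (i, b) j) * (\<Sum>ys\<in>arrangements (I - {i}). weight_product g h ys))"
    unfolding sum_arrangements[OF Suc.prems(1) \<open>I \<noteq> {}\<close>] sum_distrib_left
    by (intro sum.cong refl) (simp add: prod_list_arrangement)
  also have "\<dots> = (\<Sum>i\<in>I. \<Sum>b\<in>UNIV. g (i, b) * (\<Prod>j\<in>I-{i}. h (i, b) j)) * (\<Prod>m=1..n. c m)"
    unfolding sum_distrib_right by (intro sum.cong refl) (simp add: IH)
  also have "\<dots> = (\<Prod>m=1..card I. c m)"
    using Suc.prems(2)[of I] \<open>I \<noteq> {}\<close> by (simp flip: Suc.hyps(2) add: mult.commute)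
  finally show ?case .
qed auto

text \<open>Sum over the first entry, and use that its factor is independent of the arrangement of the remaining
  indices. The positions beyond the length of \<open>ds\<close> carry no exponent; they contribute the
  constants \<open>c\<close>.\<close>

lemma sum_weighted_arrangements:
  fixes g :: "nat \<times> bool \<Rightarrow> 'a::comm_ring_1"
  assumes "finite I" and "\<And>J. J \<subseteq> I \<Longrightarrow> J \<noteq> {} \<Longrightarrow>
      (\<Sum>i\<in>J. \<Sum>b\<in>UNIV. g (i, b) * (\<Prod>j\<in>J-{i}. h (i, b) j)) = c (card J)"
    and "length ds \<le> card I"
  shows "(\<Sum>ys\<in>arrangements I. prod_list (map2 e ds ys) * weight_product g h ys) =
    coset_sum g h e ds I * (\<Prod>m=1..card I - length ds. c m)"
  using assms
proof (induction ds arbitrary: I)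
  case Nil
  then show ?case by (simp add: sum_weight_product)
next
  case (Cons d ds)
  have "I \<noteq> {}" using Cons.prems(3) by auto
  let ?M = "\<Prod>m=1..card I - length (d # ds). c m"
  have IH: "(\<Sum>ys\<in>arrangements (I - {i}). prod_list (map2 e ds ys) * weight_product g h ys) =
      coset_sum g h e ds (I - {i}) * ?M" if "i \<in> I" for i
  proof -
    have "card (I - {i}) - length ds = card I - length (d # ds)" using that Cons.prems(1) by simp
    moreover have "(\<Sum>ys\<in>arrangements (I - {i}). prod_list (map2 e ds ys) * weight_product g h ys) =
        coset_sum g h e ds (I - {i}) * (\<Prod>m=1..card (I - {i}) - length ds. c m)"
      by (rule Cons.IH) (use Cons.prems that in \<open>auto intro!: Cons.prems(2)\<close>)
    ultimately show ?thesis by simp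
  qed
  have "(\<Sum>ys\<in>arrangements I. prod_list (map2 e (d # ds) ys) * weight_product g h ys) =
      (\<Sum>i\<in>I. \<Sum>b\<in>UNIV. e d (i, b) * (g (i, b) * (\<Prod>j\<in>I-{i}. h (i, b) j)) *
        (\<Sum>ys\<in>arrangements (I - {i}). prod_list (map2 e ds ys) * weight_product g h ys))"
    unfolding sum_arrangements[OF Cons.prems(1) \<open>I \<noteq> {}\<close>] sum_distrib_left
    by (intro sum.cong refl) (simp add: prod_list_arrangement mult_ac)
  also have "\<dots> = coset_sum g h e (d # ds) I * ?M"
    unfolding coset_sum.simps sum_distrib_right
    by (intro sum.cong refl; subst IH; simp only: mult_ac)
  finally show ?case .
qed

section \<open>The Weyl group as a set of signed arrangements\<close>

definition signed_perm :: "(nat \<Rightarrow> nat) \<Rightarrow> (nat \<Rightarrow> int) \<Rightarrow> weight \<Rightarrow> weight" where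
  "signed_perm \<sigma> s v =
     Abs_poly_mapping (\<lambda>k. s (inv_into UNIV \<sigma> k) * Poly_Mapping.lookup v (inv_into UNIV \<sigma> k))"

lemma lookup_signed_perm:
  assumes "bij \<sigma>"
  shows "Poly_Mapping.lookup (signed_perm \<sigma> s v) (\<sigma> i) = s i * Poly_Mapping.lookup v i"
proof -
  have left: "inv_into UNIV \<sigma> (\<sigma> i) = i" for i using assms by (simp add: bij_is_inj)
  have surj: "\<sigma> (inv_into UNIV \<sigma> k) = k" for k using assms by (simp add: bij_is_surj surj_f_inv_f)
  have "{k. s (inv_into UNIV \<sigma> k) * Poly_Mapping.lookup v (inv_into UNIV \<sigma> k) \<noteq> 0} \<subseteq> \<sigma> ` Poly_Mapping.keys v"
  proof
    fix k assume "k \<in> {k. s (inv_into UNIV \<sigma> k) * Poly_Mapping.lookup v (inv_into UNIV \<sigma> k) \<noteq> 0}"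
    then have "inv_into UNIV \<sigma> k \<in> Poly_Mapping.keys v" by (auto simp: in_keys_iff)
    then show "k \<in> \<sigma> ` Poly_Mapping.keys v" using surj by (metis imageI)
  qed
  then have "finite {k. s (inv_into UNIV \<sigma> k) * Poly_Mapping.lookup v (inv_into UNIV \<sigma> k) \<noteq> 0}"
    by (rule finite_subset) simp
  then show ?thesis
    unfolding signed_perm_def by (subst lookup_Abs_poly_mapping) (simp_all add: left)
qed

text \<open>Beyond the end of the list the identity is used, as the action fixes all further coordinates.\<close>

definition perm_of :: "(nat \<times> bool) list \<Rightarrow> nat \<Rightarrow> nat" where
  "perm_of ys i = (if i < length ys then fst (ys ! i) else i)"

definition sign_of :: "(nat \<times> bool) list \<Rightarrow> nat \<Rightarrow> int" where
  "sign_of ys i = (if i < length ys \<and> \<not> snd (ys ! i) then -1 else 1)"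

definition weyl_action :: "(nat \<times> bool) list \<Rightarrow> weight \<Rightarrow> weight" where
  "weyl_action ys = signed_perm (perm_of ys) (sign_of ys)"

definition negations :: "(nat \<times> bool) list \<Rightarrow> nat" where
  "negations ys = length (filter (\<lambda>y. \<not> snd y) ys)"

definition weyl_arrangements :: "root_type \<Rightarrow> nat set \<Rightarrow> (nat \<times> bool) list set" where
  "weyl_arrangements X I = {ys \<in> arrangements I. X = Type_D \<longrightarrow> even (negations ys)}"

definition list_perm :: "nat list \<Rightarrow> nat \<Rightarrow> nat" where
  "list_perm ys i = (if i < length ys then ys ! i else i)"

lemma list_perm_permutes:
  assumes "distinct ys" "set ys = {..<n}"
  shows "list_perm ys permutes {..<n}"
proof (rule bij_imp_permutes)
  have len: "length ys = n" using assms distinct_card[of ys] by simp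
  have "bij_betw ((!) ys) {..<length ys} (set ys)" by (rule bij_betw_nth[OF assms(1)]) auto
  then have "bij_betw ((!) ys) {..<n} {..<n}" using assms len by simp
  then show "bij_betw (list_perm ys) {..<n} {..<n}"
    by (rule bij_betw_cong[THEN iffD1, rotated]) (simp add: list_perm_def len)
  show "list_perm ys i = i" if "i \<notin> {..<n}" for i using that len by (simp add: list_perm_def)
qed

lemma perm_of_permutes:
  assumes "ys \<in> arrangements {..<n}"
  shows "perm_of ys permutes {..<n}"
proof -
  have "perm_of ys = list_perm (map fst ys)" by (auto simp: fun_eq_iff perm_of_def list_perm_def)
  then show ?thesis using assms by (simp add: list_perm_permutes arrangements_def)
qed

lemma lookup_weyl_action:
  assumes "ys \<in> arrangements {..<n}"
  shows "Poly_Mapping.lookup (weyl_action ys v) (perm_of ys i) = sign_of ys i * Poly_Mapping.lookup v i"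
  unfolding weyl_action_def
  by (rule lookup_signed_perm) (use perm_of_permutes[OF assms] permutes_bij in blast)

lemma weyl_action_eqI:
  assumes "ys \<in> arrangements {..<n}"
    and "\<And>i. Poly_Mapping.lookup u (perm_of ys i) = sign_of ys i * Poly_Mapping.lookup v i"
  shows "weyl_action ys v = u"
proof (rule poly_mapping_eqI)
  fix k
  obtain i where "k = perm_of ys i"
    using perm_of_permutes[OF assms(1)] by (metis permutes_surj surjD)
  then show "Poly_Mapping.lookup (weyl_action ys v) k = Poly_Mapping.lookup u k"
    using assms by (simp add: lookup_weyl_action)
qed

lemma sign_of_cases: "sign_of ys i = 1 \<or> sign_of ys i = -1"
  by (simp add: sign_of_def)

lemma negations_eq_card: "negations ys = card {i. sign_of ys i = -1}"
proof -
  have "{i. sign_of ys i = -1} = {i. i < length ys \<and> \<not> snd (ys ! i)}"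
    by (auto simp: sign_of_def)
  then show ?thesis by (simp add: negations_def length_filter_conv_card)
qed

lemma lookup_eps: "Poly_Mapping.lookup (eps i) j = (if i = j then 1 else 0)"
  by (simp add: eps_def lookup_single when_def)

lemma inj_weyl_action: "inj_on weyl_action (arrangements {..<n})"
proof (rule inj_onI)
  fix ys zs assume ys: "ys \<in> arrangements {..<n}" and zs: "zs \<in> arrangements {..<n}"
    and eq: "weyl_action ys = weyl_action zs"
  have len: "length ys = n" "length zs = n"
    using length_arrangement[OF ys] length_arrangement[OF zs] by auto
  have same: "perm_of ys i = perm_of zs i \<and> sign_of ys i = sign_of zs i" for i
  proof -
    obtain j where j: "perm_of zs i = perm_of ys j"
      using perm_of_permutes[OF ys] by (metis permutes_surj surjD)
    have "sign_of zs i = Poly_Mapping.lookup (weyl_action zs (eps i)) (perm_of zs i)"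
      by (simp add: lookup_weyl_action[OF zs] lookup_eps)
    also have "\<dots> = sign_of ys j * Poly_Mapping.lookup (eps i) j"
      unfolding j eq[symmetric] by (rule lookup_weyl_action[OF ys])
    finally show ?thesis using sign_of_cases[of zs i] j by (auto simp: lookup_eps split: if_splits)
  qed
  show "ys = zs"
  proof (rule nth_equalityI)
    fix i assume "i < length ys"
    then show "ys ! i = zs ! i"
      using same[of i] len by (auto simp: perm_of_def sign_of_def prod_eq_iff split: if_splits)
  qed (simp add: len)
qed

text \<open>The determining equation of a Weyl group element prescribes all coordinates of the image, because
  the permutation is onto; so an element is the same thing as its window.\<close>

lemma weyl_action_image: "weyl_action ` weyl_arrangements X {..<n} = weyl_group X n"
proof (intro equalityI subsetI)
  fix w assume "w \<in> weyl_action ` weyl_arrangements X {..<n}"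
  then obtain ys where ys: "ys \<in> arrangements {..<n}" "X = Type_D \<longrightarrow> even (negations ys)"
    and w: "w = weyl_action ys" by (auto simp: weyl_arrangements_def)
  have "\<forall>i\<ge>n. sign_of ys i = 1" using length_arrangement[OF ys(1)] by (simp add: sign_of_def)
  moreover have "X = Type_D \<longrightarrow> even (card {i. sign_of ys i = -1})"
    using ys(2) by (simp add: negations_eq_card)
  ultimately show "w \<in> weyl_group X n" unfolding weyl_group_def w
    using perm_of_permutes[OF ys(1)] lookup_weyl_action[OF ys(1)] sign_of_cases[of ys]
    by (intro CollectI exI[of _ "perm_of ys"] exI[of _ "sign_of ys"]) simp
next
  fix w assume "w \<in> weyl_group X n"
  then obtain \<sigma> s where \<sigma>: "\<sigma> permutes {..<n}" and s: "\<forall>i<n. s i = 1 \<or> s i = -1" "\<forall>i\<ge>n. s i = 1"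
    and par: "X = Type_D \<longrightarrow> even (card {i. s i = -1})"
    and w: "\<And>v i. Poly_Mapping.lookup (w v) (\<sigma> i) = s i * Poly_Mapping.lookup v i"
    unfolding weyl_group_def by blast
  define ys where "ys = map (\<lambda>i. (\<sigma> i, s i = 1)) [0..<n]"
  have sgn: "sign_of ys = s"
  proof
    show "sign_of ys i = s i" for i using s by (cases "i < n") (auto simp: sign_of_def ys_def)
  qed
  have perm: "perm_of ys = \<sigma>"
    using permutes_not_in[OF \<sigma>] by (auto simp: perm_of_def ys_def fun_eq_iff)
  have "distinct (map fst ys)" "fst ` set ys = {..<n}"
    using permutes_inj_on[OF \<sigma>, of "{0..<n}"] permutes_image[OF \<sigma>]
    by (auto simp: ys_def distinct_map o_def image_image atLeast0LessThan)
  then have A: "ys \<in> arrangements {..<n}" by (simp add: arrangements_def)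
  moreover have "X = Type_D \<longrightarrow> even (negations ys)" using par by (simp add: negations_eq_card sgn)
  moreover have "w = weyl_action ys"
    by (rule ext, rule weyl_action_eqI[OF A, symmetric]) (simp add: perm sgn w)
  ultimately show "w \<in> weyl_action ` weyl_arrangements X {..<n}"
    by (auto simp: weyl_arrangements_def)
qed

lemma bij_betw_weyl_action: "bij_betw weyl_action (weyl_arrangements X {..<n}) (weyl_group X n)"
  by (rule bij_betw_imageI[OF inj_on_subset[OF inj_weyl_action] weyl_action_image])
    (auto simp: weyl_arrangements_def)

subsection \<open>Simple roots\<close>

text \<open>A linear form that takes its minimum over the positive roots at the roots that are listed as simple.
  A sum of two positive roots has at least twice this height, so these roots are indecomposable.\<close>

definition root_height :: "root_type \<Rightarrow> nat \<Rightarrow> weight \<Rightarrow> int" where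
  "root_height X n v = (\<Sum>i<n. Poly_Mapping.lookup v i * (case X of
     Type_B \<Rightarrow> int n - int i | Type_C \<Rightarrow> 2 * (int n - int i) - 1 | Type_D \<Rightarrow> int n - int i - 1))"

lemma root_height_add: "root_height X n (v + w) = root_height X n v + root_height X n w"
  by (simp add: root_height_def lookup_add distrib_right sum.distrib)

lemma root_height_diff: "root_height X n (v - w) = root_height X n v - root_height X n w"
  by (simp add: root_height_def lookup_minus left_diff_distrib sum_subtractf)

lemma lookup_double: "Poly_Mapping.lookup (2 * v :: weight) k = 2 * Poly_Mapping.lookup v k"
  unfolding mult_2 by (rule lookup_add)

lemma root_height_double: "root_height X n (2 * v) = 2 * root_height X n v"
  unfolding mult_2 by (rule root_height_add)

lemma root_height_eps: "i < n \<Longrightarrow> root_height X n (eps i) = (case X of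
     Type_B \<Rightarrow> int n - int i | Type_C \<Rightarrow> 2 * (int n - int i) - 1 | Type_D \<Rightarrow> int n - int i - 1)"
  by (simp add: root_height_def lookup_eps if_distrib[of "\<lambda>x. x * _"] cong: if_cong)

lemma root_height_positive:
  assumes "\<alpha> \<in> positive_roots X n"
  shows "root_height X n \<alpha> \<ge> (if X = Type_C then 2 else 1)"
  using assms by (cases X) (auto simp: positive_roots_def root_height_add root_height_diff root_height_eps root_height_double)

definition end_roots :: "root_type \<Rightarrow> nat \<Rightarrow> weight set" where
  "end_roots X n = (case X of Type_B \<Rightarrow> {eps i |i. Suc i = n}
     | Type_C \<Rightarrow> {eps i + eps i |i. Suc i = n} | Type_D \<Rightarrow> {eps i + eps (Suc i) |i. Suc (Suc i) = n})"

text \<open>Every other positive root is decomposed explicitly; for the listed ones see \<open>root_height\<close>.\<close>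

lemma simple_roots_eq:
  "simple_roots X n = {eps i - eps (Suc i) |i. Suc i < n} \<union> end_roots X n"
proof (intro equalityI subsetI)
  fix \<alpha> assume \<alpha>: "\<alpha> \<in> simple_roots X n"
  then have pos: "\<alpha> \<in> positive_roots X n"
    and indec: "\<And>\<beta> \<gamma>. \<beta> \<in> positive_roots X n \<Longrightarrow> \<gamma> \<in> positive_roots X n \<Longrightarrow> \<alpha> \<noteq> \<beta> + \<gamma>"
    by (auto simp: simple_roots_def)
  have m: "eps i - eps j \<in> positive_roots X n" and p: "eps i + eps j \<in> positive_roots X n"
    if "i < j" "j < n" for i j
    using that by (auto simp: positive_roots_def)
  have e: "eps i \<in> positive_roots X n" if "X = Type_B" "i < n" for i
    using that by (auto simp: positive_roots_def)
  have d: "eps i + eps i \<in> positive_roots X n" if "X = Type_C" "i < n" for i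
    using that by (auto simp: positive_roots_def)
  consider (minus) i j where "\<alpha> = eps i - eps j" "i < j" "j < n"
    | (plus) i j where "\<alpha> = eps i + eps j" "i < j" "j < n"
    | (short) i where "X = Type_B" "\<alpha> = eps i" "i < n"
    | (long) i where "X = Type_C" "\<alpha> = eps i + eps i" "i < n"
    using pos by (cases X) (auto simp: positive_roots_def)
  then show "\<alpha> \<in> {eps i - eps (Suc i) |i. Suc i < n} \<union> end_roots X n"
  proof cases
    case minus
    have "j = Suc i"
      using minus indec[OF m[of i "Suc i"] m[of "Suc i" j]] by (cases "j = Suc i") auto
    with minus show ?thesis by auto
  next
    case plus
    show ?thesis
    proof (cases X)
      case Type_B
      then show ?thesis using plus indec[OF e[of i] e[of j]] by auto
    next
      case Type_C
      then show ?thesis using plus indec[OF m[of i j] d[of j]] by auto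
    next
      case Type_D
      obtain k where k: "n = Suc (Suc k)" using plus by (metis less_imp_Suc_add not_less_eq less_antisym not_less_zero Suc_lessE)
      have "j = Suc k"
        using plus indec[OF m[of i "Suc k"] p[of j "Suc k"]] k by (cases "j = Suc k") auto
      moreover have "i = k"
        using plus indec[OF m[of i k] p[of k "Suc k"]] k \<open>j = Suc k\<close> by (cases "i = k") auto
      ultimately have "\<alpha> = eps k + eps (Suc k)" using plus by simp
      then show ?thesis using k Type_D by (simp add: end_roots_def)
    qed
  next
    case short
    obtain k where k: "n = Suc k" using short by (cases n) auto
    have "i = k" using short indec[OF m[of i k] e[of k]] k by (cases "i = k") auto
    then show ?thesis using short k by (auto simp: end_roots_def)
  next
    case long
    obtain k where k: "n = Suc k" using long by (cases n) auto
    have "i = k" using long indec[OF m[of i k] p[of i k]] k by (cases "i = k") auto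
    then show ?thesis using long k by (auto simp: end_roots_def)
  qed
next
  fix \<alpha> assume \<alpha>: "\<alpha> \<in> {eps i - eps (Suc i) |i. Suc i < n} \<union> end_roots X n"
  then have pos: "\<alpha> \<in> positive_roots X n"
    by (cases X) (force simp: positive_roots_def end_roots_def)+
  have "root_height X n \<alpha> = (if X = Type_C then 2 else 1)"
    using \<alpha> by (cases X) (auto simp: end_roots_def root_height_add root_height_diff root_height_eps
        root_height_double)
  then have "\<alpha> \<noteq> \<beta> + \<gamma>" if "\<beta> \<in> positive_roots X n" "\<gamma> \<in> positive_roots X n" for \<beta> \<gamma>
    using root_height_positive[OF that(1)] root_height_positive[OF that(2)]
    by (auto simp: root_height_add split: if_splits)
  with pos show "\<alpha> \<in> simple_roots X n" by (auto simp: simple_roots_def)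
qed

lemma weight_inner_superset:
  assumes "finite F" "\<And>k. k \<notin> F \<Longrightarrow> Poly_Mapping.lookup w k = 0"
  shows "weight_inner v w = (\<Sum>k\<in>F. Poly_Mapping.lookup v k * Poly_Mapping.lookup w k)"
proof -
  have "weight_inner v w = (\<Sum>k\<in>F \<union> Poly_Mapping.keys v. Poly_Mapping.lookup v k * Poly_Mapping.lookup w k)"
    unfolding weight_inner_def using assms(1) by (intro sum.mono_neutral_left) (auto simp: in_keys_iff)
  also have "\<dots> = (\<Sum>k\<in>F. Poly_Mapping.lookup v k * Poly_Mapping.lookup w k)"
    using assms by (intro sum.mono_neutral_right) auto
  finally show ?thesis .
qed

lemma weight_inner_eps: "weight_inner v (eps i) = Poly_Mapping.lookup v i"
  by (subst weight_inner_superset[of "{i}"]) (auto simp: lookup_eps)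

lemma weight_inner_eps_pair:
  assumes "i \<noteq> j"
  shows "weight_inner v (eps i - eps j) = Poly_Mapping.lookup v i - Poly_Mapping.lookup v j"
    and "weight_inner v (eps i + eps j) = Poly_Mapping.lookup v i + Poly_Mapping.lookup v j"
  using assms
  by (subst weight_inner_superset[of "{i, j}"]; auto simp: lookup_eps lookup_minus lookup_add)+

lemma lookup_reflection_eps:
  "Poly_Mapping.lookup (reflection (eps i) v) k = (if k = i then - 1 else 1) * Poly_Mapping.lookup v k"
  by (simp add: reflection_def lookup_minus lookup_eps weight_inner_eps)

text \<open>The reflection depends only on the line of the root, so types B and C share it.\<close>

lemma reflection_double: "reflection (eps i + eps i) = reflection (eps i)"
proof
  fix v
  have "weight_inner v (eps i + eps i) = 2 * Poly_Mapping.lookup v i" for v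
    by (subst weight_inner_superset[of "{i}"]) (auto simp: lookup_eps lookup_double)
  then show "reflection (eps i + eps i) v = reflection (eps i) v"
    by (intro poly_mapping_eqI)
      (simp add: reflection_def lookup_minus lookup_double weight_inner_eps lookup_eps)
qed

lemma lookup_reflection_pair:
  assumes "i \<noteq> j"
  shows "Poly_Mapping.lookup (reflection (eps i - eps j) v) k = Poly_Mapping.lookup v (transpose i j k)"
    and "Poly_Mapping.lookup (reflection (eps i + eps j) v) k =
      (if k = i \<or> k = j then - 1 else 1) * Poly_Mapping.lookup v (transpose i j k)"
  using assms
  by (auto simp: reflection_def lookup_minus lookup_add lookup_eps weight_inner_eps_pair
      transpose_def)

subsection \<open>Length and inversions\<close>

definition flip :: "nat \<times> bool \<Rightarrow> nat \<times> bool" where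
  "flip y = (fst y, \<not> snd y)"

text \<open>Composing with a simple reflection on the right acts on the positions of the window: it exchanges two
  neighbours, or inverts the last entry, or, in type D, exchanges and inverts the last two.\<close>

inductive simple_step :: "root_type \<Rightarrow> (nat \<times> bool) list \<Rightarrow> (nat \<times> bool) list \<Rightarrow> bool" for X where
  swap: "simple_step X (xs @ a # b # ts) (xs @ b # a # ts)"
| flip_last: "X \<noteq> Type_D \<Longrightarrow> simple_step X (xs @ [a]) (xs @ [flip a])"
| flip_last_two: "X = Type_D \<Longrightarrow> simple_step X (xs @ [a, b]) (xs @ [flip b, flip a])"

lemma flip_flip [simp]: "flip (flip y) = y" by (simp add: flip_def)

lemma fst_flip [simp]: "fst (flip y) = fst y" by (simp add: flip_def)

lemma snd_flip [simp]: "snd (flip y) \<longleftrightarrow> \<not> snd y" by (simp add: flip_def)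

lemma simple_step_sym: "simple_step X ys zs \<Longrightarrow> simple_step X zs ys"
  by (induction rule: simple_step.induct)
    (metis simple_step.intros flip_flip)+

lemma negations_simps [simp]:
  "negations [] = 0" "negations (y # ys) = (if snd y then 0 else 1) + negations ys"
  "negations (ys @ zs) = negations ys + negations zs"
  by (simp_all add: negations_def)

lemma simple_step_weyl_arrangements:
  assumes "simple_step X ys zs" "ys \<in> weyl_arrangements X I"
  shows "zs \<in> weyl_arrangements X I"
  using assms by (induction rule: simple_step.induct)
    (auto simp: weyl_arrangements_def arrangements_def)

lemma weyl_action_comp:
  assumes ys: "ys \<in> arrangements {..<n}" and zs: "zs \<in> arrangements {..<n}"
    and "\<And>i. perm_of zs i = perm_of ys (\<tau> i)" "\<And>i. sign_of zs i = sign_of ys (\<tau> i) * e i"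
    and "\<And>v i. Poly_Mapping.lookup (r v) (\<tau> i) = e i * Poly_Mapping.lookup v i"
  shows "weyl_action ys \<circ> r = weyl_action zs"
proof
  fix v
  have "weyl_action zs v = weyl_action ys (r v)"
    by (rule weyl_action_eqI[OF zs]) (simp add: assms lookup_weyl_action[OF ys])
  then show "(weyl_action ys \<circ> r) v = weyl_action zs v" by simp
qed

lemma nth_append_Cons_Cons:
  "(xs @ a # b # ts) ! j = (if j < length xs then xs ! j else if j = length xs then a
     else if j = Suc (length xs) then b else ts ! (j - length xs - 2))"
  by (auto simp: nth_append nth_Cons' numeral_2_eq_2)

lemma weyl_action_swap:
  assumes "xs @ a # b # ts \<in> arrangements {..<n}"
  shows "weyl_action (xs @ a # b # ts) \<circ> reflection (eps (length xs) - eps (Suc (length xs))) =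
    weyl_action (xs @ b # a # ts)"
proof (rule weyl_action_comp[OF assms, where \<tau> = "transpose (length xs) (Suc (length xs))" and e = "\<lambda>_. 1"])
  show "xs @ b # a # ts \<in> arrangements {..<n}" using assms by (auto simp: arrangements_def)
qed (auto simp: perm_of_def sign_of_def nth_append_Cons_Cons transpose_def lookup_reflection_pair)

lemma weyl_action_flip:
  assumes "xs @ [a] \<in> arrangements {..<n}"
  shows "weyl_action (xs @ [a]) \<circ> reflection (eps (length xs)) = weyl_action (xs @ [flip a])"
proof (rule weyl_action_comp[OF assms, where \<tau> = id and e = "\<lambda>i. if i = length xs then -1 else 1"])
  show "xs @ [flip a] \<in> arrangements {..<n}" using assms by (auto simp: arrangements_def)
qed (auto simp: perm_of_def sign_of_def nth_append lookup_reflection_eps)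

lemma weyl_action_flip_two:
  assumes "xs @ [a, b] \<in> arrangements {..<n}"
  shows "weyl_action (xs @ [a, b]) \<circ> reflection (eps (length xs) + eps (Suc (length xs))) =
    weyl_action (xs @ [flip b, flip a])"
proof (rule weyl_action_comp[OF assms, where \<tau> = "transpose (length xs) (Suc (length xs))"
      and e = "\<lambda>i. if i = length xs \<or> i = Suc (length xs) then -1 else 1"])
  show "xs @ [flip b, flip a] \<in> arrangements {..<n}" using assms by (auto simp: arrangements_def)
qed (auto simp: perm_of_def sign_of_def nth_append_Cons_Cons transpose_def lookup_reflection_pair)

lemma simple_step_imp_reflection:
  assumes "simple_step X ys zs" "ys \<in> arrangements {..<n}"
  shows "\<exists>\<alpha>\<in>simple_roots X n. weyl_action ys \<circ> reflection \<alpha> = weyl_action zs"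
  using assms
proof cases
  case (swap xs a b ts)
  have "Suc (length xs) < n" using length_arrangement[OF assms(2)] swap by simp
  then show ?thesis using weyl_action_swap[of xs a b ts n] assms(2) swap
    by (intro bexI[of _ "eps (length xs) - eps (Suc (length xs))"]) (auto simp: simple_roots_eq)
next
  case (flip_last xs a)
  have n: "Suc (length xs) = n" using length_arrangement[OF assms(2)] flip_last by simp
  have act: "weyl_action ys \<circ> reflection (eps (length xs)) = weyl_action zs"
    using weyl_action_flip[of xs a n] assms(2) flip_last by simp
  show ?thesis
  proof (cases X)
    case Type_B
    with n act show ?thesis by (intro bexI[of _ "eps (length xs)"]) (auto simp: simple_roots_eq end_roots_def)
  next
    case Type_C
    have "eps (length xs) + eps (length xs) \<in> simple_roots X n"
      unfolding simple_roots_eq end_roots_def using Type_C n by auto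
    with act show ?thesis unfolding reflection_double[symmetric] by blast
  qed (use flip_last in simp)
next
  case (flip_last_two xs a b)
  have "Suc (Suc (length xs)) = n" using length_arrangement[OF assms(2)] flip_last_two by simp
  then show ?thesis using weyl_action_flip_two[of xs a b n] assms(2) flip_last_two
    by (intro bexI[of _ "eps (length xs) + eps (Suc (length xs))"])
      (auto simp: simple_roots_eq end_roots_def)
qed

lemma reflection_imp_simple_step:
  assumes \<alpha>: "\<alpha> \<in> simple_roots X n" and ys: "ys \<in> arrangements {..<n}"
  shows "\<exists>zs. simple_step X ys zs \<and> weyl_action ys \<circ> reflection \<alpha> = weyl_action zs"
proof -
  have len: "length ys = n" using length_arrangement[OF ys] by simp
  have split: "ys = take i ys @ ys ! i # ys ! Suc i # drop (Suc (Suc i)) ys" if "Suc i < n" for i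
    using that len by (metis Cons_nth_drop_Suc Suc_lessD append_take_drop_id)
  have split1: "ys = take i ys @ [ys ! i]" if "Suc i = n" for i
    using that len by (metis lessI take_Suc_conv_app_nth take_all_iff order_refl)
  consider (swap) i where "\<alpha> = eps i - eps (Suc i)" "Suc i < n"
    | (short) i where "X \<noteq> Type_D" "reflection \<alpha> = reflection (eps i)" "Suc i = n"
    | (two) i where "X = Type_D" "\<alpha> = eps i + eps (Suc i)" "Suc (Suc i) = n"
    using \<alpha> reflection_double unfolding simple_roots_eq end_roots_def by (cases X) auto
  then show ?thesis
  proof cases
    case (swap i)
    let ?xs = "take i ys" and ?a = "ys ! i" and ?b = "ys ! Suc i" and ?ts = "drop (Suc (Suc i)) ys"
    have "simple_step X ys (?xs @ ?b # ?a # ?ts)"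
      by (subst split[OF swap(2)]) (rule simple_step.swap)
    moreover have "weyl_action ys \<circ> reflection \<alpha> = weyl_action (?xs @ ?b # ?a # ?ts)"
      using weyl_action_swap[of ?xs ?a ?b ?ts n] split[OF swap(2)] ys swap len by simp
    ultimately show ?thesis by blast
  next
    case (short i)
    let ?xs = "take i ys" and ?a = "ys ! i"
    have "simple_step X ys (?xs @ [flip ?a])"
      by (subst split1[OF short(3)]) (rule simple_step.flip_last[OF short(1)])
    moreover have "weyl_action ys \<circ> reflection \<alpha> = weyl_action (?xs @ [flip ?a])"
      using weyl_action_flip[of ?xs ?a n] split1[OF short(3)] ys short len by simp
    ultimately show ?thesis by blast
  next
    case (two i)
    let ?xs = "take i ys" and ?a = "ys ! i" and ?b = "ys ! Suc i"
    have eq: "ys = ?xs @ [?a, ?b]" using split[of i] two len by simp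
    have "simple_step X ys (?xs @ [flip ?b, flip ?a])"
      by (subst eq) (rule simple_step.flip_last_two[OF two(1)])
    moreover have "weyl_action ys \<circ> reflection \<alpha> = weyl_action (?xs @ [flip ?b, flip ?a])"
      using weyl_action_flip_two[of ?xs ?a ?b n] eq ys two len by simp
    ultimately show ?thesis by blast
  qed
qed

text \<open>For window entries \<open>p\<close> and \<open>q\<close> at positions \<open>i < j\<close> the two summands tell whether the images of
  \<open>\<epsilon>\<^sub>i - \<epsilon>\<^sub>j\<close> and of \<open>\<epsilon>\<^sub>i + \<epsilon>\<^sub>j\<close> are negative roots.\<close>

definition pair_inversions :: "int \<Rightarrow> int \<Rightarrow> nat" where
  "pair_inversions p q = (if p < q then 1 else 0) + (if p + q < 0 then 1 else 0)"

fun inversions :: "root_type \<Rightarrow> int list \<Rightarrow> nat" where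
  "inversions X [] = 0"
| "inversions X (p # ps) = (if X \<noteq> Type_D \<and> p < 0 then 1 else 0) +
     sum_list (map (pair_inversions p) ps) + inversions X ps"

text \<open>The value of the signed basis vector under a linear form that is positive on all positive roots. The
  smallest index gets the largest value, so that the identity has a decreasing positive window.\<close>

definition window :: "nat \<Rightarrow> nat \<times> bool \<Rightarrow> int" where
  "window n y = (if snd y then int n - int (fst y) else int (fst y) - int n)"

lemma window_flip [simp]: "window n (flip y) = - window n y"
  by (simp add: window_def)

lemma pair_inversions_uminus [simp]: "pair_inversions p (- q) = pair_inversions p q"
  by (simp add: pair_inversions_def)

text \<open>The inversions between \<open>xs\<close> and the tail are unchanged if the tail changes by a reordering and by
  sign changes, so the difference of the totals is that of the tails.\<close>

lemma inversions_append:
  assumes "\<And>p. p \<in> set xs \<Longrightarrow>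
    sum_list (map (pair_inversions p) us) = sum_list (map (pair_inversions p) vs)"
  shows "inversions X (xs @ us) + inversions X vs = inversions X (xs @ vs) + inversions X us"
  using assms by (induction xs) auto

lemma inversions_swap:
  "inversions X (xs @ a # b # ts) + pair_inversions b a = inversions X (xs @ b # a # ts) + pair_inversions a b"
proof -
  have "inversions X (xs @ a # b # ts) + inversions X (b # a # ts) =
      inversions X (xs @ b # a # ts) + inversions X (a # b # ts)"
    by (rule inversions_append) simp
  then show ?thesis by simp
qed

lemma inversions_flip:
  assumes "X \<noteq> Type_D"
  shows "inversions X (xs @ [a]) + (if a > 0 then 1 else 0) =
    inversions X (xs @ [- a]) + (if a < 0 then 1 else 0)"
proof -
  have "inversions X (xs @ [a]) + inversions X [- a] = inversions X (xs @ [- a]) + inversions X [a]"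
    by (rule inversions_append) simp
  then show ?thesis using assms by (simp split: if_splits)
qed

lemma inversions_flip_two:
  "inversions Type_D (xs @ [a, b]) + pair_inversions (- b) (- a) =
    inversions Type_D (xs @ [- b, - a]) + pair_inversions a b"
proof -
  have "inversions Type_D (xs @ [a, b]) + inversions Type_D [- b, - a] =
      inversions Type_D (xs @ [- b, - a]) + inversions Type_D [a, b]"
    by (rule inversions_append) simp
  then show ?thesis by (simp del: pair_inversions_uminus)
qed

lemma inversions_step_le:
  "simple_step X ys zs \<Longrightarrow> inversions X (map (window n) zs) \<le> Suc (inversions X (map (window n) ys))"
proof (induction rule: simple_step.induct)
  case (swap xs a b ts)
  show ?case
    using inversions_swap[of X "map (window n) xs" "window n a" "window n b" "map (window n) ts"]
    by (simp add: pair_inversions_def split: if_splits)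
next
  case (flip_last xs a)
  show ?case
    using inversions_flip[OF flip_last, of "map (window n) xs" "window n a"]
    by (simp split: if_splits)
next
  case (flip_last_two xs a b)
  show ?case
    using inversions_flip_two[of "map (window n) xs" "window n a" "window n b"] flip_last_two
    by (simp add: pair_inversions_def split: if_splits)
qed

definition identity_arrangement :: "nat \<Rightarrow> (nat \<times> bool) list" where
  "identity_arrangement n = map (\<lambda>i. (i, True)) [0..<n]"

lemma sorted_or_adjacent_violation:
  assumes R: "transp R" "\<And>x y. x \<noteq> y \<Longrightarrow> R x y \<or> R y x"
  shows "sorted_wrt R ys \<or> \<not> distinct ys \<or> (\<exists>xs a b ts. ys = xs @ a # b # ts \<and> R b a)"
proof (induction ys)
  case (Cons y ys)
  consider "sorted_wrt R ys" | "\<not> distinct ys" | xs a b ts where "ys = xs @ a # b # ts" "R b a"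
    using Cons.IH by blast
  then show ?case
  proof cases
    case 1
    show ?thesis
    proof (cases ys)
      case (Cons z zs)
      consider "R y z" | "y = z" | "R z y" using R(2) by blast
      then show ?thesis
      proof cases
        case 1
        then show ?thesis using \<open>sorted_wrt R ys\<close> Cons sorted_wrt2[OF R(1)] by blast
      next
        case 3
        then have "y # ys = [] @ y # z # zs \<and> R z y" using Cons by simp
        then show ?thesis by blast
      qed (use Cons in simp)
    qed simp
  next
    case 3
    then have "y # ys = (y # xs) @ a # b # ts \<and> R b a" by simp
    then show ?thesis by blast
  qed simp
qed simp

text \<open>A window without a descending step has decreasing entries of which at most the last is negative, the
  latter only in type D, where it is excluded by parity. So it is the window of the identity.\<close>

lemma descent_exists:
  assumes ys: "ys \<in> weyl_arrangements X {..<n}" and ne: "ys \<noteq> identity_arrangement n"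
  shows "\<exists>zs. simple_step X ys zs \<and> inversions X (map (window n) zs) < inversions X (map (window n) ys)"
proof -
  have arr: "ys \<in> arrangements {..<n}" using ys by (simp add: weyl_arrangements_def)
  have lt: "fst y < n" if "y \<in> set ys" for y using arr that by (auto simp: arrangements_def)
  have nz: "window n y \<noteq> 0" "window n y > 0 \<longleftrightarrow> snd y" if "y \<in> set ys" for y
    using lt[OF that] by (auto simp: window_def)
  have dist: "distinct (map (window n) ys)"
  proof -
    have "inj_on (window n) (set ys)"
    proof (rule inj_onI)
      fix y z assume yz: "y \<in> set ys" "z \<in> set ys" "window n y = window n z"
      have "fst y = fst z \<and> snd y = snd z"
        using lt[OF yz(1)] lt[OF yz(2)] yz(3) by (auto simp: window_def split: if_splits)
      then show "y = z" by (simp add: prod_eq_iff)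
    qed
    moreover have "distinct ys" using arr by (auto simp: arrangements_def distinct_map)
    ultimately show ?thesis by (simp add: distinct_map)
  qed
  consider (ascent) us a b vs where "map (window n) ys = us @ a # b # vs" "a < b"
    | (sorted) "sorted_wrt (>) (map (window n) ys)"
    using sorted_or_adjacent_violation[of "(>) :: int \<Rightarrow> int \<Rightarrow> bool" "map (window n) ys"] dist
    by (auto simp: neq_iff)
  then show ?thesis
  proof cases
    case ascent
    then obtain xs y z ts where eq: "ys = xs @ y # z # ts" "window n y = a" "window n z = b"
        "map (window n) xs = us" "map (window n) ts = vs"
      by (auto simp: map_eq_append_conv map_eq_Cons_conv)
    have "simple_step X ys (xs @ z # y # ts)" unfolding eq by (rule simple_step.swap)
    moreover have "inversions X (map (window n) (xs @ z # y # ts)) < inversions X (map (window n) ys)"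
      using inversions_swap[of X us a b vs] ascent(2)
      by (simp add: eq pair_inversions_def split: if_splits)
    ultimately show ?thesis by blast
  next
    case sorted
    have pos: "\<exists>y\<in>set ys. \<not> snd y"
    proof (rule ccontr)
      assume "\<not> ?thesis"
      then have all: "\<And>y. y \<in> set ys \<Longrightarrow> snd y" by blast
      have "sorted_wrt (<) (map fst ys)"
        using sorted unfolding sorted_wrt_map
        by (rule sorted_wrt_mono_rel[rotated]) (auto simp: window_def all)
      moreover have "set (map fst ys) = set [0..<n]" using arr by (auto simp: arrangements_def)
      ultimately have "map fst ys = [0..<n]" by (intro strict_sorted_equal) auto
      moreover have "ys = map (\<lambda>i. (i, True)) (map fst ys)"
        by (simp add: map_idI all prod_eq_iff o_def)
      ultimately show False using ne by (simp add: identity_arrangement_def)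
    qed
    then have "ys \<noteq> []" by auto
    then obtain xs z where eq: "ys = xs @ [z]" by (metis rev_exhaust)
    have neg: "\<not> snd z"
    proof
      assume "snd z"
      obtain y where y: "y \<in> set ys" "\<not> snd y" using pos by blast
      with eq \<open>snd z\<close> have "y \<in> set xs" by auto
      then have "window n y > window n z"
        using sorted by (simp add: eq sorted_wrt_append)
      then show False using nz[of y] nz[of z] y \<open>snd z\<close> eq by auto
    qed
    then have wz: "window n z < 0" using nz[of z] eq by force
    show ?thesis
    proof (cases "X = Type_D")
      case False
      have "simple_step X ys (xs @ [flip z])" unfolding eq by (rule simple_step.flip_last[OF False])
      moreover have "inversions X (map (window n) (xs @ [flip z])) < inversions X (map (window n) ys)"
        using inversions_flip[OF False, of "map (window n) xs" "window n z"] wz by (simp add: eq)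
      ultimately show ?thesis by blast
    next
      case True
      have even: "even (negations ys)" using ys True by (simp add: weyl_arrangements_def)
      \<comment> \<open>an even number of inverses, one of which is the last entry\<close>
      have "\<exists>y\<in>set xs. \<not> snd y"
      proof (rule ccontr)
        assume "\<not> ?thesis"
        then have "negations xs = 0" by (simp add: negations_def)
        then show False using even neg by (simp add: eq)
      qed
      then obtain y where y: "y \<in> set xs" "\<not> snd y" by blast
      then obtain us u where us: "xs = us @ [u]" by (metis rev_exhaust empty_iff list.set(1))
      have "window n u \<le> window n y"
        using sorted y(1) by (auto simp: eq us sorted_wrt_append)
      moreover have "window n y < 0" using y nz[of y] eq by force
      ultimately have wu: "window n u < 0" by simp
      have "simple_step X ys (us @ [flip z, flip u])"
        unfolding eq us using simple_step.flip_last_two[OF True, of us u z] by simp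
      moreover have "inversions X (map (window n) (us @ [flip z, flip u])) < inversions X (map (window n) ys)"
        using inversions_flip_two[of "map (window n) us" "window n u" "window n z"] wz wu
        by (simp add: eq us True pair_inversions_def split: if_splits)
      ultimately show ?thesis by blast
    qed
  qed
qed

text \<open>Entries of the identity in front dominate all later entries in absolute value and so take part in no
  inversion. This reduces the inversions of a stabilizer element to those of its moving part.\<close>

lemma inversions_identity_append:
  assumes "\<And>q. q \<in> set qs \<Longrightarrow> \<bar>q\<bar> \<le> int n - int l" "l \<le> n"
  shows "inversions X (map (window n) (identity_arrangement l) @ qs) = inversions X qs"
  using assms
proof (induction l arbitrary: qs)
  case (Suc l)
  let ?p = "int n - int l"
  have z: "sum_list (map (pair_inversions ?p) qs) = 0"
    using Suc.prems(1) by (fastforce simp: sum_list_eq_0_iff pair_inversions_def)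
  have "inversions X (map (window n) (identity_arrangement (Suc l)) @ qs) =
      inversions X (map (window n) (identity_arrangement l) @ (?p # qs))"
    by (simp add: identity_arrangement_def window_def)
  also have "\<dots> = inversions X (?p # qs)"
    by (rule Suc.IH) (use Suc.prems in fastforce)+
  also have "\<dots> = inversions X qs" using z Suc.prems(2) by simp
  finally show ?case .
qed (simp add: identity_arrangement_def)

lemma inversions_identity: "inversions X (map (window n) (identity_arrangement n)) = 0"
  using inversions_identity_append[of "[]" n n X] by simp

lemma identity_arrangement_weyl: "identity_arrangement n \<in> weyl_arrangements X {..<n}"
  by (auto simp: weyl_arrangements_def arrangements_def identity_arrangement_def negations_def
      o_def image_image)

lemma weyl_action_identity: "weyl_action (identity_arrangement n) = id"
proof
  fix v show "weyl_action (identity_arrangement n) v = id v"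
    by (rule weyl_action_eqI[of _ n])
      (use identity_arrangement_weyl[of n Type_B] in
        \<open>auto simp: weyl_arrangements_def perm_of_def sign_of_def identity_arrangement_def\<close>)
qed

lemma foldr_comp_snoc: "foldr (\<circ>) (fs @ [f]) id = foldr (\<circ>) fs id \<circ> f"
  by (induction fs) (auto simp: o_assoc)

lemma word_of_length_inversions:
  assumes "ys \<in> weyl_arrangements X {..<n}"
  shows "\<exists>as. length as \<le> inversions X (map (window n) ys) \<and> set as \<subseteq> simple_roots X n \<and>
    weyl_action ys = foldr (\<circ>) (map reflection as) id"
  using assms
proof (induction "inversions X (map (window n) ys)" arbitrary: ys rule: less_induct)
  case less
  show ?case
  proof (cases "ys = identity_arrangement n")
    case True
    then show ?thesis by (intro exI[of _ "[]"]) (simp add: weyl_action_identity)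
  next
    case False
    then obtain zs where step: "simple_step X ys zs"
      and lt: "inversions X (map (window n) zs) < inversions X (map (window n) ys)"
      using descent_exists[OF less.prems] by blast
    have zs: "zs \<in> weyl_arrangements X {..<n}"
      by (rule simple_step_weyl_arrangements[OF step less.prems])
    obtain as where as: "length as \<le> inversions X (map (window n) zs)" "set as \<subseteq> simple_roots X n"
        "weyl_action zs = foldr (\<circ>) (map reflection as) id"
      using less.hyps[OF lt zs] by blast
    obtain \<alpha> where \<alpha>: "\<alpha> \<in> simple_roots X n" "weyl_action zs \<circ> reflection \<alpha> = weyl_action ys"
      using simple_step_imp_reflection[OF simple_step_sym[OF step]] zs
      by (auto simp: weyl_arrangements_def)
    show ?thesis
      by (rule exI[of _ "as @ [\<alpha>]"])
        (use as \<alpha> lt foldr_comp_snoc[of "map reflection as" "reflection \<alpha>"] in simp)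
  qed
qed

lemma inversions_le_word_length:
  assumes "set as \<subseteq> simple_roots X n"
  shows "\<exists>ys\<in>weyl_arrangements X {..<n}. foldr (\<circ>) (map reflection as) id = weyl_action ys \<and>
    inversions X (map (window n) ys) \<le> length as"
  using assms
proof (induction as rule: rev_induct)
  case Nil
  show ?case
    by (rule bexI[OF _ identity_arrangement_weyl]) (simp add: weyl_action_identity inversions_identity)
next
  case (snoc \<alpha> as)
  then have "set as \<subseteq> simple_roots X n" by simp
  from snoc.IH[OF this] obtain ys where ys: "ys \<in> weyl_arrangements X {..<n}"
      "foldr (\<circ>) (map reflection as) id = weyl_action ys" "inversions X (map (window n) ys) \<le> length as"
    by blast
  obtain zs where zs: "simple_step X ys zs" "weyl_action ys \<circ> reflection \<alpha> = weyl_action zs"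
    using reflection_imp_simple_step[of \<alpha> X n ys] snoc.prems ys(1) by (auto simp: weyl_arrangements_def)
  show ?case
  proof (rule bexI[of _ zs])
    show "zs \<in> weyl_arrangements X {..<n}" by (rule simple_step_weyl_arrangements[OF zs(1) ys(1)])
    show "foldr (\<circ>) (map reflection (as @ [\<alpha>])) id = weyl_action zs \<and>
        inversions X (map (window n) zs) \<le> length (as @ [\<alpha>])"
      using foldr_comp_snoc[of "map reflection as" "reflection \<alpha>"] ys zs inversions_step_le[OF zs(1), of n]
      by simp
  qed
qed

text \<open>Each simple reflection changes the number of inversions by at most one, which bounds the length from
  below; by \<open>descent_exists\<close> one can descend to the identity, which bounds it from above.\<close>

lemma weyl_length_eq_inversions:
  assumes ys: "ys \<in> weyl_arrangements X {..<n}"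
  shows "weyl_length X n (weyl_action ys) = inversions X (map (window n) ys)"
proof -
  let ?P = "\<lambda>k. \<exists>as. length as = k \<and> set as \<subseteq> simple_roots X n \<and>
      weyl_action ys = foldr (\<circ>) (map reflection as) id"
  have low: "inversions X (map (window n) ys) \<le> length as"
    if as: "set as \<subseteq> simple_roots X n" "weyl_action ys = foldr (\<circ>) (map reflection as) id" for as
  proof -
    obtain zs where zs: "zs \<in> weyl_arrangements X {..<n}" "weyl_action ys = weyl_action zs"
        "inversions X (map (window n) zs) \<le> length as"
      using inversions_le_word_length[OF as(1)] as(2) by auto
    have "ys = zs"
      using inj_onD[OF inj_weyl_action[of n] zs(2)] ys zs(1) by (simp add: weyl_arrangements_def)
    with zs show ?thesis by simp
  qed
  obtain as where as: "length as \<le> inversions X (map (window n) ys)" "set as \<subseteq> simple_roots X n"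
      "weyl_action ys = foldr (\<circ>) (map reflection as) id"
    using word_of_length_inversions[OF ys] by blast
  with low[of as] have "?P (inversions X (map (window n) ys))" by (metis order_antisym)
  then show ?thesis
    unfolding weyl_length_def by (rule Least_equality) (use low in blast)
qed

subsection \<open>Poincare polynomials\<close>

text \<open>Counting the smaller elements numbers a finite set of naturals.\<close>

lemma bij_betw_rank:
  assumes "finite (J :: nat set)"
  shows "bij_betw (\<lambda>i. card {j\<in>J. j < i}) J {..<card J}"
proof -
  have less: "card {j\<in>J. j < i} < card {j\<in>J. j < i'}" if "i \<in> J" "i < i'" for i i'
    by (rule psubset_card_mono) (use assms that in auto)
  have inj: "inj_on (\<lambda>i. card {j\<in>J. j < i}) J"
  proof (rule inj_onI)
    fix i i' assume "i \<in> J" "i' \<in> J" "card {j\<in>J. j < i} = card {j\<in>J. j < i'}"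
    then show "i = i'" using less[of i i'] less[of i' i] by (cases i i' rule: linorder_cases) simp_all
  qed
  have "card {j\<in>J. j < i} < card J" if "i \<in> J" for i
    by (rule psubset_card_mono) (use assms that in auto)
  then have "(\<lambda>i. card {j\<in>J. j < i}) ` J \<subseteq> {..<card J}" by blast
  then have "(\<lambda>i. card {j\<in>J. j < i}) ` J = {..<card J}"
    by (rule card_subset_eq[OF finite_lessThan]) (simp only: card_image[OF inj] card_lessThan)
  with inj show ?thesis by (simp add: bij_betw_def)
qed

lemma prod_power_indicator:
  "finite A \<Longrightarrow> (\<Prod>j\<in>A. (t :: 'a::comm_monoid_mult) ^ (if P j then 1 else 0)) = t ^ card {j\<in>A. P j}"
proof (induction A rule: finite_induct)
  case (insert x F)
  have "{j \<in> insert x F. P j} = (if P x then insert x {j\<in>F. P j} else {j\<in>F. P j})" by auto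
  then show ?case using insert by simp
qed simp

lemma sum_powers_add:
  "(\<Sum>a<m + k. (t :: 'a::comm_semiring_1) ^ a) = (\<Sum>a<m. t ^ a) + (\<Sum>a<k. t ^ (m + a))"
  by (induction k) (simp_all add: add.assoc)

text \<open>The counterpart of \<open>coset_identity\<close> for inversions. If the first entry is the index \<open>i\<close> of rank
  \<open>r\<close> among \<open>m\<close> indices, it takes part in \<open>r\<close> inversions; if it is the inverse, in
  \<open>2 m - 2 - r\<close> inversions, and one more in types B and C.\<close>

lemma coset_inversions:
  fixes t :: "'a::comm_ring_1"
  assumes J: "J \<subseteq> {..<n}" "J \<noteq> {}"
  shows "(\<Sum>i\<in>J. \<Sum>b\<in>UNIV. t ^ (if X \<noteq> Type_D \<and> window n (i, b) < 0 then 1 else 0) *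
      (\<Prod>j\<in>J-{i}. t ^ pair_inversions (window n (i, b)) (int n - int j))) =
    coset_poincare X t (card J)"
proof -
  have fin: "finite J" using J finite_subset by blast
  define m where "m = card J"
  define r where "r i = card {j\<in>J. j < i}" for i
  define c :: nat where "c = (if X = Type_D then 0 else 1)"
  have m: "m \<ge> 1" using fin J by (simp add: m_def Suc_le_eq card_gt_0_iff)
  have bij: "bij_betw r J {..<m}" unfolding r_def m_def by (rule bij_betw_rank[OF fin])
  have rm: "r i < m" if "i \<in> J" for i using bij that by (auto simp: bij_betw_def)
  have above: "card {j\<in>J-{i}. i < j} = m - 1 - r i" if "i \<in> J" for i
  proof -
    have "J = insert i ({j\<in>J-{i}. i < j} \<union> {j\<in>J. j < i})" using that by auto
    then have "m = card (insert i ({j\<in>J-{i}. i < j} \<union> {j\<in>J. j < i}))" by (simp add: m_def)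
    also have "\<dots> = Suc (card ({j\<in>J-{i}. i < j} \<union> {j\<in>J. j < i}))"
      using fin by (subst card_insert_disjoint) auto
    also have "card ({j\<in>J-{i}. i < j} \<union> {j\<in>J. j < i}) = card {j\<in>J-{i}. i < j} + r i"
      unfolding r_def using fin by (intro card_Un_disjoint) auto
    finally show ?thesis by simp
  qed
  have plus: "t ^ (if X \<noteq> Type_D \<and> window n (i, True) < 0 then 1 else 0) *
      (\<Prod>j\<in>J-{i}. t ^ pair_inversions (window n (i, True)) (int n - int j)) = t ^ r i"
    if i: "i \<in> J" for i
  proof -
    have "(\<Prod>j\<in>J-{i}. t ^ pair_inversions (window n (i, True)) (int n - int j)) =
        (\<Prod>j\<in>J-{i}. t ^ (if j < i then 1 else 0))"
    proof (intro prod.cong refl arg_cong[of _ _ "power t"])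
      fix j assume "j \<in> J - {i}"
      then have "j < n" "i < n" using J i by auto
      then show "pair_inversions (window n (i, True)) (int n - int j) = (if j < i then 1 else 0)"
        by (simp add: pair_inversions_def window_def)
    qed
    also have "\<dots> = t ^ card {j\<in>J-{i}. j < i}" using fin by (intro prod_power_indicator) simp
    also have "{j\<in>J-{i}. j < i} = {j\<in>J. j < i}" by auto
    finally show ?thesis using J i by (auto simp: r_def window_def)
  qed
  have minus: "t ^ (if X \<noteq> Type_D \<and> window n (i, False) < 0 then 1 else 0) *
      (\<Prod>j\<in>J-{i}. t ^ pair_inversions (window n (i, False)) (int n - int j)) =
      t ^ (c + (m - 1) + (m - Suc (r i)))"
    if i: "i \<in> J" for i
  proof -
    have "(\<Prod>j\<in>J-{i}. t ^ pair_inversions (window n (i, False)) (int n - int j)) =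
        (\<Prod>j\<in>J-{i}. t * t ^ (if i < j then 1 else 0))"
    proof (rule prod.cong[OF refl])
      fix j assume j: "j \<in> J - {i}"
      have "pair_inversions (window n (i, False)) (int n - int j) = Suc (if i < j then 1 else 0)"
      proof -
        have "j < n" "i < n" "j \<noteq> i" using J i j by auto
        then show ?thesis by (simp add: pair_inversions_def window_def)
      qed
      then show "t ^ pair_inversions (window n (i, False)) (int n - int j) =
          t * t ^ (if i < j then 1 else 0)" by (simp only: power_Suc)
    qed
    also have "\<dots> = t ^ (m - 1) * t ^ card {j\<in>J-{i}. i < j}"
      using fin i by (simp only: prod.distrib prod_constant prod_power_indicator finite_Diff)
        (simp add: m_def)
    also have "\<dots> = t ^ (m - 1) * t ^ (m - Suc (r i))" using above[OF i] by simp
    finally show ?thesis using J i by (auto simp: c_def window_def power_add)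
  qed
  have "(\<Sum>i\<in>J. \<Sum>b\<in>UNIV. t ^ (if X \<noteq> Type_D \<and> window n (i, b) < 0 then 1 else 0) *
      (\<Prod>j\<in>J-{i}. t ^ pair_inversions (window n (i, b)) (int n - int j))) =
      (\<Sum>i\<in>J. t ^ r i + t ^ (c + (m - 1) + (m - Suc (r i))))"
    by (intro sum.cong refl) (simp only: sum_bool plus minus)
  also have "\<dots> = (\<Sum>a<m. t ^ a + t ^ (c + (m - 1) + (m - Suc a)))"
    by (rule sum.reindex_bij_betw[OF bij])
  also have "\<dots> = (\<Sum>a<m. t ^ a) + (\<Sum>a<m. t ^ (c + (m - 1) + a))"
    using sum.nat_diff_reindex[of "\<lambda>a. t ^ (c + (m - 1) + a)" m] by (simp add: sum.distrib)
  also have "\<dots> = coset_poincare X t m"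
  proof (cases "X = Type_D")
    case True
    obtain k where k: "m = Suc k" using m by (cases m) auto
    have "(\<Sum>a<m. t ^ (k + a)) = t ^ k + (\<Sum>a<k. t ^ (m + a))"
      unfolding k by (subst sum.lessThan_Suc_shift) simp
    moreover have "(\<Sum>a<2*m-1. t ^ a) = (\<Sum>a<m. t ^ a) + (\<Sum>a<k. t ^ (m + a))"
      using sum_powers_add[of t m k] by (simp add: k mult_2)
    ultimately show ?thesis using True by (simp add: coset_poincare_def c_def k)
  next
    case False
    then have "coset_poincare X t m = (\<Sum>a<2*m. t ^ a)" by (cases X) (auto simp: coset_poincare_def)
    moreover have "c + (m - 1) = m" using False m by (simp add: c_def)
    ultimately show ?thesis using sum_powers_add[of t m m] by (simp only: mult_2)
  qed
  finally show ?thesis by (simp add: m_def)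
qed

lemma weight_product_inversions:
  assumes "\<forall>z\<in>set zs. fst z < n"
  shows "weight_product (\<lambda>k. t ^ (if X \<noteq> Type_D \<and> window n k < 0 then 1 else 0))
    (\<lambda>k j. t ^ pair_inversions (window n k) (int n - int j)) zs =
    (t :: 'a::comm_monoid_mult) ^ inversions X (map (window n) zs)"
  using assms
proof (induction zs)
  case (Cons z zs)
  have "prod_list (map ((\<lambda>j. t ^ pair_inversions (window n z) (int n - int j)) \<circ> fst) zs) =
      t ^ sum_list (map (pair_inversions (window n z)) (map (window n) zs))"
  proof (induction zs)
    case (Cons y zs)
    have "pair_inversions (window n z) (window n y) = pair_inversions (window n z) (int n - int (fst y))"
    proof -
      define q where "q = int n - int (fst y)"
      have "window n y = (if snd y then q else - q)" by (simp add: window_def q_def)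
      then show ?thesis by (simp add: q_def[symmetric])
    qed
    then show ?case using Cons by (simp add: power_add)
  qed simp
  then show ?case using Cons by (simp add: power_add)
qed simp

lemma inversion_generating_function:
  fixes t :: "'a::comm_ring_1"
  assumes "I \<subseteq> {..<n}"
  shows "(\<Sum>zs\<in>arrangements I. t ^ inversions X (map (window n) zs)) =
    (\<Prod>m=1..card I. coset_poincare X t m)"
proof -
  have "(\<Sum>zs\<in>arrangements I. t ^ inversions X (map (window n) zs)) =
      (\<Sum>zs\<in>arrangements I. weight_product (\<lambda>k. t ^ (if X \<noteq> Type_D \<and> window n k < 0 then 1 else 0))
        (\<lambda>k j. t ^ pair_inversions (window n k) (int n - int j)) zs)"
    by (intro sum.cong refl weight_product_inversions[symmetric])
      (use assms in \<open>auto simp: arrangements_def\<close>)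
  also have "\<dots> = (\<Prod>m=1..card I. coset_poincare X t m)"
    by (rule sum_weight_product)
      (use assms finite_subset in \<open>auto intro!: coset_inversions\<close>)
  finally show ?thesis .
qed

subsection \<open>Changing the last sign\<close>

definition flip_end :: "(nat \<times> bool) list \<Rightarrow> (nat \<times> bool) list" where
  "flip_end ys = butlast ys @ [flip (last ys)]"

lemma flip_end_snoc [simp]: "flip_end (xs @ [a]) = xs @ [flip a]"
  by (simp add: flip_end_def)

text \<open>Inverting the last entry exchanges the arrangements with even and with odd number of inverses.\<close>

lemma sum_arrangements_parity:
  assumes "finite I" "I \<noteq> {}"
  shows "(\<Sum>ys\<in>arrangements I. f ys) =
    (\<Sum>ys\<in>weyl_arrangements Type_D I. f ys) + (\<Sum>ys\<in>weyl_arrangements Type_D I. f (flip_end ys))"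
proof -
  define E where "E = weyl_arrangements Type_D I"
  define U where "U = {ys\<in>arrangements I. odd (negations ys)}"
  have ne: "ys \<noteq> []" if "ys \<in> arrangements I" for ys using that assms(2) by (auto simp: arrangements_def)
  have arr: "flip_end ys \<in> arrangements I" "flip_end (flip_end ys) = ys"
      "even (negations (flip_end ys)) \<longleftrightarrow> odd (negations ys)"
    if ys: "ys \<in> arrangements I" for ys
  proof -
    obtain xs a where "ys = xs @ [a]" using ne[OF ys] by (cases ys rule: rev_cases) auto
    then show "flip_end ys \<in> arrangements I" "flip_end (flip_end ys) = ys"
      "even (negations (flip_end ys)) \<longleftrightarrow> odd (negations ys)"
      using ys by (auto simp: arrangements_def)
  qed
  have U: "(\<Sum>ys\<in>U. f ys) = (\<Sum>ys\<in>E. f (flip_end ys))"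
  proof (rule sum.reindex_bij_witness[of _ flip_end flip_end])
    fix ys assume "ys \<in> U"
    then have "ys \<in> arrangements I" "odd (negations ys)" by (simp_all add: U_def)
    with arr[of ys] show "flip_end (flip_end ys) = ys" "flip_end ys \<in> E"
        "f (flip_end (flip_end ys)) = f ys"
      by (simp_all add: E_def weyl_arrangements_def)
  next
    fix ys assume "ys \<in> E"
    then have "ys \<in> arrangements I" "even (negations ys)"
      by (simp_all add: E_def weyl_arrangements_def)
    with arr[of ys] show "flip_end (flip_end ys) = ys" "flip_end ys \<in> U"
      by (simp_all add: U_def)
  qed
  have "arrangements I = E \<union> U" "E \<inter> U = {}" unfolding E_def U_def weyl_arrangements_def by blast+
  moreover from this(1) have "finite E" "finite U"
    using finite_arrangements[OF assms(1)] by simp_all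
  ultimately show ?thesis using U by (simp add: sum.union_disjoint E_def)
qed

lemma weight_product_flip_end:
  assumes "\<And>y. g (flip y) = g y"
  shows "weight_product g h (xs @ [flip a]) = weight_product g h (xs @ [a])"
  using assms by (induction xs) auto

lemma inversions_flip_end:
  "inversions Type_D (map (window n) (xs @ [flip a])) = inversions Type_D (map (window n) (xs @ [a]))"
  using inversions_append[of "map (window n) xs" "[window n (flip a)]" "[window n a]" Type_D] by simp

subsection \<open>Stabilizers\<close>

lemma lookup_partition_weight:
  "Poly_Mapping.lookup (partition_weight lam) i = (if i < length lam then int (lam ! i) else 0)"
  by (simp add: partition_weight_def lookup_sum lookup_single when_def)

lemma strict_partition_nth:
  assumes "strict_partition lam" "i < length lam"
  shows "0 < lam ! i" and "j < length lam \<Longrightarrow> lam ! i = lam ! j \<Longrightarrow> i = j"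
proof -
  show "0 < lam ! i" using assms by (simp add: strict_partition_def)
  show "i = j" if "j < length lam" "lam ! i = lam ! j"
    using assms that by (metis strict_partition_def nat_neq_iff sorted_wrt_iff_nth_less)
qed

lemma arrangements_append_identity:
  assumes "l \<le> n"
  shows "identity_arrangement l @ zs \<in> weyl_arrangements X {..<n} \<longleftrightarrow> zs \<in> weyl_arrangements X {l..<n}"
proof -
  have n0: "negations (identity_arrangement l) = 0"
    by (simp add: negations_def identity_arrangement_def)
  have d: "distinct (map fst (identity_arrangement l))" "fst ` set (identity_arrangement l) = {..<l}"
    using identity_arrangement_weyl[of l Type_B] by (auto simp: weyl_arrangements_def arrangements_def)
  show ?thesis
  proof
    assume L: "identity_arrangement l @ zs \<in> weyl_arrangements X {..<n}"
    then have "{..<l} \<inter> fst ` set zs = {}" "{..<l} \<union> fst ` set zs = {..<n}"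
      using d by (auto simp: weyl_arrangements_def arrangements_def image_Un)
    then have "fst ` set zs = {..<n} - {..<l}" by blast
    also have "\<dots> = {l..<n}" by auto
    finally have "fst ` set zs = {l..<n}" .
    then show "zs \<in> weyl_arrangements X {l..<n}"
      using L n0 by (auto simp: weyl_arrangements_def arrangements_def)
  next
    assume "zs \<in> weyl_arrangements X {l..<n}"
    then show "identity_arrangement l @ zs \<in> weyl_arrangements X {..<n}"
      using assms d n0 by (auto simp: weyl_arrangements_def arrangements_def image_Un)
  qed
qed

text \<open>The parts of a strict partition are distinct and positive, so a stabilizing element must fix the
  corresponding basis vectors, while it may permute and invert the others, in type D with an even
  number of inversions of sign.\<close>

lemma stabilizer_eq:
  assumes lam: "strict_partition lam" "length lam \<le> n"
  shows "{ys\<in>weyl_arrangements X {..<n}. weyl_action ys (partition_weight lam) = partition_weight lam} =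
    (\<lambda>zs. identity_arrangement (length lam) @ zs) ` weyl_arrangements X {length lam..<n}"
proof (intro equalityI subsetI)
  let ?l = "length lam" and ?v = "partition_weight lam"
  fix ys assume "ys \<in> {ys\<in>weyl_arrangements X {..<n}. weyl_action ys ?v = ?v}"
  then have ys: "ys \<in> weyl_arrangements X {..<n}" "ys \<in> arrangements {..<n}"
    and fix_v: "weyl_action ys ?v = ?v" by (auto simp: weyl_arrangements_def)
  have len: "length ys = n" using length_arrangement[OF ys(2)] by simp
  have "ys ! i = (i, True)" if i: "i < ?l" for i
  proof -
    have *: "Poly_Mapping.lookup ?v (perm_of ys i) = sign_of ys i * int (lam ! i)"
      using lookup_weyl_action[OF ys(2), of ?v i] fix_v i by (simp add: lookup_partition_weight)
    have pos: "0 < lam ! i" using strict_partition_nth[OF lam(1) i] by simp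
    have p: "perm_of ys i < ?l"
      using * pos sign_of_cases[of ys i] by (auto simp: lookup_partition_weight split: if_splits)
    have s: "sign_of ys i = 1"
      using * p pos sign_of_cases[of ys i] by (auto simp: lookup_partition_weight)
    have "lam ! perm_of ys i = lam ! i" using * p s by (simp add: lookup_partition_weight)
    then have "perm_of ys i = i" using strict_partition_nth(2)[OF lam(1) p i] by simp
    then show ?thesis using s i len lam(2)
      by (auto simp: perm_of_def sign_of_def prod_eq_iff split: if_splits)
  qed
  then have "take ?l ys = identity_arrangement ?l"
    using len lam(2) by (intro nth_equalityI) (auto simp: identity_arrangement_def)
  then have "ys = identity_arrangement ?l @ drop ?l ys" by (metis append_take_drop_id)
  with ys(1) show "ys \<in> (\<lambda>zs. identity_arrangement ?l @ zs) ` weyl_arrangements X {?l..<n}"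
    using arrangements_append_identity[OF lam(2)] by (metis imageI)
next
  let ?l = "length lam" and ?v = "partition_weight lam"
  fix ys assume "ys \<in> (\<lambda>zs. identity_arrangement ?l @ zs) ` weyl_arrangements X {?l..<n}"
  then obtain zs where eq: "ys = identity_arrangement ?l @ zs"
    and ys: "ys \<in> weyl_arrangements X {..<n}"
    using arrangements_append_identity[OF lam(2)] by blast
  have arr: "ys \<in> arrangements {..<n}" using ys by (simp add: weyl_arrangements_def)
  have id: "perm_of ys i = i" "sign_of ys i = 1" if "i < ?l" for i
    using that by (auto simp: eq perm_of_def sign_of_def identity_arrangement_def nth_append)
  have "weyl_action ys ?v = ?v"
  proof (rule weyl_action_eqI[OF arr])
    fix i
    show "Poly_Mapping.lookup ?v (perm_of ys i) = sign_of ys i * Poly_Mapping.lookup ?v i"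
    proof (cases "i < ?l")
      case False
      have "perm_of ys i \<ge> ?l"
      proof (rule ccontr)
        assume low: "\<not> perm_of ys i \<ge> ?l"
        then have "perm_of ys (perm_of ys i) = perm_of ys i" using id by simp
        then have "perm_of ys i = i"
          using perm_of_permutes[OF arr] by (metis permutes_inj injD)
        then show False using False low by simp
      qed
      then show ?thesis using False by (simp add: lookup_partition_weight)
    qed (simp add: id)
  qed
  with ys show "ys \<in> {ys\<in>weyl_arrangements X {..<n}. weyl_action ys ?v = ?v}" by simp
qed

lemma sum_over_stabilizer:
  fixes t :: "'a::comm_ring_1"
  assumes lam: "strict_partition lam" "length lam \<le> n"
  shows "(\<Sum>w | w \<in> weyl_group X n \<and> w (partition_weight lam) = partition_weight lam.
      t ^ weyl_length X n w) =
    (\<Sum>zs\<in>weyl_arrangements X {length lam..<n}. t ^ inversions X (map (window n) zs))"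
proof -
  let ?l = "length lam" and ?v = "partition_weight lam"
  let ?S = "{ys\<in>weyl_arrangements X {..<n}. weyl_action ys ?v = ?v}"
  have "{w. w \<in> weyl_group X n \<and> w ?v = ?v} = weyl_action ` ?S"
    using weyl_action_image[of X n] by auto
  moreover have "inj_on weyl_action ?S"
    by (rule inj_on_subset[OF inj_weyl_action]) (auto simp: weyl_arrangements_def)
  ultimately have "(\<Sum>w | w \<in> weyl_group X n \<and> w ?v = ?v. t ^ weyl_length X n w) =
      (\<Sum>ys\<in>?S. t ^ weyl_length X n (weyl_action ys))"
    by (simp add: sum.reindex)
  also have "\<dots> = (\<Sum>ys\<in>?S. t ^ inversions X (map (window n) ys))"
    by (intro sum.cong refl) (simp add: weyl_length_eq_inversions)
  also have "\<dots> = (\<Sum>zs\<in>weyl_arrangements X {?l..<n}.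
      t ^ inversions X (map (window n) (identity_arrangement ?l @ zs)))"
    unfolding stabilizer_eq[OF lam] by (subst sum.reindex) (auto simp: inj_on_def)
  also have "\<dots> = (\<Sum>zs\<in>weyl_arrangements X {?l..<n}. t ^ inversions X (map (window n) zs))"
  proof (intro sum.cong refl)
    fix zs assume "zs \<in> weyl_arrangements X {?l..<n}"
    then have "fst z \<in> {?l..<n}" if "z \<in> set zs" for z
      using that imageI[of z "set zs" fst] by (simp add: weyl_arrangements_def arrangements_def)
    then have "\<bar>window n z\<bar> \<le> int n - int ?l" if "z \<in> set zs" for z
      using that[THEN \<open>\<And>z. z \<in> set zs \<Longrightarrow> fst z \<in> {?l..<n}\<close>] by (simp add: window_def abs_if)
    then have "inversions X (map (window n) (identity_arrangement ?l) @ map (window n) zs) =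
        inversions X (map (window n) zs)"
      using lam(2) by (intro inversions_identity_append) auto
    then show "t ^ inversions X (map (window n) (identity_arrangement ?l @ zs)) =
        t ^ inversions X (map (window n) zs)" by simp
  qed
  finally show ?thesis .
qed

section \<open>Hall--Littlewood functions as sums over cosets\<close>

lemma wexp_0 [simp]: "wexp 0 = 1"
  by (simp add: wexp_def single_one)

lemma wexp_add: "wexp (\<mu> + \<nu>) = wexp \<mu> * wexp \<nu>"
  by (simp add: wexp_def mult_single flip: to_fract_mult)

lemma wexp_nonzero [simp]: "(wexp \<mu> :: (weight \<Rightarrow>\<^sub>0 'a::idom) fract) \<noteq> 0"
proof
  assume "(wexp \<mu> :: (weight \<Rightarrow>\<^sub>0 'a) fract) = 0"
  then have "Poly_Mapping.single \<mu> (1::'a) = 0" by (simp add: wexp_def)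
  from arg_cong[OF this, of "\<lambda>p. Poly_Mapping.lookup p \<mu>"] show False by simp
qed

lemma wexp_uminus: "(wexp (- \<mu>) :: (weight \<Rightarrow>\<^sub>0 'a::idom) fract) = inverse (wexp \<mu>)"
proof -
  have "wexp \<mu> * wexp (- \<mu>) = (1 :: (weight \<Rightarrow>\<^sub>0 'a) fract)" by (simp flip: wexp_add)
  then show ?thesis by (rule inverse_unique[symmetric])
qed

lemma wexp_diff: "wexp (\<mu> - \<nu>) = wexp \<mu> / wexp \<nu>"
  by (simp add: wexp_uminus wexp_add divide_inverse flip: add_uminus_conv_diff)

lemma wexp_eq_iff [simp]: "(wexp \<mu> :: (weight \<Rightarrow>\<^sub>0 'a::idom) fract) = wexp \<nu> \<longleftrightarrow> \<mu> = \<nu>"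
proof
  assume "(wexp \<mu> :: (weight \<Rightarrow>\<^sub>0 'a) fract) = wexp \<nu>"
  then have "Poly_Mapping.single \<mu> (1::'a) = Poly_Mapping.single \<nu> 1" by (simp add: wexp_def)
  from arg_cong[OF this, of "\<lambda>p. Poly_Mapping.lookup p \<mu>"] show "\<mu> = \<nu>"
    by (auto simp: lookup_single when_def split: if_splits)
qed simp

lemma const_fract_0 [simp]: "const_fract 0 = 0" by (simp add: const_fract_def)

lemma const_fract_1 [simp]: "const_fract 1 = 1" by (simp add: const_fract_def single_one)

lemma const_fract_add: "const_fract (a + b) = const_fract a + const_fract b"
  by (simp add: const_fract_def single_add flip: to_fract_add)

lemma const_fract_mult: "const_fract (a * b) = const_fract a * const_fract b"
  by (simp add: const_fract_def mult_single flip: to_fract_mult)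

lemma const_fract_power: "const_fract (a ^ k) = const_fract a ^ k"
  by (induction k) (simp_all add: const_fract_mult)

lemma const_fract_sum: "const_fract (sum f A) = (\<Sum>a\<in>A. const_fract (f a))"
  by (induction A rule: infinite_finite_induct) (simp_all add: const_fract_add)

lemma const_fract_eq_iff [simp]: "const_fract a = const_fract b \<longleftrightarrow> a = b"
proof
  assume "const_fract a = const_fract b"
  then have "Poly_Mapping.single (0::weight) a = Poly_Mapping.single 0 b" by (simp add: const_fract_def)
  from arg_cong[OF this, of "\<lambda>p. Poly_Mapping.lookup p 0"] show "a = b" by simp
qed simp

abbreviation T_indet :: "(weight \<Rightarrow>\<^sub>0 rat poly) fract" where
  "T_indet \<equiv> const_fract [:0, 1:]"

abbreviation var :: "nat \<Rightarrow> (weight \<Rightarrow>\<^sub>0 'a::idom) fract" where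
  "var i \<equiv> wexp (eps i)"

lemma T_indet_neq: "T_indet \<noteq> 0" "T_indet \<noteq> 1"
proof -
  have "[:0, 1:] \<noteq> (0 :: rat poly)" "[:0, 1:] \<noteq> (1 :: rat poly)" by (simp_all add: one_pCons)
  then show "T_indet \<noteq> 0" "T_indet \<noteq> 1" by (metis const_fract_eq_iff const_fract_0 const_fract_1)+
qed

lemma wexp_neq_T_indet: "wexp \<mu> \<noteq> T_indet"
proof
  assume "wexp \<mu> = T_indet"
  then have "Poly_Mapping.single \<mu> (1 :: rat poly) = Poly_Mapping.single 0 [:0, 1:]"
    by (simp add: wexp_def const_fract_def)
  from arg_cong[OF this, of "\<lambda>p. Poly_Mapping.lookup p \<mu>"] show False
    by (auto simp: lookup_single when_def one_pCons split: if_splits)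
qed

definition signed_eps :: "nat \<times> bool \<Rightarrow> weight" where
  "signed_eps k = (if snd k then eps (fst k) else - eps (fst k))"

lemma lookup_signed_eps:
  "Poly_Mapping.lookup (signed_eps k) i = (if fst k = i then (if snd k then 1 else -1) else 0)"
  by (simp add: signed_eps_def lookup_eps)

lemma nodes_var: "nodes var k = wexp (signed_eps k)"
  by (simp add: case_prod_unfold signed_def signed_eps_def wexp_uminus)

lemma inj_signed_eps: "inj signed_eps"
proof
  fix k l assume eq: "signed_eps k = signed_eps l"
  have "Poly_Mapping.lookup (signed_eps k) (fst k) = Poly_Mapping.lookup (signed_eps l) (fst k)"
    by (simp add: eq)
  then show "k = l" by (auto simp: lookup_signed_eps prod_eq_iff split: if_splits)
qed

lemma generic_on_var: "generic_on (var :: nat \<Rightarrow> (weight \<Rightarrow>\<^sub>0 'a::idom) fract) I"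
proof -
  have "inj_on (nodes (var :: nat \<Rightarrow> (weight \<Rightarrow>\<^sub>0 'a) fract)) (I \<times> UNIV)"
    by (rule inj_onI) (metis nodes_var wexp_eq_iff inj_signed_eps injD)
  then show ?thesis by (simp add: generic_on_def)
qed

lemma weyl_action_add:
  assumes "ys \<in> arrangements {..<n}"
  shows "weyl_action ys (u + v) = weyl_action ys u + weyl_action ys v"
  by (rule weyl_action_eqI[OF assms]) (simp add: lookup_add lookup_weyl_action[OF assms] distrib_left)

lemma weyl_action_uminus:
  assumes "ys \<in> arrangements {..<n}"
  shows "weyl_action ys (- v) = - weyl_action ys v"
  by (rule weyl_action_eqI[OF assms]) (simp add: lookup_weyl_action[OF assms])

lemma weyl_action_diff:
  assumes "ys \<in> arrangements {..<n}"
  shows "weyl_action ys (u - v) = weyl_action ys u - weyl_action ys v"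
  by (rule weyl_action_eqI[OF assms]) (simp add: lookup_minus lookup_weyl_action[OF assms] right_diff_distrib)

lemma weyl_action_0: "ys \<in> arrangements {..<n} \<Longrightarrow> weyl_action ys 0 = 0"
  by (rule weyl_action_eqI) auto

lemma weyl_action_eps:
  assumes "ys \<in> arrangements {..<n}" "i < n"
  shows "weyl_action ys (eps i) = signed_eps (ys ! i)"
proof (rule weyl_action_eqI[OF assms(1)])
  fix j
  have len: "length ys = n" using length_arrangement[OF assms(1)] by simp
  have "perm_of ys i = perm_of ys j \<longleftrightarrow> i = j"
    using perm_of_permutes[OF assms(1)] by (metis permutes_inj injD)
  then show "Poly_Mapping.lookup (signed_eps (ys ! i)) (perm_of ys j) =
      sign_of ys j * Poly_Mapping.lookup (eps i) j"
    using assms(2) len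
    by (auto simp: lookup_signed_eps lookup_eps sign_of_def perm_of_def[of ys i])
qed

text \<open>The roots are grouped by their first basis vector, which is the order of factors in
  \<open>weight_product\<close>.\<close>

lemma prod_positive_roots:
  fixes f :: "weight \<Rightarrow> 'a::comm_monoid_mult"
  shows "(\<Prod>\<alpha>\<in>positive_roots X n. f \<alpha>) = (\<Prod>i<n.
     (case X of Type_B \<Rightarrow> f (eps i) | Type_C \<Rightarrow> f (eps i + eps i) | Type_D \<Rightarrow> 1) *
     (\<Prod>j\<in>{i<..<n}. f (eps i - eps j) * f (eps i + eps j)))"
proof -
  define P where "P = (SIGMA i:{..<n}. {i<..<n})"
  define M where "M = (\<lambda>(i, j). eps i - eps j) ` P"
  define S where "S = (\<lambda>(i, j). eps i + eps j) ` P"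
  define E where "E = (case X of Type_B \<Rightarrow> eps ` {..<n} | Type_C \<Rightarrow> (\<lambda>i. eps i + eps i) ` {..<n} | Type_D \<Rightarrow> {})"
  have fin: "finite P" "finite M" "finite S" "finite E"
    by (auto simp: P_def M_def S_def E_def split: root_type.split)
  have roots: "positive_roots X n = M \<union> S \<union> E"
    by (cases X) (force simp: positive_roots_def M_def S_def E_def P_def)+
  have lt: "i < j" "j < n" if "(i, j) \<in> P" for i j using that by (auto simp: P_def)
  have injM: "inj_on (\<lambda>(i, j). eps i - eps j) P"
  proof (rule inj_onI, clarify)
    fix i j i' j' assume P: "(i, j) \<in> P" "(i', j') \<in> P" and eq: "eps i - eps j = eps i' - eps j'"
    have "Poly_Mapping.lookup (eps i - eps j) k = Poly_Mapping.lookup (eps i' - eps j') k" for k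
      by (simp add: eq)
    from this[of i] this[of j] show "i = i' \<and> j = j'"
      using lt[OF P(1)] lt[OF P(2)] by (auto simp: lookup_minus lookup_eps split: if_splits)
  qed
  have injS: "inj_on (\<lambda>(i, j). eps i + eps j) P"
  proof (rule inj_onI, clarify)
    fix i j i' j' assume P: "(i, j) \<in> P" "(i', j') \<in> P" and eq: "eps i + eps j = eps i' + eps j'"
    have "Poly_Mapping.lookup (eps i + eps j) k = Poly_Mapping.lookup (eps i' + eps j') k" for k
      by (simp add: eq)
    from this[of i] this[of j] this[of i'] this[of j'] show "i = i' \<and> j = j'"
      using lt[OF P(1)] lt[OF P(2)] by (auto simp: lookup_add lookup_eps split: if_splits)
  qed
  have MS: "M \<inter> S = {}"
  proof -
    have False if P: "(i, j) \<in> P" "(i', j') \<in> P" and eq: "eps i - eps j = eps i' + eps j'" for i j i' j'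
    proof -
      have "Poly_Mapping.lookup (eps i - eps j) j = Poly_Mapping.lookup (eps i' + eps j') j" by (simp add: eq)
      then show False using lt[OF P(1)] by (auto simp: lookup_add lookup_minus lookup_eps split: if_splits)
    qed
    then show ?thesis by (auto simp: M_def S_def)
  qed
  have E: "\<exists>i<n. \<exists>c>0. \<forall>k. Poly_Mapping.lookup v k = (if i = k then c else 0)" if "v \<in> E" for v
    using that by (cases X) (force simp: E_def lookup_eps lookup_double)+
  have ME: "(M \<union> S) \<inter> E = {}"
  proof -
    have False if P: "(i, j) \<in> P" and v: "v = eps i - eps j \<or> v = eps i + eps j" "v \<in> E" for i j v
    proof -
      obtain k c where kc: "c > 0" "\<And>m. Poly_Mapping.lookup v m = (if k = m then c else 0)"
        using E[OF v(2)] by blast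
      show False using v(1) kc(2)[of i] kc(2)[of j] kc(1) lt[OF P]
        by (auto simp: lookup_add lookup_minus lookup_eps split: if_splits)
    qed
    then show ?thesis by (auto simp: M_def S_def)
  qed
  have prodE: "(\<Prod>\<alpha>\<in>E. f \<alpha>) =
      (\<Prod>i<n. case X of Type_B \<Rightarrow> f (eps i) | Type_C \<Rightarrow> f (eps i + eps i) | Type_D \<Rightarrow> 1)"
  proof (cases X)
    case Type_B
    have "inj_on eps {..<n}"
    proof (rule inj_onI)
      fix i j assume "eps i = eps j"
      from arg_cong[OF this, of "\<lambda>v. Poly_Mapping.lookup v i"] show "i = j"
        by (simp add: lookup_eps split: if_splits)
    qed
    then show ?thesis by (simp add: E_def Type_B prod.reindex)
  next
    case Type_C
    have "inj_on (\<lambda>i. eps i + eps i) {..<n}"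
    proof (rule inj_onI)
      fix i j assume "eps i + eps i = eps j + eps j"
      from arg_cong[OF this, of "\<lambda>v. Poly_Mapping.lookup v i"] show "i = j"
        by (simp add: lookup_double lookup_eps split: if_splits)
    qed
    then show ?thesis by (simp add: E_def Type_C prod.reindex o_def)
  qed (simp add: E_def)
  have "(\<Prod>\<alpha>\<in>positive_roots X n. f \<alpha>) = prod f M * prod f S * prod f E"
    unfolding roots using fin MS ME by (simp add: prod.union_disjoint)
  also have "prod f M * prod f S = (\<Prod>p\<in>P. f (eps (fst p) - eps (snd p)) * f (eps (fst p) + eps (snd p)))"
    unfolding M_def S_def prod.reindex[OF injM] prod.reindex[OF injS]
    by (simp add: prod.distrib case_prod_unfold o_def)
  also have "\<dots> = (\<Prod>i<n. \<Prod>j\<in>{i<..<n}. f (eps i - eps j) * f (eps i + eps j))"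
    unfolding P_def by (subst prod.Sigma) (auto simp: case_prod_unfold)
  finally show ?thesis by (simp add: prodE prod.distrib mult.commute)
qed

lemma weight_product_eq_prod:
  "weight_product g h ys = (\<Prod>i<length ys. g (ys ! i) * (\<Prod>j\<in>{i<..<length ys}. h (ys ! i) (fst (ys ! j))))"
proof (induction ys)
  case (Cons y ys)
  have "prod_list (map (h y \<circ> fst) ys) = (\<Prod>j<length ys. h y (fst (ys ! j)))"
    by (simp add: prod.list_conv_set_nth atLeast0LessThan)
  also have "\<dots> = (\<Prod>j\<in>{0<..<Suc (length ys)}. h y (fst ((y # ys) ! j)))"
    by (rule prod.reindex_bij_witness[of _ "\<lambda>j. j - 1" Suc]) auto
  finally have first: "prod_list (map (h y \<circ> fst) ys) = \<dots>" .
  have rest: "(\<Prod>j\<in>{i<..<length ys}. h (ys ! i) (fst (ys ! j))) =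
      (\<Prod>j\<in>{Suc i<..<Suc (length ys)}. h (ys ! i) (fst ((y # ys) ! j)))" for i
    by (rule prod.reindex_bij_witness[of _ "\<lambda>j. j - 1" Suc]) auto
  show ?case
    unfolding weight_product.simps Cons.IH first rest length_Cons prod.lessThan_Suc_shift
    by simp
qed simp

text \<open>The roots \<open>\<epsilon>\<^sub>i - \<epsilon>\<^sub>j\<close> and \<open>\<epsilon>\<^sub>i + \<epsilon>\<^sub>j\<close> are taken together: only the product of their factors is
  invariant under inverting the later entry.\<close>

lemma root_factor_pair:
  fixes a b :: "'a::field"
  assumes "a \<noteq> 0" "b \<noteq> 0"
  shows "(1 - t * inverse (a / b)) / (1 - inverse (a / b)) *
      ((1 - t * inverse (a * b)) / (1 - inverse (a * b))) = pair_ratio t a b"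
proof -
  have 1: "1 - s * inverse (a / b) = (a - s * b) / a" "1 - s * inverse (a * b) = (a - s * inverse b) / a" for s
    using assms by (simp_all add: field_simps)
  show ?thesis
    using 1[of t] 1[of 1] assms by (simp add: pair_ratio_def)
qed

lemma root_factor_single:
  fixes a :: "'a::field"
  assumes "a \<noteq> 0"
  shows "(1 - t * inverse a) / (1 - inverse a) = (a - t) / (a - 1)"
proof -
  have "1 - s * inverse a = (a - s) / a" for s using assms by (simp add: field_simps)
  from this[of t] this[of 1] show ?thesis using assms by simp
qed

definition self_factor :: "root_type \<Rightarrow> 'a::field \<Rightarrow> (nat \<Rightarrow> 'a) \<Rightarrow> nat \<times> bool \<Rightarrow> 'a" where
  "self_factor X t x k = self_ratio X t (nodes x k)"

definition pair_factor :: "'a::field \<Rightarrow> (nat \<Rightarrow> 'a) \<Rightarrow> nat \<times> bool \<Rightarrow> nat \<Rightarrow> 'a" where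
  "pair_factor t x k j = pair_ratio t (nodes x k) (x j)"

lemma prod_root_factors:
  fixes t :: "(weight \<Rightarrow>\<^sub>0 'a::idom) fract"
  assumes ys: "ys \<in> arrangements {..<n}"
  shows "(\<Prod>\<alpha>\<in>positive_roots X n. (1 - t * wexp (weyl_action ys (- \<alpha>))) / (1 - wexp (weyl_action ys (- \<alpha>)))) =
    weight_product (self_factor X t var) (pair_factor t var) ys"
proof -
  have len: "length ys = n" using length_arrangement[OF ys] by simp
  define y :: "nat \<Rightarrow> (weight \<Rightarrow>\<^sub>0 'a) fract" where "y i = nodes var (ys ! i)" for i
  define f where "f \<alpha> = (1 - t * wexp (weyl_action ys (- \<alpha>))) / (1 - wexp (weyl_action ys (- \<alpha>)))" for \<alpha>
  have f: "f \<alpha> = (1 - t * inverse (wexp (weyl_action ys \<alpha>))) / (1 - inverse (wexp (weyl_action ys \<alpha>)))" for \<alpha>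
    by (simp add: f_def weyl_action_uminus[OF ys] wexp_uminus)
  have y0: "y i \<noteq> 0" for i by (simp add: y_def nodes_var)
  have y: "wexp (weyl_action ys (eps i)) = y i" if "i < n" for i
    by (simp add: weyl_action_eps[OF ys that] y_def nodes_var)
  have single: "(case X of Type_B \<Rightarrow> f (eps i) | Type_C \<Rightarrow> f (eps i + eps i) | Type_D \<Rightarrow> 1) =
      self_factor X t var (ys ! i)" if i: "i < n" for i
  proof -
    have "f (eps i) = (y i - t) / (y i - 1)"
      unfolding f y[OF i] by (rule root_factor_single[OF y0])
    moreover have "f (eps i + eps i) = ((y i)\<^sup>2 - t) / ((y i)\<^sup>2 - 1)"
      unfolding f weyl_action_add[OF ys] wexp_add y[OF i] power2_eq_square
      by (rule root_factor_single) (simp add: y0)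
    ultimately show ?thesis by (cases X) (simp_all add: self_factor_def self_ratio_def flip: y_def)
  qed
  have pair: "f (eps i - eps j) * f (eps i + eps j) = pair_factor t var (ys ! i) (fst (ys ! j))"
    if ij: "i < n" "j < n" for i j
  proof -
    have "f (eps i - eps j) * f (eps i + eps j) = pair_ratio t (y i) (y j)"
      unfolding f weyl_action_add[OF ys] weyl_action_diff[OF ys] wexp_add wexp_diff y[OF ij(1)] y[OF ij(2)]
      by (rule root_factor_pair) (simp_all add: y0)
    also have "\<dots> = pair_ratio t (y i) (var (fst (ys ! j)))"
      by (simp add: y_def case_prod_unfold pair_ratio_signed)
    finally show ?thesis by (simp add: pair_factor_def y_def)
  qed
  have "(\<Prod>\<alpha>\<in>positive_roots X n. f \<alpha>) =
      (\<Prod>i<n. self_factor X t var (ys ! i) * (\<Prod>j\<in>{i<..<n}. pair_factor t var (ys ! i) (fst (ys ! j))))"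
    unfolding prod_positive_roots by (intro prod.cong arg_cong2[of _ _ _ _ "(*)"]) (auto simp: single pair)
  then show ?thesis unfolding f_def[symmetric] weight_product_eq_prod len .
qed

definition node_power :: "(nat \<Rightarrow> 'a::field) \<Rightarrow> nat \<Rightarrow> nat \<times> bool \<Rightarrow> 'a" where
  "node_power x d k = nodes x k ^ d"

lemma wexp_weyl_action_single:
  assumes "ys \<in> arrangements {..<n}" "i < n"
  shows "wexp (weyl_action ys (Poly_Mapping.single i (int d))) = node_power var d (ys ! i)"
proof (induction d)
  case (Suc d)
  have "Poly_Mapping.single i (int (Suc d)) = eps i + Poly_Mapping.single i (int d)"
    by (simp add: eps_def single_add)
  then show ?case
    using Suc by (simp add: weyl_action_add[OF assms(1)] wexp_add weyl_action_eps[OF assms]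
        nodes_var node_power_def)
qed (simp add: weyl_action_0[OF assms(1)] node_power_def)

lemma wexp_weyl_action_partition:
  assumes ys: "ys \<in> arrangements {..<n}" and "length lam \<le> n"
  shows "wexp (weyl_action ys (partition_weight lam)) = prod_list (map2 (node_power var) lam ys)"
proof -
  have len: "length ys = n" using length_arrangement[OF ys] by simp
  have "wexp (weyl_action ys (\<Sum>i<k. Poly_Mapping.single i (int (lam ! i)))) =
      (\<Prod>i<k. node_power var (lam ! i) (ys ! i))" if "k \<le> n" for k
    using that by (induction k)
      (simp_all add: weyl_action_0[OF ys] weyl_action_add[OF ys] wexp_add wexp_weyl_action_single[OF ys])
  then show ?thesis
    using assms(2) len
    by (simp add: partition_weight_def prod.list_conv_set_nth atLeast0LessThan)
qed

text \<open>The summand of the Weyl group element with window \<open>ys\<close>. It makes sense for every signed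
  arrangement, also for those that do not belong to the Weyl group of type D.\<close>

definition hl_summand :: "root_type \<Rightarrow> nat list \<Rightarrow> (nat \<times> bool) list \<Rightarrow> (weight \<Rightarrow>\<^sub>0 rat poly) fract" where
  "hl_summand X lam ys = prod_list (map2 (node_power var) lam ys) *
     weight_product (self_factor X T_indet var) (pair_factor T_indet var) ys"

lemma hall_littlewood_numerator:
  assumes lam: "length lam \<le> n"
  shows "(\<Sum>w\<in>weyl_group X n. wexp (w (partition_weight lam)) *
        (\<Prod>\<alpha>\<in>positive_roots X n.
           (1 - const_fract [:0, 1:] * wexp (w (- \<alpha>))) / (1 - wexp (w (- \<alpha>))))) =
    (\<Sum>ys\<in>weyl_arrangements X {..<n}. hl_summand X lam ys)"
proof -
  have arr: "ys \<in> arrangements {..<n}" if "ys \<in> weyl_arrangements X {..<n}" for ys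
    using that by (simp add: weyl_arrangements_def)
  show ?thesis
    unfolding sum.reindex_bij_betw[OF bij_betw_weyl_action, symmetric] hl_summand_def
    by (intro sum.cong refl) (simp only: arr prod_root_factors wexp_weyl_action_partition[OF _ lam])
qed

lemma sum_summands:
  assumes "length lam \<le> n"
  shows "(\<Sum>ys\<in>arrangements {..<n}. hl_summand X lam ys) =
    coset_sum (self_factor X T_indet var) (pair_factor T_indet var) (node_power var) lam {..<n} *
    (\<Prod>m=1..n - length lam. coset_poincare X T_indet m)"
proof -
  have "(\<Sum>i\<in>J. \<Sum>b\<in>UNIV. self_factor X T_indet var (i, b) *
      (\<Prod>j\<in>J-{i}. pair_factor T_indet var (i, b) j)) = coset_poincare X T_indet (card J)"
    if J: "J \<subseteq> {..<n}" "J \<noteq> {}" for J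
  proof -
    have "(nodes var k)\<^sup>2 \<noteq> T_indet" for k
      unfolding nodes_var power2_eq_square wexp_add[symmetric] by (rule wexp_neq_T_indet)
    then show ?thesis
      using coset_identity[OF _ generic_on_var J(2) T_indet_neq, of X] finite_subset[OF J(1)]
      by (simp add: self_factor_def pair_factor_def)
  qed
  then show ?thesis
    unfolding hl_summand_def
    using sum_weighted_arrangements[of "{..<n}" "self_factor X T_indet var" "pair_factor T_indet var"
        "coset_poincare X T_indet" lam "node_power var"] assms by simp
qed

lemma coset_poincare_T_indet_nonzero: "m \<ge> 1 \<Longrightarrow> coset_poincare X T_indet m \<noteq> 0"
proof -
  assume m: "m \<ge> 1"
  have "coset_poincare X T_indet m = const_fract (coset_poincare X [:0, 1:] m)"
    by (cases X) (simp_all add: coset_poincare_def const_fract_sum const_fract_add const_fract_power)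
  moreover have "poly (coset_poincare X [:0, 1:] m) (1 :: rat) = of_nat (2 * m)"
    using m by (cases X) (simp_all add: coset_poincare_def poly_sum poly_power of_nat_diff)
  then have "coset_poincare X [:0, 1:] m \<noteq> (0 :: rat poly)" using m by auto
  ultimately show ?thesis by (metis const_fract_0 const_fract_eq_iff)
qed

lemma hall_littlewood_denominator:
  assumes lam: "strict_partition lam" "length lam \<le> n"
  shows "const_fract (\<Sum>w | w \<in> weyl_group X n \<and> w (partition_weight lam) = partition_weight lam.
      [:0, 1:] ^ weyl_length X n w) =
    (\<Sum>zs\<in>weyl_arrangements X {length lam..<n}. T_indet ^ inversions X (map (window n) zs))"
  unfolding sum_over_stabilizer[OF lam] by (simp add: const_fract_sum const_fract_power)

definition hl_coset_sum :: "root_type \<Rightarrow> nat list \<Rightarrow> nat \<Rightarrow> (weight \<Rightarrow>\<^sub>0 rat poly) fract" where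
  "hl_coset_sum X lam n =
     coset_sum (self_factor X T_indet var) (pair_factor T_indet var) (node_power var) lam {..<n}"

text \<open>The positions without a part contribute the product of the \<open>coset_poincare X t m\<close> to the numerator,
  and the denominator is the same product. In type D both are half of the corresponding sums over all signed arrangements,
  by \<open>sum_arrangements_parity\<close>; this needs a position with exponent zero.\<close>

lemma hall_littlewood_eq_hl_coset_sum:
  assumes lam: "strict_partition lam" "length lam \<le> n" and X: "X = Type_D \<Longrightarrow> length lam < n"
  shows "hall_littlewood X n (partition_weight lam) = hl_coset_sum X lam n"
proof -
  let ?l = "length lam"
  define M where "M = (\<Prod>m=1..n - ?l. coset_poincare X T_indet m)"
  define N where "N = (\<Sum>ys\<in>weyl_arrangements X {..<n}. hl_summand X lam ys)"
  define W where "W = (\<Sum>zs\<in>weyl_arrangements X {?l..<n}. T_indet ^ inversions X (map (window n) zs))"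
  have HL: "hall_littlewood X n (partition_weight lam) = N / W"
    unfolding hall_littlewood_def hall_littlewood_numerator[OF lam(2)]
      hall_littlewood_denominator[OF lam] N_def W_def ..
  have M0: "M \<noteq> 0" using coset_poincare_T_indet_nonzero by (auto simp: M_def)
  have allN: "(\<Sum>ys\<in>arrangements {..<n}. hl_summand X lam ys) = hl_coset_sum X lam n * M"
    unfolding sum_summands[OF lam(2)] hl_coset_sum_def M_def ..
  have allW: "(\<Sum>zs\<in>arrangements {?l..<n}. T_indet ^ inversions X (map (window n) zs)) = M"
    unfolding M_def by (subst inversion_generating_function) auto
  show ?thesis
  proof (cases "X = Type_D")
    case False
    then have "weyl_arrangements X I = arrangements I" for I by (simp add: weyl_arrangements_def)
    then show ?thesis unfolding HL using allN allW M0 by (simp add: N_def W_def)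
  next
    case True
    have l: "?l < n" using X[OF True] .
    have flip_snoc: "\<exists>xs a. ys = xs @ [a] \<and> length xs \<ge> ?l" if "ys \<in> arrangements {..<n}" for ys
      using length_arrangement[OF that] l by (cases ys rule: rev_cases) auto
    have "hl_summand X lam (flip_end ys) = hl_summand X lam ys" if ys: "ys \<in> weyl_arrangements X {..<n}" for ys
    proof -
      have "ys \<in> arrangements {..<n}" using ys by (simp add: weyl_arrangements_def)
      from flip_snoc[OF this] obtain xs a where xa: "ys = xs @ [a]" "?l \<le> length xs" by blast
      have "zip lam (xs @ [b]) = zip lam xs" for b
        using xa(2) by (simp add: zip_append2)
      moreover have "weight_product (self_factor X T_indet var) (pair_factor T_indet var) (xs @ [flip a]) =
          weight_product (self_factor X T_indet var) (pair_factor T_indet var) (xs @ [a])"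
        by (rule weight_product_flip_end) (simp add: True self_factor_def self_ratio_def)
      ultimately show ?thesis by (simp add: hl_summand_def xa)
    qed
    then have "hl_coset_sum X lam n * M = N + N"
      using sum_arrangements_parity[of "{..<n}" "hl_summand X lam"] lessThan_empty_iff[of n] l
      unfolding allN[symmetric] N_def unfolding True by simp
    moreover have "M = W + W"
    proof -
      have "T_indet ^ inversions X (map (window n) (flip_end zs)) = T_indet ^ inversions X (map (window n) zs)"
        if zs: "zs \<in> weyl_arrangements X {?l..<n}" for zs
      proof -
        have "zs \<noteq> []" using zs l by (auto simp: weyl_arrangements_def arrangements_def)
        then obtain xs a where "zs = xs @ [a]" by (cases zs rule: rev_cases) auto
        then show ?thesis using True inversions_flip_end by simp
      qed
      then show ?thesis
        using sum_arrangements_parity[of "{?l..<n}" "\<lambda>zs. T_indet ^ inversions X (map (window n) zs)"] l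
        unfolding allW[symmetric] W_def True by simp
    qed
    ultimately have "hl_coset_sum X lam n * (2 * W) = 2 * N" "W \<noteq> 0" using M0 by auto
    then show ?thesis unfolding HL by (simp add: field_simps)
  qed
qed


lemma last_sign_reflection:
  assumes lam: "length lam = Suc k"
  shows "partition_weight (butlast lam) - Poly_Mapping.single k (int (last lam)) =
    reflection (eps k) (partition_weight lam)"
proof (rule poly_mapping_eqI)
  have "last lam = lam ! k" using lam by (cases lam rule: rev_cases) auto
  then show "Poly_Mapping.lookup (partition_weight (butlast lam) - Poly_Mapping.single k (int (last lam))) i =
      Poly_Mapping.lookup (reflection (eps k) (partition_weight lam)) i" for i
    using lam by (auto simp: lookup_reflection_eps lookup_minus lookup_single when_def
      lookup_partition_weight nth_butlast)
qed

text \<open>Both stabilizers are trivial, so the denominators are \<open>1\<close>. Since \<open>\<lambda>'\<close> is the mirror image of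
  \<open>\<lambda>\<close> in the last coordinate, the summand of \<open>\<lambda>'\<close> at \<open>ys\<close> is the summand of \<open>\<lambda>\<close> at
  \<open>flip_end ys\<close>. The two sums are kept apart because each of them has to be specialized.\<close>

lemma hall_littlewood_D_full_length:
  assumes lam: "strict_partition lam" "length lam = n" and n: "n \<ge> 1"
  shows "hall_littlewood Type_D n (partition_weight lam) =
      (\<Sum>ys\<in>weyl_arrangements Type_D {..<n}. hl_summand Type_D lam ys)"
    and "hall_littlewood Type_D n
        (partition_weight (butlast lam) - Poly_Mapping.single (n - 1) (int (last lam))) =
      (\<Sum>ys\<in>weyl_arrangements Type_D {..<n}. hl_summand Type_D lam (flip_end ys))"
    and "(\<Sum>ys\<in>weyl_arrangements Type_D {..<n}. hl_summand Type_D lam ys) +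
      (\<Sum>ys\<in>weyl_arrangements Type_D {..<n}. hl_summand Type_D lam (flip_end ys)) =
      hl_coset_sum Type_D lam n"
proof -
  let ?v = "partition_weight lam"
  obtain k where k: "n = Suc k" using n by (cases n) auto
  define v' where "v' = partition_weight (butlast lam) - Poly_Mapping.single (n - 1) (int (last lam))"
  have v': "v' = reflection (eps k) ?v"
    unfolding v'_def using last_sign_reflection[of lam k] lam(2) k by simp
  have rev: "reflection (eps k) v' = ?v"
    unfolding v' by (rule poly_mapping_eqI) (simp add: lookup_reflection_eps)
  have arr: "ys \<in> arrangements {..<n}" if "ys \<in> weyl_arrangements Type_D {..<n}" for ys
    using that by (simp add: weyl_arrangements_def)
  have flip: "weyl_action ys v' = weyl_action (flip_end ys) ?v" "flip_end ys \<in> arrangements {..<n}"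
    "weight_product (self_factor Type_D t var) h (flip_end ys) =
      weight_product (self_factor Type_D t var) h ys"
    if ys: "ys \<in> arrangements {..<n}" for ys and t :: "(weight \<Rightarrow>\<^sub>0 rat poly) fract" and h
  proof -
    obtain xs a where xa: "ys = xs @ [a]" "length xs = k"
      using length_arrangement[OF ys] k by (cases ys rule: rev_cases) auto
    show "weyl_action ys v' = weyl_action (flip_end ys) ?v"
      using weyl_action_flip[of xs a n] ys unfolding xa v' by (simp add: xa fun_eq_iff)
    show "flip_end ys \<in> arrangements {..<n}" using ys by (auto simp: xa arrangements_def)
    show "weight_product (self_factor Type_D t var) h (flip_end ys) =
      weight_product (self_factor Type_D t var) h ys"
      unfolding xa flip_end_snoc
      by (rule weight_product_flip_end) (simp add: self_factor_def self_ratio_def)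
  qed
  have "weyl_arrangements Type_D {n..<n} = {[]}" by (auto simp: weyl_arrangements_def)
  then have W: "(\<Sum>w | w \<in> weyl_group Type_D n \<and> w ?v = ?v. [:0, 1:] ^ weyl_length Type_D n w) = (1 :: rat poly)"
    using sum_over_stabilizer[OF lam(1) eq_refl[OF lam(2)], where X = Type_D and t = "[:0, 1:] :: rat poly"] lam(2) by simp
  have "{w. w \<in> weyl_group Type_D n \<and> w v' = v'} = {id}"
  proof (intro equalityI subsetI)
    fix w assume "w \<in> {w. w \<in> weyl_group Type_D n \<and> w v' = v'}"
    then have "w \<in> weyl_action ` weyl_arrangements Type_D {..<n}" "w v' = v'"
      by (simp_all only: weyl_action_image mem_Collect_eq)
    then obtain ys where ys: "ys \<in> weyl_arrangements Type_D {..<n}" "w = weyl_action ys" "weyl_action ys v' = v'"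
      by blast
    obtain xs a where xa: "ys = xs @ [a]" "length xs = k"
      using length_arrangement[OF arr[OF ys(1)]] k by (cases ys rule: rev_cases) auto
    have fixed: "Poly_Mapping.lookup v' (perm_of ys i) = sign_of ys i * Poly_Mapping.lookup v' i" for i
      using lookup_weyl_action[OF arr[OF ys(1)], of v' i] ys(3) by simp
    have v'_lookup: "Poly_Mapping.lookup v' i = (if i = k then -1 else 1) * (if i < n then int (lam ! i) else 0)" for i
      unfolding v' lookup_reflection_eps lookup_partition_weight using lam(2) by simp
    have perm: "perm_of ys i = i \<and> sign_of ys i = 1" for i
    proof (cases "i < n")
      case True
      have p: "perm_of ys i < n"
        using permutes_in_image[OF perm_of_permutes[OF arr[OF ys(1)]], of i] True by simp
      have pos: "lam ! i > 0" "lam ! perm_of ys i > 0"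
        using strict_partition_nth(1)[OF lam(1)] True p lam(2) by auto
      have "\<bar>Poly_Mapping.lookup v' (perm_of ys i)\<bar> = \<bar>Poly_Mapping.lookup v' i\<bar>"
        unfolding fixed using sign_of_cases[of ys i] by (auto simp: abs_mult)
      then have "lam ! perm_of ys i = lam ! i" using True p by (simp add: v'_lookup abs_mult split: if_splits)
      then have "perm_of ys i = i" using strict_partition_nth(2)[OF lam(1)] True p lam(2) by blast
      moreover from this have "sign_of ys i = 1"
        using fixed[of i] v'_lookup[of i] True pos sign_of_cases[of ys i] by (auto split: if_splits)
      ultimately show ?thesis by simp
    next
      case False
      then show ?thesis using length_arrangement[OF arr[OF ys(1)]] by (simp add: perm_of_def sign_of_def)
    qed
    have "weyl_action ys u = u" for u
      by (rule weyl_action_eqI[OF arr[OF ys(1)]]) (simp add: perm)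
    then show "w \<in> {id}" using ys(2) by auto
  next
    fix w :: "weight \<Rightarrow> weight" assume w: "w \<in> {id}"
    have "weyl_action (identity_arrangement n) \<in> weyl_group Type_D n"
      unfolding weyl_action_image[symmetric] by (rule imageI[OF identity_arrangement_weyl])
    with w show "w \<in> {w. w \<in> weyl_group Type_D n \<and> w v' = v'}"
      by (simp add: weyl_action_identity)
  qed
  moreover have "weyl_length Type_D n id = 0"
    using weyl_length_eq_inversions[OF identity_arrangement_weyl[of n Type_D]]
    by (simp add: weyl_action_identity inversions_identity)
  ultimately have W': "(\<Sum>w | w \<in> weyl_group Type_D n \<and> w v' = v'. [:0, 1:] ^ weyl_length Type_D n w) = (1 :: rat poly)"
    by simp
  have N': "(\<Sum>w\<in>weyl_group Type_D n. wexp (w v') *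
        (\<Prod>\<alpha>\<in>positive_roots Type_D n.
           (1 - const_fract [:0, 1:] * wexp (w (- \<alpha>))) / (1 - wexp (w (- \<alpha>))))) =
    (\<Sum>ys\<in>weyl_arrangements Type_D {..<n}. hl_summand Type_D lam (flip_end ys))"
    unfolding sum.reindex_bij_betw[OF bij_betw_weyl_action, symmetric] hl_summand_def
    by (intro sum.cong refl) (simp add: arr prod_root_factors flip wexp_weyl_action_partition[where n = n] lam(2))
  show "hall_littlewood Type_D n ?v = (\<Sum>ys\<in>weyl_arrangements Type_D {..<n}. hl_summand Type_D lam ys)"
    unfolding hall_littlewood_def W hall_littlewood_numerator[OF eq_refl[OF lam(2)]] by simp
  show "hall_littlewood Type_D n
        (partition_weight (butlast lam) - Poly_Mapping.single (n - 1) (int (last lam))) =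
      (\<Sum>ys\<in>weyl_arrangements Type_D {..<n}. hl_summand Type_D lam (flip_end ys))"
    unfolding hall_littlewood_def v'_def[symmetric] W' N' by simp
  have "(\<Sum>ys\<in>weyl_arrangements Type_D {..<n}. hl_summand Type_D lam ys) +
      (\<Sum>ys\<in>weyl_arrangements Type_D {..<n}. hl_summand Type_D lam (flip_end ys)) =
      (\<Sum>ys\<in>arrangements {..<n}. hl_summand Type_D lam ys)"
    using sum_arrangements_parity[of "{..<n}" "hl_summand Type_D lam"] lessThan_empty_iff[of n] n by simp
  also have "\<dots> = hl_coset_sum Type_D lam n"
    using sum_summands[OF eq_refl[OF lam(2)], of Type_D] lam(2) by (simp add: hl_coset_sum_def)
  finally show "(\<Sum>ys\<in>weyl_arrangements Type_D {..<n}. hl_summand Type_D lam ys) +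
      (\<Sum>ys\<in>weyl_arrangements Type_D {..<n}. hl_summand Type_D lam (flip_end ys)) =
      hl_coset_sum Type_D lam n" .
qed

section \<open>Specialization at minus one\<close>

lemma eval_coeffs_add: "eval_coeffs c (p + q) = eval_coeffs c p + eval_coeffs c q"
  by (rule poly_mapping_eqI) (simp add: lookup_eval_coeffs lookup_add)

lemma eval_coeffs_single: "eval_coeffs c (Poly_Mapping.single \<mu> p) = Poly_Mapping.single \<mu> (poly p c)"
  by (rule poly_mapping_eqI) (simp add: lookup_eval_coeffs lookup_single when_def)

lemma specializes_to_to_fract: "specializes_to c (to_fract p) (to_fract (eval_coeffs c p))"
proof -
  have "eval_coeffs c (1 :: weight \<Rightarrow>\<^sub>0 rat poly) = 1"
    using eval_coeffs_single[of c 0 1] by (simp add: single_one)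
  then show ?thesis unfolding specializes_to_def
    by (intro exI[of _ p] exI[of _ 1]) (simp add: to_fract_def)
qed

lemma specializes_to_wexp: "specializes_to c (wexp \<mu>) (wexp \<mu>)"
  using specializes_to_to_fract[of c "Poly_Mapping.single \<mu> 1"]
  by (simp add: wexp_def eval_coeffs_single)

lemma specializes_to_const: "specializes_to c (const_fract p) (const_fract (poly p c))"
  using specializes_to_to_fract[of c "Poly_Mapping.single 0 p"]
  by (simp add: const_fract_def eval_coeffs_single)

lemma specializes_to_add:
  assumes "specializes_to c f f'" "specializes_to c g g'"
  shows "specializes_to c (f + g) (f' + g')"
proof -
  obtain p q where pq: "f = Fract p q" "eval_coeffs c q \<noteq> 0" "f' = Fract (eval_coeffs c p) (eval_coeffs c q)"
    using assms(1) unfolding specializes_to_def by blast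
  obtain r s where rs: "g = Fract r s" "eval_coeffs c s \<noteq> 0" "g' = Fract (eval_coeffs c r) (eval_coeffs c s)"
    using assms(2) unfolding specializes_to_def by blast
  have "q \<noteq> 0" "s \<noteq> 0" using pq(2) rs(2) by (auto simp: eval_coeffs_0)
  then show ?thesis unfolding specializes_to_def
    using pq rs by (intro exI[of _ "p * s + r * q"] exI[of _ "q * s"])
      (simp add: eval_coeffs_add eval_coeffs_mult)
qed

lemma specializes_to_mult:
  assumes "specializes_to c f f'" "specializes_to c g g'"
  shows "specializes_to c (f * g) (f' * g')"
proof -
  obtain p q where pq: "f = Fract p q" "eval_coeffs c q \<noteq> 0" "f' = Fract (eval_coeffs c p) (eval_coeffs c q)"
    using assms(1) unfolding specializes_to_def by blast
  obtain r s where rs: "g = Fract r s" "eval_coeffs c s \<noteq> 0" "g' = Fract (eval_coeffs c r) (eval_coeffs c s)"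
    using assms(2) unfolding specializes_to_def by blast
  show ?thesis unfolding specializes_to_def
    using pq rs by (intro exI[of _ "p * r"] exI[of _ "q * s"]) (simp add: eval_coeffs_mult)
qed

lemma specializes_to_inverse:
  assumes "specializes_to c f f'" "f' \<noteq> 0"
  shows "specializes_to c (inverse f) (inverse f')"
proof -
  obtain p q where pq: "f = Fract p q" "eval_coeffs c q \<noteq> 0" "f' = Fract (eval_coeffs c p) (eval_coeffs c q)"
    using assms(1) unfolding specializes_to_def by blast
  have "eval_coeffs c p \<noteq> 0" using assms(2) pq by (auto simp: fract_collapse)
  then show ?thesis unfolding specializes_to_def
    using pq by (intro exI[of _ q] exI[of _ p]) simp
qed

lemma specializes_to_1: "specializes_to c 1 1"
  using specializes_to_const[of c 1] by simp

lemma specializes_to_0: "specializes_to c 0 0"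
  using specializes_to_const[of c 0] by simp

lemma specializes_to_uminus: "specializes_to c f f' \<Longrightarrow> specializes_to c (- f) (- f')"
proof -
  assume f: "specializes_to c f f'"
  have m1: "(const_fract (-1) :: (weight \<Rightarrow>\<^sub>0 'a::idom) fract) = -1"
    using const_fract_add[of "-1 :: 'a" 1] by (simp add: eq_neg_iff_add_eq_0)
  have "specializes_to c (-1) (-1)" using specializes_to_const[of c "-1"] by (simp add: m1)
  from specializes_to_mult[OF this f] show ?thesis by simp
qed

lemma specializes_to_diff:
  "specializes_to c f f' \<Longrightarrow> specializes_to c g g' \<Longrightarrow> specializes_to c (f - g) (f' - g')"
  using specializes_to_add[of c f f' "- g" "- g'"] specializes_to_uminus[of c g g'] by simp

lemma specializes_to_divide:
  "specializes_to c f f' \<Longrightarrow> specializes_to c g g' \<Longrightarrow> g' \<noteq> 0 \<Longrightarrow> specializes_to c (f / g) (f' / g')"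
  unfolding divide_inverse by (intro specializes_to_mult specializes_to_inverse)

lemma specializes_to_power: "specializes_to c f f' \<Longrightarrow> specializes_to c (f ^ k) (f' ^ k)"
  by (induction k) (auto intro: specializes_to_mult specializes_to_1)

lemma specializes_to_sum:
  "(\<And>i. i \<in> A \<Longrightarrow> specializes_to c (f i) (f' i)) \<Longrightarrow> specializes_to c (sum f A) (sum f' A)"
  by (induction A rule: infinite_finite_induct) (auto intro: specializes_to_add specializes_to_0)

lemma specializes_to_prod:
  "(\<And>i. i \<in> A \<Longrightarrow> specializes_to c (f i) (f' i)) \<Longrightarrow> specializes_to c (prod f A) (prod f' A)"
  by (induction A rule: infinite_finite_induct) (auto intro: specializes_to_mult specializes_to_1)

lemma specializes_to_T: "specializes_to (-1) T_indet (-1)"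
proof -
  have "(const_fract (-1) :: (weight \<Rightarrow>\<^sub>0 rat) fract) = -1"
    using const_fract_add[of "-1 :: rat" 1] by (simp add: eq_neg_iff_add_eq_0)
  then show ?thesis using specializes_to_const[of "-1" "[:0, 1:]"] by simp
qed

lemma specializes_to_nodes: "specializes_to c (nodes var k) (nodes var k)"
  unfolding nodes_var by (rule specializes_to_wexp)

lemma nodes_var_neq:
  fixes k :: "nat \<times> bool"
  defines "y \<equiv> (nodes var k :: (weight \<Rightarrow>\<^sub>0 'a::idom) fract)"
  shows "y \<noteq> 0" "y \<noteq> 1" "y\<^sup>2 \<noteq> 1"
    and "fst k \<noteq> j \<Longrightarrow> y \<noteq> var j" "fst k \<noteq> j \<Longrightarrow> y \<noteq> inverse (var j)"
proof -
  obtain i b where k: "k = (i, b)" by (cases k)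
  show y: "y \<noteq> 0" "y\<^sup>2 \<noteq> 1"
    using generic_on_signed[OF generic_on_var[of UNIV], of i b] by (auto simp: y_def k)
  then show "y \<noteq> 1" by auto
  show "y \<noteq> var j" "y \<noteq> inverse (var j)" if "fst k \<noteq> j"
  proof -
    have "signed_eps k \<noteq> signed_eps (j, b)" for b
      using injD[OF inj_signed_eps, of k "(j, b)"] that by auto
    from this[of True] this[of False] show "y \<noteq> var j" "y \<noteq> inverse (var j)"
      unfolding y_def nodes_var wexp_uminus[symmetric] wexp_eq_iff by (auto simp: signed_eps_def)
  qed
qed

lemma specializes_to_self_factor:
  "specializes_to (-1) (self_factor X T_indet var k) (self_factor X (-1) var k)"
  unfolding self_factor_def self_ratio_def using nodes_var_neq[of k]
  by (cases X) (auto intro!: specializes_to_divide specializes_to_diff specializes_to_power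
      specializes_to_diff[OF _ specializes_to_T, simplified] specializes_to_nodes specializes_to_1
      simp del: split_paired_All)

text \<open>The denominators of the pair factors are free of \<open>t\<close>, so the specialization is regular as soon as
  they do not vanish.\<close>

lemma specializes_to_pair_factor:
  assumes "j \<noteq> fst k"
  shows "specializes_to (-1) (pair_factor T_indet var k j) (pair_factor (-1) var k j)"
proof -
  have "((nodes var k - var j) * (nodes var k - inverse (var j)) :: (weight \<Rightarrow>\<^sub>0 rat) fract) \<noteq> 0"
    using nodes_var_neq(4,5)[of k j] assms by (simp del: split_paired_All)
  then show ?thesis
    unfolding pair_factor_def pair_ratio_def
    by (intro specializes_to_divide specializes_to_diff specializes_to_mult specializes_to_inverse
        specializes_to_nodes specializes_to_T specializes_to_wexp) simp_all
qed

lemma specializes_to_coset_sum: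
  "specializes_to (-1)
    (coset_sum (self_factor X T_indet var) (pair_factor T_indet var) (node_power var) lam I)
    (coset_sum (self_factor X (-1) var) (pair_factor (-1) var) (node_power var) lam I)"
proof (induction lam arbitrary: I)
  case (Cons d lam)
  show ?case unfolding coset_sum.simps node_power_def
    by (intro specializes_to_sum specializes_to_mult specializes_to_prod specializes_to_self_factor
        specializes_to_pair_factor specializes_to_power specializes_to_nodes)
      (use Cons.IH in \<open>auto simp: node_power_def[abs_def]\<close>)
qed (simp add: specializes_to_1)

lemma specializes_to_prod_list:
  "(\<And>y. y \<in> set ys \<Longrightarrow> specializes_to c (f y) (f' y)) \<Longrightarrow>
    specializes_to c (prod_list (map f ys)) (prod_list (map f' ys))"
  by (induction ys) (auto intro: specializes_to_mult specializes_to_1)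

text \<open>Every single summand is regular at \<open>t = -1\<close>. For weights with trivial stabilizer this shows that the
  Hall--Littlewood function is regular there.\<close>

lemma summand_regular:
  assumes "distinct (map fst ys)"
  shows "\<exists>g. specializes_to (-1) (hl_summand X lam ys) g"
proof -
  have "specializes_to (-1) (node_power var d k) (node_power var d k)" for d k
    unfolding node_power_def by (rule specializes_to_power[OF specializes_to_nodes])
  then have powers: "specializes_to (-1) (prod_list (map2 (node_power var) lam ys))
      (prod_list (map2 (node_power var) lam ys))"
    by (intro specializes_to_prod_list) (simp add: case_prod_unfold)
  have "specializes_to (-1) (weight_product (self_factor X T_indet var) (pair_factor T_indet var) ys)
      (weight_product (self_factor X (-1) var) (pair_factor (-1) var) ys)"
    using assms
  proof (induction ys)
    case (Cons y ys)
    have "specializes_to (-1) ((pair_factor T_indet var y \<circ> fst) z) ((pair_factor (-1) var y \<circ> fst) z)"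
      if "z \<in> set ys" for z
    proof -
      have "fst y \<notin> fst ` set ys" using Cons.prems by simp
      then have "fst z \<noteq> fst y" using imageI[OF that, of fst] by metis
      then show ?thesis unfolding o_apply by (rule specializes_to_pair_factor)
    qed
    then show ?case
      using Cons unfolding weight_product.simps
      by (intro specializes_to_mult specializes_to_self_factor specializes_to_prod_list) auto
  qed (simp add: specializes_to_1)
  with powers show ?thesis unfolding hl_summand_def using specializes_to_mult by blast
qed

section \<open>The three polynomial sequences\<close>

text \<open>The recursion of the Chebyshev polynomials, normalized so that the argument \<open>x + 1/x\<close> gives
  combinations of \<open>x^d\<close> and \<open>x^(-d)\<close>.\<close>

fun trace_polys :: "rat poly \<Rightarrow> rat poly \<Rightarrow> nat \<Rightarrow> rat poly" where
  "trace_polys p q 0 = p"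
| "trace_polys p q (Suc 0) = q"
| "trace_polys p q (Suc (Suc d)) = pCons 0 (trace_polys p q (Suc d)) - trace_polys p q d"

lemma poly_trace_polys:
  fixes u :: "'a::field_char_0"
  assumes "\<And>d. h (Suc (Suc d)) = u * h (Suc d) - h d"
    and "poly (rat_poly p) u = h 0" "poly (rat_poly q) u = h 1"
  shows "poly (rat_poly (trace_polys p q d)) u = h d"
  using assms by (induction p q d rule: trace_polys.induct) (simp_all add: rat_poly_diff map_poly_pCons)

definition trace_values :: "root_type \<Rightarrow> nat \<Rightarrow> 'a::field \<Rightarrow> 'a" where
  "trace_values X d x = (case X of
     Type_B \<Rightarrow> (x ^ d - inverse x ^ d) * ((x + 1) / (x - 1))
   | Type_C \<Rightarrow> (x ^ d - inverse x ^ d) * ((x + inverse x) / (x - inverse x))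
   | Type_D \<Rightarrow> x ^ d + inverse x ^ d)"

definition f_polys :: "root_type \<Rightarrow> nat \<Rightarrow> rat poly" where
  "f_polys X d = (if d = 0 then 1 else case X of
     Type_B \<Rightarrow> trace_polys 0 [:2, 1:] d | Type_C \<Rightarrow> trace_polys 0 [:0, 1:] d
   | Type_D \<Rightarrow> trace_polys [:2:] [:0, 1:] d)"

lemma poly_f_polys:
  fixes x :: "'a::field_char_0"
  assumes "x \<noteq> 0" "x\<^sup>2 \<noteq> 1" "d \<ge> 1"
  shows "poly (rat_poly (f_polys X d)) (x + inverse x) = trace_values X d x"
proof -
  have nz: "x - 1 \<noteq> 0" "x - inverse x \<noteq> 0"
    using assms(1,2) by (auto simp: power2_eq_square field_simps)
  show ?thesis
  proof (cases X)
    case Type_B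
    have "(x - inverse x) * (x + 1) = (x + inverse x + 2) * (x - 1)"
      using assms(1) by (simp add: field_simps)
    then have "(x - inverse x) * ((x + 1) / (x - 1)) = x + inverse x + 2"
      using nz(1) by (simp add: nonzero_divide_eq_eq)
    then have "poly (rat_poly (trace_polys 0 [:2, 1:] d)) (x + inverse x) =
        (x ^ d - inverse x ^ d) * ((x + 1) / (x - 1))"
      by (intro poly_trace_polys power_recurrence(1)[OF assms(1)]) (simp_all add: map_poly_pCons)
    then show ?thesis using assms(3) Type_B by (simp add: f_polys_def trace_values_def)
  next
    case Type_C
    have "poly (rat_poly (trace_polys 0 [:0, 1:] d)) (x + inverse x) =
        (x ^ d - inverse x ^ d) * ((x + inverse x) / (x - inverse x))"
      by (intro poly_trace_polys power_recurrence(1)[OF assms(1)]) (use nz in \<open>simp_all add: map_poly_pCons\<close>)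
    then show ?thesis using assms(3) Type_C by (simp add: f_polys_def trace_values_def)
  next
    case Type_D
    have "poly (rat_poly (trace_polys [:2:] [:0, 1:] d)) (x + inverse x) = x ^ d + inverse x ^ d"
      by (intro poly_trace_polys power_recurrence(2)[OF assms(1)]) (simp_all add: map_poly_pCons)
    then show ?thesis using assms(3) Type_D by (simp add: f_polys_def trace_values_def)
  qed
qed

lemma indet_square_neq_1: "indet\<^sup>2 \<noteq> 1"
proof
  assume "indet\<^sup>2 = 1"
  then have "indet = inverse indet" using indet_nonzero by (simp add: power2_eq_square field_simps)
  then show False using indet_minus_inverse by simp
qed

text \<open>In type B the defining equation is stated for \<open>x = y^2\<close>; the factor \<open>(y + 1/y) / (y - 1/y)\<close> is
  \<open>(x + 1) / (x - 1)\<close>. The sequences are unique, so it suffices to check the defining equations.\<close>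

lemma f_polys_eq: "fB = f_polys Type_B" "fC = f_polys Type_C" "fD = f_polys Type_D"
proof -
  have y2: "indet\<^sup>2 \<noteq> 0" "(indet\<^sup>2)\<^sup>2 \<noteq> 1"
  proof -
    show "indet\<^sup>2 \<noteq> 0" using indet_nonzero by simp
    show "(indet\<^sup>2)\<^sup>2 \<noteq> 1"
    proof
      assume "(indet\<^sup>2)\<^sup>2 = 1"
      then have "indet ^ 4 = 1" by (simp flip: power_mult)
      then have "to_fract ([:0, 1:] ^ 4 :: rat poly) = to_fract 1" by (simp add: indet_power)
      then have "[:0, 1:] ^ 4 = (1 :: rat poly)" by (simp only: to_fract_eq_iff)
      from arg_cong[OF this, of degree] show False by (simp add: degree_power_eq)
    qed
  qed
  have eq: "(indet + inverse indet) / (indet - inverse indet) = (indet\<^sup>2 + 1) / (indet\<^sup>2 - 1)"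
  proof -
    have "(indet + inverse indet) / (indet - inverse indet) =
        (indet * (indet + inverse indet)) / (indet * (indet - inverse indet))"
      using indet_nonzero by simp
    then show ?thesis using indet_nonzero by (simp add: distrib_left right_diff_distrib power2_eq_square)
  qed
  have "is_fB (f_polys Type_B)"
    unfolding is_fB_def Let_def eq
    using poly_f_polys[OF y2, of _ Type_B] by (simp add: trace_values_def f_polys_def[of _ 0])
  then show "fB = f_polys Type_B" using ex1_fB is_fB_fB by blast
  have "is_fC (f_polys Type_C)"
    using poly_f_polys[OF indet_nonzero indet_square_neq_1, of _ Type_C]
    by (simp add: is_fC_def Let_def trace_values_def f_polys_def[of _ 0])
  then show "fC = f_polys Type_C" using ex1_fC is_fC_fC by blast
  have "is_fD (f_polys Type_D)"
    using poly_f_polys[OF indet_nonzero indet_square_neq_1, of _ Type_D]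
    by (simp add: is_fD_def Let_def trace_values_def f_polys_def[of _ 0])
  then show "fD = f_polys Type_D" using ex1_fD is_fD_fD by blast
qed

section \<open>The value at minus one\<close>

text \<open>The sum over the choices of distinct indices for the parts, that is, over the cosets of the symmetric
  group by the permutations of the positions without a part.\<close>

fun partition_sum :: "(nat \<Rightarrow> 'a::field \<Rightarrow> 'a) \<Rightarrow> (nat \<Rightarrow> 'a) \<Rightarrow> nat list \<Rightarrow> nat set \<Rightarrow> 'a" where
  "partition_sum f u [] I = 1"
| "partition_sum f u (d # ds) I = (\<Sum>i\<in>I. f d (u i) *
     (\<Prod>j\<in>I-{i}. (u i + u j) / (u i - u j)) * partition_sum f u ds (I - {i}))"

text \<open>Numerator and denominator are both \<open>a\<close> times an expression in \<open>a + 1/a\<close> and \<open>b + 1/b\<close>.\<close>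

lemma pair_ratio_minus_one:
  fixes a b :: "'a::field"
  assumes "a \<noteq> 0" "b \<noteq> 0"
  shows "pair_ratio (-1) a b = ((a + inverse a) + (b + inverse b)) / ((a + inverse a) - (b + inverse b))"
proof -
  have "(a + b) * (a + inverse b) = a * ((a + inverse a) + (b + inverse b))"
    "(a - b) * (a - inverse b) = a * ((a + inverse a) - (b + inverse b))"
    using assms by (simp_all add: field_simps)
  then show ?thesis using assms(1) by (simp add: pair_ratio_def)
qed

text \<open>In types B and C the one-variable factor changes its sign when \<open>x\<close> is inverted, in type D it is
  constant; so the difference or the sum of the powers appears.\<close>

lemma sum_of_signs_minus_one:
  fixes x :: "'a::field"
  assumes "x \<noteq> 0" "x\<^sup>2 \<noteq> 1"
  shows "(\<Sum>b\<in>UNIV. signed x b ^ d * self_ratio X (-1) (signed x b)) = trace_values X d x"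
proof -
  have nz: "x - 1 \<noteq> 0" "1 - x \<noteq> 0" "x\<^sup>2 - 1 \<noteq> 0" using assms by auto
  have B: "(inverse x + 1) / (inverse x - 1) = - ((x + 1) / (x - 1))"
  proof -
    have "(inverse x + 1) / (inverse x - 1) = (x * (inverse x + 1)) / (x * (inverse x - 1))"
      using assms(1) by simp
    also have "\<dots> = (1 + x) / (1 - x)" using assms(1) by (simp add: distrib_left right_diff_distrib)
    also have "\<dots> = - ((x + 1) / (x - 1))" by (metis add.commute minus_diff_eq minus_divide_right)
    finally show ?thesis .
  qed
  have C1: "(y\<^sup>2 + 1) / (y\<^sup>2 - 1) = (y + inverse y) / (y - inverse y)" if "y \<noteq> 0" for y :: 'a
  proof -
    have "(y + inverse y) / (y - inverse y) = (y * (y + inverse y)) / (y * (y - inverse y))"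
      using that by simp
    then show ?thesis using that by (simp add: distrib_left right_diff_distrib power2_eq_square)
  qed
  have C2: "(inverse x + x) / (inverse x - x) = - ((x + inverse x) / (x - inverse x))"
    by (metis add.commute minus_diff_eq minus_divide_right)
  show ?thesis
    using C1[OF assms(1)] C1[of "inverse x"] C2 B assms(1)
    by (cases X) (simp_all add: sum_bool signed_def self_ratio_def trace_values_def left_diff_distrib
        del: times_divide_eq_left times_divide_eq_right)
qed

lemma coset_sum_minus_one:
  fixes x :: "nat \<Rightarrow> 'a::field_char_0"
  assumes "\<And>i. i \<in> I \<Longrightarrow> x i \<noteq> 0 \<and> (x i)\<^sup>2 \<noteq> 1" and "\<forall>d\<in>set lam. d \<ge> 1"
  shows "coset_sum (self_factor X (-1) x) (pair_factor (-1) x) (node_power x) lam I =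
    partition_sum (\<lambda>d. poly (rat_poly (f_polys X d))) (\<lambda>i. x i + inverse (x i)) lam I"
  using assms
proof (induction lam arbitrary: I)
  case (Cons d lam)
  let ?u = "\<lambda>i. x i + inverse (x i)"
  have pair: "pair_factor (-1) x (i, b) j = (?u i + ?u j) / (?u i - ?u j)" if "i \<in> I" "j \<in> I" for i j b
    using pair_ratio_minus_one[of "signed (x i) b" "x j"] Cons.prems(1) that
    by (cases b) (simp_all add: pair_factor_def signed_def add.commute)
  have val: "(\<Sum>b\<in>UNIV. node_power x d (i, b) * self_factor X (-1) x (i, b)) =
      poly (rat_poly (f_polys X d)) (?u i)" if i: "i \<in> I" for i
    using sum_of_signs_minus_one[of "x i" d X] poly_f_polys[of "x i" d X] Cons.prems i
    by (simp add: node_power_def self_factor_def)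
  have IH: "coset_sum (self_factor X (-1) x) (pair_factor (-1) x) (node_power x) lam (I - {i}) =
      partition_sum (\<lambda>d. poly (rat_poly (f_polys X d))) ?u lam (I - {i})" for i
    by (rule Cons.IH) (use Cons.prems in auto)
  have "coset_sum (self_factor X (-1) x) (pair_factor (-1) x) (node_power x) (d # lam) I =
      (\<Sum>i\<in>I. (\<Sum>b\<in>UNIV. node_power x d (i, b) * self_factor X (-1) x (i, b)) *
        (\<Prod>j\<in>I-{i}. (?u i + ?u j) / (?u i - ?u j)) *
        partition_sum (\<lambda>d. poly (rat_poly (f_polys X d))) ?u lam (I - {i}))"
    unfolding coset_sum.simps IH sum_distrib_right
  proof (intro sum.cong refl)
    fix i b assume i: "i \<in> I"
    have "(\<Prod>j\<in>I-{i}. pair_factor (-1) x (i, b) j) = (\<Prod>j\<in>I-{i}. (?u i + ?u j) / (?u i - ?u j))"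
      using pair[OF i] by (intro prod.cong) auto
    then show "node_power x d (i, b) * (self_factor X (-1) x (i, b) * (\<Prod>j\<in>I-{i}. pair_factor (-1) x (i, b) j)) *
        partition_sum (\<lambda>d. poly (rat_poly (f_polys X d))) ?u lam (I - {i}) =
      node_power x d (i, b) * self_factor X (-1) x (i, b) * (\<Prod>j\<in>I-{i}. (?u i + ?u j) / (?u i - ?u j)) *
        partition_sum (\<lambda>d. poly (rat_poly (f_polys X d))) ?u lam (I - {i})"
      by (simp only: mult.assoc)
  qed
  also have "\<dots> = partition_sum (\<lambda>d. poly (rat_poly (f_polys X d))) ?u (d # lam) I"
    unfolding partition_sum.simps by (intro sum.cong refl) (simp only: val)
  finally show ?case .
qed simp

section \<open>Pfaffians\<close>

definition order_sign :: "nat \<Rightarrow> nat \<Rightarrow> 'a::comm_ring_1" where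
  "order_sign i j = (if i < j then 1 else - 1)"

lemma order_sign_swap: "i \<noteq> j \<Longrightarrow> order_sign j i = - order_sign i j"
  by (auto simp: order_sign_def)

text \<open>The sign of the arrangement of \<open>I\<close> that puts \<open>r\<close> and \<open>j\<close> in front, relative to the increasing
  order. It is the sign in the expansion of a Pfaffian.\<close>

definition pair_sign :: "nat \<Rightarrow> nat \<Rightarrow> nat set \<Rightarrow> 'a::comm_ring_1" where
  "pair_sign r j I = order_sign r j * (\<Prod>z\<in>I-{r,j}. order_sign r z * order_sign j z)"

text \<open>The Pfaffian of the submatrix on a set of indices, defined by expansion along the first row. Working
  with index sets avoids renumbering rows and columns when a row is removed.\<close>

function set_pfaffian :: "(nat \<Rightarrow> nat \<Rightarrow> 'a::comm_ring_1) \<Rightarrow> nat set \<Rightarrow> 'a" where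
  "set_pfaffian a I = (if finite I \<and> I \<noteq> {} then
     \<Sum>j\<in>I-{Min I}. pair_sign (Min I) j I * a (Min I) j * set_pfaffian a (I - {Min I, j}) else 1)"
  by pat_completeness auto
termination
proof (relation "measure (card \<circ> snd)")
  fix a :: "nat \<Rightarrow> nat \<Rightarrow> 'a" and I :: "nat set" and j assume I: "finite I \<and> I \<noteq> {}"
  then have "I - {Min I, j} \<subset> I" using Min_in[of I] by blast
  then have "card (I - {Min I, j}) < card I" using I by (intro psubset_card_mono) auto
  then show "((a, I - {Min I, j}), (a, I)) \<in> measure (card \<circ> snd)" by simp
qed simp

declare set_pfaffian.simps [simp del]

lemma set_pfaffian_empty [simp]: "set_pfaffian a {} = 1"
  by (simp add: set_pfaffian.simps)

lemma set_pfaffian_cong: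
  assumes "finite I" "\<And>i j. i \<in> I \<Longrightarrow> j \<in> I \<Longrightarrow> a i j = b i j"
  shows "set_pfaffian a I = set_pfaffian b I"
  using assms
proof (induction "card I" arbitrary: I rule: less_induct)
  case less
  show ?case
  proof (cases "I = {}")
    case False
    have m: "Min I \<in> I" using less.prems(1) False by simp
    have "set_pfaffian a (I - {Min I, j}) = set_pfaffian b (I - {Min I, j})" for j
    proof (rule less.hyps)
      show "card (I - {Min I, j}) < card I" using m less.prems(1) by (intro psubset_card_mono) auto
    qed (use less.prems in auto)
    then show ?thesis
      using m less.prems by (subst (1 2) set_pfaffian.simps) (auto intro!: sum.cong)
  qed simp
qed

lemma pair_sign_swap: "r \<noteq> j \<Longrightarrow> pair_sign j r I = - pair_sign r j I"
  unfolding pair_sign_def by (simp add: order_sign_swap[of r j] insert_commute mult.commute)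

text \<open>Both sides are the sign of an arrangement that begins with \<open>m, j, r, k\<close> or with \<open>r, k, m, j\<close>; moving a
  pair past a pair changes four relative orders and hence no sign.\<close>

lemma pair_sign_exchange:
  assumes fin: "finite I" and mem: "m \<in> I" "j \<in> I" "r \<in> I" "k \<in> I"
    and dist: "m \<noteq> j" "m \<noteq> r" "m \<noteq> k" "j \<noteq> r" "j \<noteq> k" "r \<noteq> k"
  shows "pair_sign m j I * pair_sign r k (I - {m, j}) =
    (pair_sign r k I * pair_sign m j (I - {r, k}) :: 'a::comm_ring_1)"
proof -
  define B where "B = I - {m, j, r, k}"
  define P :: "nat \<Rightarrow> nat \<Rightarrow> 'a" where "P x y = (\<Prod>z\<in>B. order_sign x z * order_sign y z)" for x y
  have "finite B" and notin: "m \<notin> B" "j \<notin> B" "r \<notin> B" "k \<notin> B" using fin by (auto simp: B_def)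
  have sets: "I - {m, j} = insert r (insert k B)" "I - {r, k} = insert m (insert j B)"
    "I - {m, j} - {r, k} = B" "I - {r, k} - {m, j} = B"
  proof -
    show B: "I - {m, j} - {r, k} = B" "I - {r, k} - {m, j} = B" unfolding B_def by blast+
    have "J = insert v (insert w (J - {v, w}))" if "v \<in> J" "w \<in> J" for v w and J :: "nat set"
      using that by blast
    moreover have "r \<in> I - {m, j}" "k \<in> I - {m, j}" "m \<in> I - {r, k}" "j \<in> I - {r, k}"
      using mem dist by simp_all
    ultimately show "I - {m, j} = insert r (insert k B)" "I - {r, k} = insert m (insert j B)"
      using B by metis+
  qed
  have big: "pair_sign x y J = order_sign x y * ((order_sign x v * order_sign y v) *
      ((order_sign x w * order_sign y w) * P x y))"
    if "J - {x, y} = insert v (insert w B)" "v \<noteq> w" "v \<notin> B" "w \<notin> B" for x y v w J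
    unfolding pair_sign_def that(1) P_def using that(2-) \<open>finite B\<close> by simp
  have small: "pair_sign x y J = order_sign x y * P x y" if "J - {x, y} = B" for x y J
    unfolding pair_sign_def that P_def ..
  have e1: "pair_sign m j I = order_sign m j * ((order_sign m r * order_sign j r) *
      ((order_sign m k * order_sign j k) * P m j))"
    by (rule big[OF sets(1) dist(6) notin(3,4)])
  have e2: "pair_sign r k I = order_sign r k * ((order_sign r m * order_sign k m) *
      ((order_sign r j * order_sign k j) * P r k))"
    by (rule big[OF sets(2) dist(1) notin(1,2)])
  have e3: "pair_sign r k (I - {m, j}) = order_sign r k * P r k"
    by (rule small[OF sets(3)])
  have e4: "pair_sign m j (I - {r, k}) = order_sign m j * P m j"
    by (rule small[OF sets(4)])
  have neg: "order_sign r m = (- order_sign m r :: 'a)" "order_sign k m = (- order_sign m k :: 'a)"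
    "order_sign r j = (- order_sign j r :: 'a)" "order_sign k j = (- order_sign j k :: 'a)"
    by (rule order_sign_swap, use dist in simp)+
  show ?thesis unfolding e1 e2 e3 e4 neg by (simp add: mult_ac)
qed

lemma sum_off_diagonal_swap:
  assumes "finite A"
  shows "(\<Sum>j\<in>A. \<Sum>k\<in>A-{j}. g j k) = (\<Sum>k\<in>A. \<Sum>j\<in>A-{k}. g j k)"
proof -
  have "A - {j} = {k\<in>A. j \<noteq> k}" "A - {k} = {j\<in>A. j \<noteq> k}" for j k by auto
  then show ?thesis using sum.swap_restrict[OF assms assms, of g "(\<noteq>)"] by simp
qed

text \<open>Induction: expand the minors of the first-row expansion along \<open>r\<close>, and exchange the order of
  summation; the inner sums are then first-row expansions of the minors that belong to \<open>r\<close>.\<close>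

lemma set_pfaffian_expand:
  fixes a :: "nat \<Rightarrow> nat \<Rightarrow> 'a::comm_ring_1"
  assumes "finite I" "r \<in> I" "\<And>i j. i \<in> I \<Longrightarrow> j \<in> I \<Longrightarrow> i \<noteq> j \<Longrightarrow> a j i = - a i j"
  shows "set_pfaffian a I = (\<Sum>j\<in>I-{r}. pair_sign r j I * a r j * set_pfaffian a (I - {r, j}))"
  using assms
proof (induction "card I" arbitrary: I r rule: less_induct)
  case less
  note fin = less.prems(1) and r = less.prems(2) and skew = less.prems(3)
  define m where "m = Min I"
  have m: "m \<in> I" unfolding m_def by (rule Min_in) (use fin r in auto)
  have first: "set_pfaffian a I = (\<Sum>j\<in>I-{m}. pair_sign m j I * a m j * set_pfaffian a (I - {m, j}))"
    using fin r unfolding m_def by (subst set_pfaffian.simps) auto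
  show ?case
  proof (cases "r = m")
    case False
    let ?A = "I - {m, r}"
    have Im: "I - {m} = insert r ?A" and Ir: "I - {r} = insert m ?A" using r m False by auto
    have left: "set_pfaffian a (I - {m, j}) =
        (\<Sum>k\<in>?A-{j}. pair_sign r k (I - {m, j}) * a r k * set_pfaffian a (I - {m, j} - {r, k}))"
      if j: "j \<in> ?A" for j
    proof -
      have "card (I - {m, j}) < card I" using m fin by (intro psubset_card_mono) auto
      then have "set_pfaffian a (I - {m, j}) =
          (\<Sum>k\<in>I-{m,j}-{r}. pair_sign r k (I - {m, j}) * a r k * set_pfaffian a (I - {m, j} - {r, k}))"
      proof (rule less.hyps)
        show "a i' i = - a i i'" if "i \<in> I - {m, j}" "i' \<in> I - {m, j}" "i \<noteq> i'" for i i'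
          using that by (intro skew) auto
      qed (use fin r j False in auto)
      moreover have "I - {m, j} - {r} = ?A - {j}" by auto
      ultimately show ?thesis by simp
    qed
    have right: "set_pfaffian a (I - {r, k}) =
        (\<Sum>j\<in>?A-{k}. pair_sign m j (I - {r, k}) * a m j * set_pfaffian a (I - {r, k} - {m, j}))"
      if k: "k \<in> ?A" for k
    proof -
      have mk: "m \<in> I - {r, k}" using m k False by auto
      then have "Min (I - {r, k}) = m"
        by (intro Min_eqI) (use fin in \<open>auto simp: m_def\<close>)
      then have "set_pfaffian a (I - {r, k}) =
          (\<Sum>j\<in>I-{r,k}-{m}. pair_sign m j (I - {r, k}) * a m j * set_pfaffian a (I - {r, k} - {m, j}))"
        using mk fin by (subst set_pfaffian.simps) auto
      moreover have "I - {r, k} - {m} = ?A - {k}" by auto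
      ultimately show ?thesis by simp
    qed
    have sets: "I - {m, j} - {r, k} = I - {m, j, r, k}" "I - {r, k} - {m, j} = I - {m, j, r, k}" for j k
      by blast+
    have "(\<Sum>j\<in>?A. pair_sign m j I * a m j * set_pfaffian a (I - {m, j})) =
        (\<Sum>j\<in>?A. \<Sum>k\<in>?A-{j}. (pair_sign m j I * pair_sign r k (I - {m, j})) *
          (a m j * a r k * set_pfaffian a (I - {m, j, r, k})))"
    proof (rule sum.cong[OF refl])
      fix j assume "j \<in> ?A"
      show "pair_sign m j I * a m j * set_pfaffian a (I - {m, j}) =
          (\<Sum>k\<in>?A-{j}. (pair_sign m j I * pair_sign r k (I - {m, j})) *
            (a m j * a r k * set_pfaffian a (I - {m, j, r, k})))"
        unfolding left[OF \<open>j \<in> ?A\<close>] sum_distrib_left sets by (simp only: mult_ac)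
    qed
    also have "\<dots> = (\<Sum>j\<in>?A. \<Sum>k\<in>?A-{j}. (pair_sign r k I * pair_sign m j (I - {r, k})) *
          (a m j * a r k * set_pfaffian a (I - {m, j, r, k})))"
    proof (rule sum.cong[OF refl], rule sum.cong[OF refl])
      fix j k assume "j \<in> ?A" "k \<in> ?A - {j}"
      then have jk: "j \<in> I" "k \<in> I" "m \<noteq> j" "m \<noteq> k" "j \<noteq> r" "j \<noteq> k" "r \<noteq> k" by auto
      have "pair_sign m j I * pair_sign r k (I - {m, j}) =
          (pair_sign r k I * pair_sign m j (I - {r, k}) :: 'a)"
        by (rule pair_sign_exchange[OF fin m jk(1) r jk(2,3) False[symmetric] jk(4-7)])
      then show "pair_sign m j I * pair_sign r k (I - {m, j}) *
            (a m j * a r k * set_pfaffian a (I - {m, j, r, k})) =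
          pair_sign r k I * pair_sign m j (I - {r, k}) *
            (a m j * a r k * set_pfaffian a (I - {m, j, r, k}))" by (rule arg_cong)
    qed
    also have "\<dots> = (\<Sum>k\<in>?A. \<Sum>j\<in>?A-{k}. (pair_sign r k I * pair_sign m j (I - {r, k})) *
          (a m j * a r k * set_pfaffian a (I - {m, j, r, k})))"
      by (rule sum_off_diagonal_swap) (use fin in simp)
    also have "\<dots> = (\<Sum>k\<in>?A. pair_sign r k I * a r k * set_pfaffian a (I - {r, k}))"
    proof (rule sum.cong[OF refl])
      fix k assume "k \<in> ?A"
      show "(\<Sum>j\<in>?A-{k}. (pair_sign r k I * pair_sign m j (I - {r, k})) *
            (a m j * a r k * set_pfaffian a (I - {m, j, r, k}))) =
          pair_sign r k I * a r k * set_pfaffian a (I - {r, k})"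
        unfolding right[OF \<open>k \<in> ?A\<close>] sum_distrib_left sets by (simp only: mult_ac)
    qed
    finally have "(\<Sum>j\<in>?A. pair_sign m j I * a m j * set_pfaffian a (I - {m, j})) = \<dots>" .
    moreover have "pair_sign m r I * a m r = pair_sign r m I * a r m"
      unfolding pair_sign_swap[OF False] skew[OF r m False] by simp
    ultimately show ?thesis
      unfolding first Im Ir using fin by (simp add: insert_commute)
  qed (use first in simp)
qed

subsection \<open>The sum over perfect matchings\<close>

fun list_sign :: "nat list \<Rightarrow> 'a::comm_ring_1" where
  "list_sign [] = 1"
| "list_sign (y # ys) = prod_list (map (order_sign y) ys) * list_sign ys"

fun list_inversions :: "nat list \<Rightarrow> nat" where
  "list_inversions [] = 0"
| "list_inversions (y # ys) = length (filter (\<lambda>z. z < y) ys) + list_inversions ys"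

lemma list_sign_swap:
  "a \<noteq> b \<Longrightarrow> list_sign (xs @ a # b # ts) = - list_sign (xs @ b # a # ts)"
  by (induction xs) (simp_all add: order_sign_swap[of a b] mult_ac)

lemma list_inversions_swap:
  "b < a \<Longrightarrow> list_inversions (xs @ b # a # ts) < list_inversions (xs @ a # b # ts)"
  by (induction xs) simp_all

lemma list_sign_sorted: "sorted_wrt (<) ys \<Longrightarrow> list_sign ys = 1"
proof (induction ys)
  case (Cons y ys)
  have "map (order_sign y) ys = replicate (length ys) (1::'a)"
    using Cons.prems by (intro replicate_eqI) (auto simp: order_sign_def)
  then show ?case using Cons by simp
qed simp

text \<open>Sort the list by exchanges of neighbours; each of them changes both signs.\<close>

lemma sign_list_perm:
  assumes "distinct ys" "set ys = {..<n}"
  shows "sign (list_perm ys) = list_sign ys"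
  using assms
proof (induction "list_inversions ys" arbitrary: ys rule: less_induct)
  case less
  consider "sorted_wrt (<) ys" | xs a b ts where "ys = xs @ a # b # ts" "b < a"
    using sorted_or_adjacent_violation[of "(<)" ys] less.prems(1) by (auto simp: neq_iff)
  then show ?case
  proof cases
    case 1
    have "set [0..<n] = set ys" by (simp add: less.prems(2) atLeast0LessThan)
    then have "[0..<n] = ys" by (intro strict_sorted_equal 1) simp_all
    then have "list_perm ys i = i" for i by (auto simp: list_perm_def)
    then have "list_perm ys = id" by auto
    then show ?thesis using list_sign_sorted[OF 1] by simp
  next
    case 2
    let ?zs = "xs @ b # a # ts" and ?\<tau> = "transpose (length xs) (Suc (length xs))"
    have zs: "distinct ?zs" "set ?zs = {..<n}" 
    proof -
      show "distinct ?zs" using less.prems(1) unfolding 2(1) by auto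
      have "set ?zs = set ys" unfolding 2(1) by auto
      then show "set ?zs = {..<n}" using less.prems(2) by (rule trans)
    qed
    have IH: "sign (list_perm ?zs) = list_sign ?zs"
      by (rule less.hyps[OF _ zs]) (simp add: 2 list_inversions_swap)
    have comp: "list_perm ys = list_perm ?zs \<circ> ?\<tau>"
    proof
      show "list_perm ys i = (list_perm ?zs \<circ> ?\<tau>) i" for i
        by (auto simp: list_perm_def 2(1) nth_append_Cons_Cons transpose_def)
    qed
    have "permutation (list_perm ?zs)"
      unfolding permutation_permutes by (intro exI[of _ "{..<n}"] conjI finite_lessThan list_perm_permutes[OF zs])
    then have "sign (list_perm ys) = - sign (list_perm ?zs)"
      unfolding comp by (simp add: sign_compose permutation_swap_id sign_swap_id)
    also have "\<dots> = list_sign ys"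
      unfolding IH 2(1) by (rule list_sign_swap[symmetric]) (use 2(2) in simp)
    finally show ?thesis .
  qed
qed

fun matching_list :: "nat list \<Rightarrow> bool" where
  "matching_list [] = True"
| "matching_list [a] = False"
| "matching_list (a # b # ys) \<longleftrightarrow> a < b \<and> (ys \<noteq> [] \<longrightarrow> a < hd ys) \<and> matching_list ys"

fun pair_product :: "(nat \<Rightarrow> nat \<Rightarrow> 'a::comm_monoid_mult) \<Rightarrow> nat list \<Rightarrow> 'a" where
  "pair_product a (i # j # ys) = a i j * pair_product a ys"
| "pair_product a _ = 1"

text \<open>The lists of values of the permutations over which the Pfaffian is summed.\<close>

definition matchings :: "nat set \<Rightarrow> nat list set" where
  "matchings I = {ys. distinct ys \<and> set ys = I \<and> matching_list ys}"

lemma matching_list_hd_le: "matching_list ys \<Longrightarrow> y \<in> set ys \<Longrightarrow> hd ys \<le> y"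
proof (induction ys arbitrary: y rule: matching_list.induct)
  case (3 a b ys)
  consider "y = a" | "y = b" | "y \<in> set ys" using 3(3) by auto
  then show ?case
  proof cases
    case 3
    have "hd ys \<le> y" using "3.IH"[OF _ 3] "3.prems"(1) by simp
    moreover have "a < hd ys" using "3.prems"(1) 3 by auto
    ultimately show ?thesis by simp
  qed (use "3.prems" in auto)
qed auto

text \<open>Both monotonicity conditions together say that the first element is the least one; the partner is
  arbitrary, and the rest is a matching of the remaining indices. This is the first-row expansion.\<close>

lemma matchings_Cons_Cons:
  assumes "finite I"
  shows "a # b # ys \<in> matchings I \<longleftrightarrow> I \<noteq> {} \<and> a = Min I \<and> b \<in> I - {Min I} \<and> ys \<in> matchings (I - {Min I, b})"
proof
  assume L: "a # b # ys \<in> matchings I"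
  have set: "I = insert a (insert b (set ys))" and d: "a \<noteq> b" "a \<notin> set ys" "b \<notin> set ys" "distinct ys"
    and m: "matching_list ys" using L by (auto simp: matchings_def)
  have "a \<le> y" if "y \<in> I" for y
    using matching_list_hd_le[of "a # b # ys" y] L that by (auto simp: matchings_def)
  then have "Min I = a" using assms set by (intro Min_eqI) auto
  then show "I \<noteq> {} \<and> a = Min I \<and> b \<in> I - {Min I} \<and> ys \<in> matchings (I - {Min I, b})"
    using set d m by (auto simp: matchings_def)
next
  assume R: "I \<noteq> {} \<and> a = Min I \<and> b \<in> I - {Min I} \<and> ys \<in> matchings (I - {Min I, b})"
  then have a: "a \<in> I" "\<And>y. y \<in> I \<Longrightarrow> a \<le> y" using assms by auto
  have set: "set ys = I - {a, b}" "distinct ys" "matching_list ys" using R by (auto simp: matchings_def)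
  have lt: "a < y" if "y \<in> I" "y \<noteq> a" for y using a(2)[OF that(1)] that(2) by simp
  have "ys \<noteq> [] \<Longrightarrow> hd ys \<in> I - {a, b}" using set(1) by (metis hd_in_set)
  then show "a # b # ys \<in> matchings I"
    using R a(1) set lt by (auto simp: matchings_def)
qed

lemma finite_matchings: "finite I \<Longrightarrow> finite (matchings I)"
  by (rule finite_subset[OF _ finite_lists_length_le[of I "card I"]])
    (auto simp: matchings_def distinct_card)

lemma set_pfaffian_eq_sum_matchings:
  assumes "finite I"
  shows "set_pfaffian a I = (\<Sum>ys\<in>matchings I. list_sign ys * pair_product a ys)"
  using assms
proof (induction "card I" arbitrary: I rule: less_induct)
  case less
  show ?case
  proof (cases "I = {}")
    case True
    then have "matchings I = {[]}" by (auto simp: matchings_def)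
    then show ?thesis using True by simp
  next
    case False
    let ?m = "Min I"
    have m: "?m \<in> I" using less.prems False by simp
    define S where "S = (SIGMA j:I-{?m}. matchings (I - {?m, j}))"
    have bij: "bij_betw (\<lambda>(j, ys). ?m # j # ys) S (matchings I)"
    proof (intro bij_betw_imageI equalityI subsetI)
      fix ys assume ys: "ys \<in> matchings I"
      obtain a b zs where eq: "ys = a # b # zs"
        using ys False by (cases ys rule: matching_list.cases) (auto simp: matchings_def)
      then have "a = ?m" "(b, zs) \<in> S"
        using ys matchings_Cons_Cons[OF less.prems] by (auto simp: S_def)
      then show "ys \<in> (\<lambda>(j, ys). ?m # j # ys) ` S" unfolding eq by force
    qed (use False matchings_Cons_Cons[OF less.prems] in \<open>auto simp: inj_on_def S_def\<close>)
    have sgn: "list_sign (?m # j # ys) = (pair_sign ?m j I * list_sign ys :: 'a)"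
      if "j \<in> I - {?m}" "ys \<in> matchings (I - {?m, j})" for j ys
    proof -
      have ys: "distinct ys" "set ys = I - {?m, j}" using that by (auto simp: matchings_def)
      have "prod_list (map (order_sign ?m) ys) * prod_list (map (order_sign j) ys) =
          (\<Prod>z\<in>I-{?m,j}. order_sign ?m z * order_sign j z :: 'a)"
        unfolding ys(2)[symmetric] prod.distinct_set_conv_list[OF ys(1)] prod.distrib ..
      then show ?thesis by (simp add: pair_sign_def mult_ac)
    qed
    have IH: "set_pfaffian a (I - {?m, j}) =
        (\<Sum>ys\<in>matchings (I - {?m, j}). list_sign ys * pair_product a ys)" for j
    proof (rule less.hyps)
      show "card (I - {?m, j}) < card I" using m less.prems by (intro psubset_card_mono) auto
    qed (use less.prems in auto)
    have "(\<Sum>ys\<in>matchings I. list_sign ys * pair_product a ys) =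
        (\<Sum>(j, ys)\<in>S. list_sign (?m # j # ys) * pair_product a (?m # j # ys))"
      by (subst sum.reindex_bij_betw[OF bij, symmetric]) (simp only: case_prod_unfold)
    also have "\<dots> = (\<Sum>j\<in>I-{?m}. \<Sum>ys\<in>matchings (I - {?m, j}).
        list_sign (?m # j # ys) * pair_product a (?m # j # ys))"
      unfolding S_def using less.prems by (subst sum.Sigma) (auto intro: finite_matchings)
    also have "\<dots> = (\<Sum>j\<in>I-{?m}. pair_sign ?m j I * a ?m j * set_pfaffian a (I - {?m, j}))"
      unfolding IH sum_distrib_left
    proof (intro sum.cong refl)
      fix j ys assume "j \<in> I - {?m}" "ys \<in> matchings (I - {?m, j})"
      note sgn = sgn[OF this]
      show "list_sign (?m # j # ys) * pair_product a (?m # j # ys) =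
          pair_sign ?m j I * a ?m j * (list_sign ys * pair_product a ys)"
        unfolding sgn pair_product.simps by (simp only: mult_ac)
    qed
    also have "\<dots> = set_pfaffian a I"
      using less.prems False by (subst (2) set_pfaffian.simps) simp
    finally show ?thesis by simp
  qed
qed

lemma matching_list_iff:
  assumes "length ys = 2 * m"
  shows "matching_list ys \<longleftrightarrow> (\<forall>i<m. ys ! (2*i) < ys ! (2*i+1)) \<and> (\<forall>i. Suc i < m \<longrightarrow> ys ! (2*i) < ys ! (2 * Suc i))"
  using assms
proof (induction ys arbitrary: m rule: matching_list.induct)
  case (3 a b ys)
  obtain k where k: "m = Suc k" "length ys = 2 * k" using 3(2) by (cases m) auto
  have all: "(\<forall>i<Suc k. P i) \<longleftrightarrow> P 0 \<and> (\<forall>i<k. P (Suc i))" for P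
    by (metis less_Suc_eq_0_disj zero_less_Suc Suc_less_eq)
  have all': "(\<forall>i. Suc i < Suc k \<longrightarrow> P i) \<longleftrightarrow> (k > 0 \<longrightarrow> P 0) \<and> (\<forall>i. Suc i < k \<longrightarrow> P (Suc i))" for P
    by (metis Suc_less_eq gr0_conv_Suc not0_implies_Suc less_nat_zero_code)
  have "ys \<noteq> [] \<longleftrightarrow> k > 0" using k by (cases ys) auto
  moreover have "hd ys = ys ! 0" if "k > 0" using k that by (cases ys) auto
  ultimately show ?case unfolding k(1) all all' using 3(1)[OF k(2)] by auto
qed auto

lemma pair_product_eq_prod:
  "length ys = 2 * m \<Longrightarrow> pair_product a ys = (\<Prod>i<m. a (ys ! (2*i)) (ys ! (2*i+1)))"
proof (induction ys arbitrary: m rule: matching_list.induct)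
  case (3 i j ys)
  obtain k where k: "m = Suc k" "length ys = 2 * k" using 3(2) by (cases m) auto
  show ?case unfolding k(1) prod.lessThan_Suc_shift using 3(1)[OF k(2)] by simp
qed auto

lemma pfaffian_eq_set_pfaffian:
  assumes "even (dim_row M)"
  shows "pfaffian M = set_pfaffian (\<lambda>i j. M $$ (i, j)) {..<dim_row M}"
proof -
  define n where "n = dim_row M"
  define m where "m = n div 2"
  have n: "n = 2 * m" using assms by (simp add: m_def n_def)
  define S where "S = {\<sigma>. \<sigma> permutes {..<n} \<and> (\<forall>i<m. \<sigma> (2*i) < \<sigma> (2*i+1))
            \<and> (\<forall>i. Suc i < m \<longrightarrow> \<sigma> (2*i) < \<sigma> (2 * Suc i))}"
  have len: "length ys = 2 * m" if "ys \<in> matchings {..<n}" for ys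
    using that distinct_card[of ys] n by (auto simp: matchings_def)
  have "pfaffian M = (\<Sum>\<sigma>\<in>S. of_int (sign \<sigma>) * (\<Prod>i<m. M $$ (\<sigma> (2*i), \<sigma> (2*i+1))))"
    unfolding pfaffian_def Let_def S_def m_def n_def ..
  also have "\<dots> = (\<Sum>ys\<in>matchings {..<n}. list_sign ys * pair_product (\<lambda>i j. M $$ (i, j)) ys)"
  proof (rule sum.reindex_bij_witness[of _ list_perm "\<lambda>\<sigma>. map \<sigma> [0..<n]"])
    fix \<sigma> assume \<sigma>: "\<sigma> \<in> S"
    then have perm: "\<sigma> permutes {..<n}" by (simp add: S_def)
    show inv: "list_perm (map \<sigma> [0..<n]) = \<sigma>"
      using permutes_not_in[OF perm] by (auto simp: list_perm_def fun_eq_iff)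
    have dist: "distinct (map \<sigma> [0..<n])" and set: "set (map \<sigma> [0..<n]) = {..<n}"
      using permutes_inj_on[OF perm] permutes_image[OF perm] by (auto simp: distinct_map atLeast0LessThan)
    show mem: "map \<sigma> [0..<n] \<in> matchings {..<n}"
      unfolding matchings_def using dist set \<sigma> by (simp add: matching_list_iff[of _ m] n S_def)
    have "of_int (list_sign ys) = (list_sign ys :: 'a)" for ys
    proof (induction ys)
      case (Cons y ys)
      have "of_int (prod_list (map (order_sign y) ys)) = (prod_list (map (order_sign y) ys) :: 'a)"
        by (induction ys) (simp_all add: order_sign_def)
      then show ?case using Cons by simp
    qed simp
    then have "of_int (sign \<sigma>) = (list_sign (map \<sigma> [0..<n]) :: 'a)"
      using sign_list_perm[OF dist set] inv by metis
    then show "list_sign (map \<sigma> [0..<n]) * pair_product (\<lambda>i j. M $$ (i, j)) (map \<sigma> [0..<n]) =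
        of_int (sign \<sigma>) * (\<Prod>i<m. M $$ (\<sigma> (2*i), \<sigma> (2*i+1)))"
      by (simp add: pair_product_eq_prod[of _ m] n)
  next
    fix ys assume ys: "ys \<in> matchings {..<n}"
    show "map (list_perm ys) [0..<n] = ys"
      using len[OF ys] n by (intro nth_equalityI) (auto simp: list_perm_def)
    have "list_perm ys permutes {..<n}" using ys by (intro list_perm_permutes) (auto simp: matchings_def)
    moreover have "matching_list ys" using ys by (simp add: matchings_def)
    ultimately show "list_perm ys \<in> S"
      using matching_list_iff[OF len[OF ys]] len[OF ys] by (auto simp: S_def list_perm_def)
  qed
  also have "\<dots> = set_pfaffian (\<lambda>i j. M $$ (i, j)) {..<n}"
    by (simp add: set_pfaffian_eq_sum_matchings)
  finally show ?thesis by (simp add: n_def)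
qed

section \<open>Schur's Pfaffian\<close>

text \<open>With \<open>b = schur_entry u\<close> this is the product by which the definition of the generalized
  P-function divides.\<close>

definition ordered_product :: "(nat \<Rightarrow> nat \<Rightarrow> 'a::comm_ring_1) \<Rightarrow> nat set \<Rightarrow> 'a" where
  "ordered_product b I = (\<Prod>j\<in>I. \<Prod>i\<in>{i\<in>I. i < j}. b i j)"

lemma ordered_product_remove:
  assumes "finite I" "r \<in> I" and skew: "\<And>z. z \<in> I - {r} \<Longrightarrow> b z r = - b r z"
  shows "ordered_product b I = (\<Prod>z\<in>I-{r}. order_sign r z * b r z) * ordered_product b (I - {r})"
proof -
  have inner: "(\<Prod>i\<in>{i\<in>I. i < j}. b i j) =
      (if r < j then b r j else 1) * (\<Prod>i\<in>{i\<in>I-{r}. i < j}. b i j)" if "j \<in> I - {r}" for j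
  proof (cases "r < j")
    case True
    then have "{i\<in>I. i < j} = insert r {i\<in>I-{r}. i < j}" using assms(2) by auto
    then show ?thesis using True assms(1) by simp
  next
    case False
    then have "{i\<in>I. i < j} = {i\<in>I-{r}. i < j}" using that by auto
    then show ?thesis using False by simp
  qed
  have "(\<Prod>i\<in>{i\<in>I. i < r}. b i r) = (\<Prod>z\<in>I-{r}. if z < r then b z r else 1)"
    using assms(1) by (intro prod.mono_neutral_cong_left) auto
  moreover have "(\<Prod>z\<in>I-{r}. order_sign r z * b r z) =
      (\<Prod>z\<in>I-{r}. if z < r then b z r else 1) * (\<Prod>z\<in>I-{r}. if r < z then b r z else 1)"
    unfolding prod.distrib[symmetric]
    by (intro prod.cong refl) (auto simp: order_sign_def skew)
  moreover have "ordered_product b I = (\<Prod>i\<in>{i\<in>I. i < r}. b i r) *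
      (\<Prod>j\<in>I-{r}. \<Prod>i\<in>{i\<in>I. i < j}. b i j)"
    unfolding ordered_product_def using assms(1,2) by (rule prod.remove)
  ultimately show ?thesis
    using inner by (simp add: ordered_product_def prod.distrib mult.assoc)
qed

definition schur_entry :: "(nat \<Rightarrow> 'a::field) \<Rightarrow> nat \<Rightarrow> nat \<Rightarrow> 'a" where
  "schur_entry u i j = (u j - u i) / (u j + u i)"

definition schur_generic :: "(nat \<Rightarrow> 'a::field) \<Rightarrow> nat set \<Rightarrow> bool" where
  "schur_generic u I \<longleftrightarrow> finite I \<and> inj_on u I \<and> (\<forall>i\<in>I. \<forall>j\<in>I. u i + u j \<noteq> 0)"

lemma schur_generic_subset: "schur_generic u I \<Longrightarrow> J \<subseteq> I \<Longrightarrow> schur_generic u J"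
  unfolding schur_generic_def by (metis finite_subset inj_on_subset subsetD)

lemma schur_entry_skew: "schur_entry u j i = - schur_entry u i j"
  unfolding schur_entry_def minus_divide_left minus_diff_eq add.commute[of "u i" "u j"] ..

lemma schur_entry_nonzero:
  "schur_generic u I \<Longrightarrow> i \<in> I \<Longrightarrow> j \<in> I \<Longrightarrow> i \<noteq> j \<Longrightarrow> schur_entry u i j \<noteq> 0"
  by (auto simp: schur_generic_def schur_entry_def inj_on_def)

lemma ordered_product_nonzero:
  assumes "schur_generic u I"
  shows "ordered_product (schur_entry u) I \<noteq> 0"
  using schur_entry_nonzero[OF assms] assms
  by (auto simp: ordered_product_def schur_generic_def)

lemma sum_ratios_odd:
  fixes u :: "nat \<Rightarrow> 'a::field_char_0"
  assumes "schur_generic u I" "odd (card I)"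
  shows "(\<Sum>i\<in>I. \<Prod>j\<in>I-{i}. (u i + u j) / (u i - u j)) = 1"
proof -
  have "u i \<noteq> 0" if "i \<in> I" for i using assms(1) that by (force simp: schur_generic_def)
  then have "(1 - (- 1)) * (\<Sum>i\<in>I. \<Prod>j\<in>I-{i}. (u i - (- 1) * u j) / (u i - u j)) = 1 - (- 1) ^ card I"
    using assms(1) by (intro sum_ratios_eq_geometric) (auto simp: schur_generic_def)
  then show ?thesis using assms(2) by simp
qed

text \<open>This is \<open>sum_ratios_eq_geometric\<close> at \<open>t = -1\<close> with \<open>u\<^sub>r\<close> replaced by \<open>- u\<^sub>r\<close>: the term of \<open>r\<close> becomes the
  right-hand side, and the total is zero because the number of nodes is even.\<close>

lemma schur_expansion_identity:
  fixes u :: "nat \<Rightarrow> 'a::field_char_0"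
  assumes gen: "schur_generic u I" and r: "r \<in> I" and even: "even (card I)"
  shows "(\<Sum>j\<in>I-{r}. schur_entry u r j * (\<Prod>z\<in>I-{r,j}. (u j + u z) / (u j - u z))) =
    (\<Prod>z\<in>I-{r}. schur_entry u r z)"
proof -
  have fin: "finite I" using gen by (simp add: schur_generic_def)
  \<comment> \<open>distinct nodes, since the sums of two of the \<open>u\<^sub>i\<close> do not vanish\<close>
  define y where "y = u(r := - u r)"
  have nz: "u i \<noteq> 0" if "i \<in> I" for i using gen that by (force simp: schur_generic_def)
  have sums: "u i + u j \<noteq> 0" if "i \<in> I" "j \<in> I" for i j using gen that by (auto simp: schur_generic_def)
  have "inj_on y I"
  proof (rule inj_onI)
    fix i j assume ij: "i \<in> I" "j \<in> I" "y i = y j"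
    have "u i \<noteq> - u r" using sums[OF ij(1) r] eq_neg_iff_add_eq_0 by metis
    moreover have "u j \<noteq> - u r" using sums[OF ij(2) r] eq_neg_iff_add_eq_0 by metis
    moreover have "u i = u j \<Longrightarrow> i = j" using gen ij unfolding schur_generic_def by (metis inj_onD)
    ultimately show "i = j" using ij(3) by (cases "i = r"; cases "j = r") (simp_all add: y_def)
  qed
  moreover have "y i \<noteq> 0" if "i \<in> I" for i using nz that nz[OF r] by (simp add: y_def)
  ultimately have "(1 - (- 1)) * (\<Sum>k\<in>I. \<Prod>z\<in>I-{k}. (y k - (- 1) * y z) / (y k - y z)) = 1 - (- 1) ^ card I"
    using fin by (intro sum_ratios_eq_geometric) auto
  then have "(\<Sum>k\<in>I. \<Prod>z\<in>I-{k}. (y k + y z) / (y k - y z)) = 0" using even by simp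
  then have zero: "(\<Prod>z\<in>I-{r}. (y r + y z) / (y r - y z)) +
      (\<Sum>k\<in>I-{r}. \<Prod>z\<in>I-{k}. (y k + y z) / (y k - y z)) = 0"
    unfolding sum.remove[OF fin r] .
  have "(\<Prod>z\<in>I-{r}. (y r + y z) / (y r - y z)) = (\<Prod>z\<in>I-{r}. - 1 * schur_entry u r z)"
  proof (intro prod.cong refl)
    fix z assume z: "z \<in> I - {r}"
    have "y r + y z = u z - u r" "y r - y z = - (u z + u r)" using z by (simp_all add: y_def)
    then have "(y r + y z) / (y r - y z) = - schur_entry u r z"
      by (simp only: schur_entry_def minus_divide_right)
    then show "(y r + y z) / (y r - y z) = - 1 * schur_entry u r z" by (simp only: mult_minus1)
  qed
  also have "\<dots> = (- 1) ^ card (I - {r}) * (\<Prod>z\<in>I-{r}. schur_entry u r z)"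
    unfolding prod.distrib prod_constant ..
  also have "odd (card (I - {r}))" using even card.remove[OF fin r] by simp
  then have "(- 1 :: 'a) ^ card (I - {r}) = - 1" by simp
  finally have first: "(\<Prod>z\<in>I-{r}. (y r + y z) / (y r - y z)) = - (\<Prod>z\<in>I-{r}. schur_entry u r z)" by simp
  have rest: "(\<Prod>z\<in>I-{k}. (y k + y z) / (y k - y z)) =
      schur_entry u r k * (\<Prod>z\<in>I-{r,k}. (u k + u z) / (u k - u z))" if k: "k \<in> I - {r}" for k
  proof -
    have sets: "I - {k} - {r} = I - {r, k}" by blast
    have "(\<Prod>z\<in>I-{k}. (y k + y z) / (y k - y z)) =
        (y k + y r) / (y k - y r) * (\<Prod>z\<in>I-{k}-{r}. (y k + y z) / (y k - y z))"
      by (rule prod.remove) (use fin r k in auto)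
    note this[unfolded sets]
    also have "(y k + y r) / (y k - y r) = schur_entry u r k" using k by (simp add: y_def schur_entry_def)
    also have "(\<Prod>z\<in>I-{r,k}. (y k + y z) / (y k - y z)) = (\<Prod>z\<in>I-{r,k}. (u k + u z) / (u k - u z))"
      using k by (intro prod.cong refl) (auto simp: y_def)
    finally show ?thesis .
  qed
  have "(\<Sum>k\<in>I-{r}. \<Prod>z\<in>I-{k}. (y k + y z) / (y k - y z)) =
      (\<Sum>k\<in>I-{r}. schur_entry u r k * (\<Prod>z\<in>I-{r,k}. (u k + u z) / (u k - u z)))"
    by (rule sum.cong[OF refl rest])
  then show ?thesis using zero unfolding first by (simp only: neg_eq_iff_add_eq_0[symmetric] minus_minus)
qed

text \<open>Dividing out the factors that involve \<open>j\<close>. The relative orders are exactly the signs of the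
  Pfaffian expansion.\<close>

lemma ordered_product_column:
  fixes u :: "nat \<Rightarrow> 'a::field"
  assumes gen: "schur_generic u J" and j: "j \<in> J"
  shows "(\<Prod>z\<in>J-{j}. order_sign j z) * ordered_product (schur_entry u) (J - {j}) =
    ordered_product (schur_entry u) J * (\<Prod>z\<in>J-{j}. (u z + u j) / (u z - u j))"
proof -
  have fin: "finite J" using gen by (simp add: schur_generic_def)
  have rem: "ordered_product (schur_entry u) J =
      (\<Prod>z\<in>J-{j}. order_sign j z * schur_entry u j z) * ordered_product (schur_entry u) (J - {j})"
    by (rule ordered_product_remove[OF fin j schur_entry_skew])
  have signs: "(\<Prod>z\<in>J-{j}. order_sign j z * schur_entry u j z) * (\<Prod>z\<in>J-{j}. (u z + u j) / (u z - u j)) =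
      (\<Prod>z\<in>J-{j}. order_sign j z)"
    unfolding prod.distrib[symmetric]
  proof (intro prod.cong refl)
    fix z assume "z \<in> J - {j}"
    then have "u z - u j \<noteq> 0" "u z + u j \<noteq> 0" using gen j by (auto simp: schur_generic_def inj_on_def)
    then show "order_sign j z * schur_entry u j z * ((u z + u j) / (u z - u j)) = order_sign j z"
      by (simp add: schur_entry_def)
  qed
  show ?thesis unfolding rem signs[symmetric] by (simp only: mult_ac)
qed

lemma ratio_flip: "(b + a) / (b - a) = - 1 * ((a + b) / (a - b :: 'a::field))"
  unfolding mult_minus1 minus_divide_right minus_diff_eq add.commute[of b a] ..

lemma schur_pfaffian:
  fixes u :: "nat \<Rightarrow> 'a::field_char_0"
  assumes "schur_generic u I" "even (card I)"
  shows "set_pfaffian (schur_entry u) I = ordered_product (schur_entry u) I"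
  using assms
proof (induction "card I" arbitrary: I rule: less_induct)
  case less
  note gen = less.prems(1)
  have fin: "finite I" using gen by (simp add: schur_generic_def)
  show ?case
  proof (cases "I = {}")
    case True then show ?thesis by (simp add: ordered_product_def)
  next
    case False
    define r where "r = Min I"
    have r: "r \<in> I" unfolding r_def using fin False by (rule Min_in)
    let ?b = "schur_entry u" and ?J = "I - {r}"
    have genJ: "schur_generic u ?J" by (rule schur_generic_subset[OF gen]) auto
    have rem: "ordered_product ?b I = (\<Prod>z\<in>?J. order_sign r z * ?b r z) * ordered_product ?b ?J"
      by (rule ordered_product_remove[OF fin r schur_entry_skew])
    have summand_eq: "pair_sign r j I * ?b r j * set_pfaffian ?b (I - {r, j}) =
        (\<Prod>z\<in>?J. order_sign r z) * ordered_product ?b ?J *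
          (?b r j * (\<Prod>z\<in>I-{r,j}. (u j + u z) / (u j - u z)))" if j: "j \<in> ?J" for j
    proof -
      have sets: "?J - {j} = I - {r, j}" by auto
      have card: "card I = Suc (Suc (card (I - {r, j})))"
        using card.remove[OF fin r] card.remove[OF _ j] fin by (simp add: sets)
      have IH: "set_pfaffian ?b (I - {r, j}) = ordered_product ?b (I - {r, j})"
        by (rule less.hyps) (use card less.prems(2) schur_generic_subset[OF gen] in auto)
      have flip: "(\<Prod>z\<in>I-{r,j}. (u z + u j) / (u z - u j)) = (\<Prod>z\<in>I-{r,j}. (u j + u z) / (u j - u z))"
      proof -
        have "(\<Prod>z\<in>I-{r,j}. (u z + u j) / (u z - u j)) =
            (\<Prod>z\<in>I-{r,j}. - 1 * ((u j + u z) / (u j - u z)))"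
          by (intro prod.cong refl) (rule ratio_flip)
        also have "\<dots> = (- 1) ^ card (I - {r, j}) * (\<Prod>z\<in>I-{r,j}. (u j + u z) / (u j - u z))"
          unfolding prod.distrib prod_constant ..
        also have "even (card (I - {r, j}))" using card less.prems(2) by simp
        then have "(- 1 :: 'a) ^ card (I - {r, j}) = 1" by simp
        finally show ?thesis by simp
      qed
      have "pair_sign r j I * set_pfaffian ?b (I - {r, j}) =
          order_sign r j * (\<Prod>z\<in>I-{r,j}. order_sign r z) *
            ((\<Prod>z\<in>I-{r,j}. order_sign j z) * ordered_product ?b (I - {r, j}))"
        unfolding pair_sign_def IH prod.distrib by (simp only: mult_ac)
      also have "(\<Prod>z\<in>I-{r,j}. order_sign j z) * ordered_product ?b (I - {r, j}) =
          ordered_product ?b ?J * (\<Prod>z\<in>I-{r,j}. (u j + u z) / (u j - u z))"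
        using ordered_product_column[OF genJ j] unfolding sets flip .
      also have "order_sign r j * (\<Prod>z\<in>I-{r,j}. order_sign r z) = (\<Prod>z\<in>?J. order_sign r z :: 'a)"
        using prod.remove[OF _ j, of "order_sign r :: nat \<Rightarrow> 'a"] fin unfolding sets by simp
      finally have main: "pair_sign r j I * set_pfaffian ?b (I - {r, j}) = (\<Prod>z\<in>?J. order_sign r z) *
          (ordered_product ?b ?J * (\<Prod>z\<in>I-{r,j}. (u j + u z) / (u j - u z)))" .
      have "pair_sign r j I * ?b r j * set_pfaffian ?b (I - {r, j}) =
          ?b r j * (pair_sign r j I * set_pfaffian ?b (I - {r, j}))" by (simp only: mult_ac)
      then show ?thesis unfolding main by (simp only: mult_ac)
    qed
    have "set_pfaffian ?b I = (\<Sum>j\<in>?J. pair_sign r j I * ?b r j * set_pfaffian ?b (I - {r, j}))"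
      by (rule set_pfaffian_expand[OF fin r schur_entry_skew])
    also have "\<dots> = (\<Prod>z\<in>?J. order_sign r z) * ordered_product ?b ?J *
        (\<Sum>j\<in>?J. ?b r j * (\<Prod>z\<in>I-{r,j}. (u j + u z) / (u j - u z)))"
      unfolding sum_distrib_left by (intro sum.cong refl summand_eq)
    also have "\<dots> = ordered_product ?b I"
      unfolding schur_expansion_identity[OF gen r less.prems(2)] rem prod.distrib by (simp only: mult_ac)
    finally show ?thesis .
  qed
qed

section \<open>Generalized P-functions\<close>

text \<open>The entries of the block matrix in the definition of the generalized P-function, as a function on all
  pairs of indices.\<close>

definition bordered_entry ::
  "(nat \<Rightarrow> 'a::field \<Rightarrow> 'a) \<Rightarrow> nat \<Rightarrow> (nat \<Rightarrow> 'a) \<Rightarrow> nat list \<Rightarrow> nat \<Rightarrow> nat \<Rightarrow> 'a" where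
  "bordered_entry f n u \<alpha> i j =
     (if i < n then if j < n then schur_entry u i j else f (\<alpha> ! (j - n)) (u i)
      else if j < n then - f (\<alpha> ! (i - n)) (u j) else 0)"

text \<open>Induction on the number of remaining border columns. Expanding along the first of them, all terms
  with a second border index vanish, and the others have the same shape with one variable and one part
  less. The Schur product changes by the factors that appear in \<open>partition_sum\<close>.\<close>

lemma bordered_pfaffian:
  fixes u :: "nat \<Rightarrow> 'a::field_char_0"
  assumes "schur_generic u I" "I \<subseteq> {..<n}" "k \<le> length \<alpha>" "even (card I + (length \<alpha> - k))"
  shows "set_pfaffian (bordered_entry f n u \<alpha>) (I \<union> {n+k..<n+length \<alpha>}) =
    ordered_product (schur_entry u) I * partition_sum f u (drop k \<alpha>) I"
  using assms
proof (induction "length \<alpha> - k" arbitrary: k I)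
  case 0
  then have "set_pfaffian (bordered_entry f n u \<alpha>) (I \<union> {n+k..<n+length \<alpha>}) = set_pfaffian (schur_entry u) I"
    by (subst set_pfaffian_cong[of _ _ "schur_entry u"])
      (auto simp: schur_generic_def bordered_entry_def)
  then show ?case using 0 by (simp add: schur_pfaffian)
next
  case (Suc l)
  let ?r = "n + k" and ?a = "bordered_entry f n u \<alpha>" and ?N = "n + length \<alpha>"
  let ?S = "I \<union> {n+k..<n+length \<alpha>}" and ?C = "{n+Suc k..<n+length \<alpha>}"
  have k: "k < length \<alpha>" using Suc.hyps(2) by simp
  have fin: "finite I" using Suc.prems(1) by (simp add: schur_generic_def)
  have below: "j < n" if "j \<in> I" for j using Suc.prems(2) that by auto
  have rS: "?r \<in> ?S" using k by simp
  have disj: "I \<inter> ?C = {}" using below by fastforce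
  have "{n+k..<n+length \<alpha>} = insert ?r ?C" using k by auto
  moreover have "?r \<notin> I" using below[of ?r] by auto
  ultimately have S_r: "?S - {?r} = I \<union> ?C" by auto
  have summand_eq: "pair_sign ?r j ?S * ?a ?r j * set_pfaffian ?a (?S - {?r, j}) =
      ordered_product (schur_entry u) I * (f (\<alpha> ! k) (u j) *
        (\<Prod>z\<in>I-{j}. (u j + u z) / (u j - u z)) * partition_sum f u (drop (Suc k) \<alpha>) (I - {j}))"
    if j: "j \<in> I" for j
  proof -
    have "?S - {?r, j} = (?S - {?r}) - {j}" by blast
    moreover have "j \<notin> ?C" using below[OF j] by simp
    ultimately have sets: "?S - {?r, j} = (I - {j}) \<union> ?C" unfolding S_r by blast
    have card: "card I = Suc (card (I - {j}))" using card.remove[OF fin j] .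
    have IH: "set_pfaffian ?a (?S - {?r, j}) =
        ordered_product (schur_entry u) (I - {j}) * partition_sum f u (drop (Suc k) \<alpha>) (I - {j})"
      unfolding sets
    proof (rule Suc.hyps(1))
      show "schur_generic u (I - {j})" by (rule schur_generic_subset[OF Suc.prems(1)]) auto
      have "length \<alpha> - k = Suc (length \<alpha> - Suc k)" using k by simp
      then show "even (card (I - {j}) + (length \<alpha> - Suc k))" using Suc.prems(4) card by simp
    qed (use Suc.hyps(2) Suc.prems(2) k in auto)
    have "(\<Prod>z\<in>?S-{?r,j}. order_sign ?r z * order_sign j z :: 'a) =
        (\<Prod>z\<in>I-{j}. order_sign ?r z * order_sign j z) * (\<Prod>z\<in>?C. order_sign ?r z * order_sign j z)"
      unfolding sets using disj fin by (intro prod.union_disjoint) auto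
    also have "(\<Prod>z\<in>?C. order_sign ?r z * order_sign j z :: 'a) = 1"
      using below[OF j] by (intro prod.neutral) (auto simp: order_sign_def)
    also have "(\<Prod>z\<in>I-{j}. order_sign ?r z * order_sign j z :: 'a) = (\<Prod>z\<in>I-{j}. - 1 * order_sign j z)"
    proof (rule prod.cong[OF refl])
      fix z assume "z \<in> I - {j}"
      then have "z < ?r" using below[of z] by simp
      then show "order_sign ?r z * order_sign j z = (- 1 * order_sign j z :: 'a)"
        by (simp add: order_sign_def)
    qed
    finally have signs: "(\<Prod>z\<in>?S-{?r,j}. order_sign ?r z * order_sign j z :: 'a) =
        (\<Prod>z\<in>I-{j}. - 1 * order_sign j z) * 1" .
    have "pair_sign ?r j ?S * ?a ?r j =
        f (\<alpha> ! k) (u j) * ((\<Prod>z\<in>I-{j}. - 1) * (\<Prod>z\<in>I-{j}. order_sign j z))"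
      unfolding pair_sign_def signs unfolding prod.distrib using below[OF j]
      by (simp add: order_sign_def[of ?r j] bordered_entry_def)
    then have "pair_sign ?r j ?S * ?a ?r j * set_pfaffian ?a (?S - {?r, j}) =
        f (\<alpha> ! k) (u j) * ((\<Prod>z\<in>I-{j}. - 1) *
          ((\<Prod>z\<in>I-{j}. order_sign j z) * ordered_product (schur_entry u) (I - {j}))) *
          partition_sum f u (drop (Suc k) \<alpha>) (I - {j})"
      unfolding IH by (simp only: mult_ac)
    also have "(\<Prod>z\<in>I-{j}. order_sign j z) * ordered_product (schur_entry u) (I - {j}) =
        ordered_product (schur_entry u) I * (\<Prod>z\<in>I-{j}. (u z + u j) / (u z - u j))"
      by (rule ordered_product_column[OF Suc.prems(1) j])
    also have "(\<Prod>z\<in>I-{j}. - 1) * (ordered_product (schur_entry u) I * (\<Prod>z\<in>I-{j}. (u z + u j) / (u z - u j))) =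
        ordered_product (schur_entry u) I * (\<Prod>z\<in>I-{j}. - 1 * ((u z + u j) / (u z - u j)))"
      unfolding prod.distrib by (simp only: mult_ac)
    also have "(\<Prod>z\<in>I-{j}. - 1 * ((u z + u j) / (u z - u j))) = (\<Prod>z\<in>I-{j}. (u j + u z) / (u j - u z))"
      by (intro prod.cong refl) (rule ratio_flip[symmetric])
    finally show ?thesis by (simp only: mult_ac)
  qed
  have "set_pfaffian ?a ?S = (\<Sum>j\<in>?S-{?r}. pair_sign ?r j ?S * ?a ?r j * set_pfaffian ?a (?S - {?r, j}))"
  proof (rule set_pfaffian_expand[OF _ rS])
    show "?a j i = - ?a i j" for i j
      by (simp add: bordered_entry_def schur_entry_skew[of u j i])
  qed (use fin in simp)
  also have "\<dots> = (\<Sum>j\<in>I. pair_sign ?r j ?S * ?a ?r j * set_pfaffian ?a (?S - {?r, j}))"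
    unfolding S_r using fin by (intro sum.mono_neutral_right) (auto simp: bordered_entry_def)
  also have "\<dots> = ordered_product (schur_entry u) I * partition_sum f u (drop k \<alpha>) I"
    unfolding Cons_nth_drop_Suc[OF k, symmetric] partition_sum.simps sum_distrib_left
    by (intro sum.cong refl summand_eq)
  finally show ?case .
qed

text \<open>The additional part \<open>0\<close> contributes a sum of products of ratios over an odd number of indices, which
  is \<open>1\<close> by partial fractions.\<close>

lemma partition_sum_append_zero:
  fixes u :: "nat \<Rightarrow> 'a::field_char_0"
  assumes "schur_generic u I" "odd (card I + length lam)" "\<And>x. f 0 x = 1"
  shows "partition_sum f u (lam @ [0]) I = partition_sum f u lam I"
  using assms(1,2)
proof (induction lam arbitrary: I)
  case Nil
  then show ?case using sum_ratios_odd[of u I] assms(3) by simp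
next
  case (Cons d lam)
  have "partition_sum f u (lam @ [0]) (I - {i}) = partition_sum f u lam (I - {i})" if "i \<in> I" for i
  proof (rule Cons.IH)
    have fin: "finite I" using Cons.prems(1) by (simp add: schur_generic_def)
    show "schur_generic u (I - {i})" by (rule schur_generic_subset[OF Cons.prems(1)]) auto
    show "odd (card (I - {i}) + length lam)" using Cons.prems(2) card.remove[OF fin that] by simp
  qed
  then show ?case by simp
qed

lemma generalized_P_eq_partition_sum:
  fixes u :: "nat \<Rightarrow> 'a::field_char_0"
  assumes gen: "schur_generic u {..<n}" and F0: "F 0 = 1"
  shows "generalized_P F n u lam = partition_sum (\<lambda>d. poly (F d)) u lam {..<n}"
proof -
  define \<alpha> where "\<alpha> = (if even (n + length lam) then lam else lam @ [0])"
  define V where "V = value_matrix F n u \<alpha>"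
  define M where "M = four_block_mat (schur_matrix n u) V (- transpose_mat V) (0\<^sub>m (length \<alpha>) (length \<alpha>))"
  have even: "even (n + length \<alpha>)" by (simp add: \<alpha>_def)
  have dim: "dim_row M = n + length \<alpha>" by (simp add: M_def schur_matrix_def)
  have entry: "M $$ (i, j) = bordered_entry (\<lambda>d. poly (F d)) n u \<alpha> i j"
    if "i < n + length \<alpha>" "j < n + length \<alpha>" for i j
    using that by (simp add: M_def V_def schur_matrix_def value_matrix_def bordered_entry_def schur_entry_def)
  have "pfaffian M = set_pfaffian (bordered_entry (\<lambda>d. poly (F d)) n u \<alpha>) {..<n + length \<alpha>}"
    unfolding pfaffian_eq_set_pfaffian[of M, unfolded dim, OF even]
    by (rule set_pfaffian_cong) (auto simp: entry)
  also have "{..<n + length \<alpha>} = {..<n} \<union> {n+0..<n+length \<alpha>}" by auto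
  also have "set_pfaffian (bordered_entry (\<lambda>d. poly (F d)) n u \<alpha>) \<dots> =
      ordered_product (schur_entry u) {..<n} * partition_sum (\<lambda>d. poly (F d)) u \<alpha> {..<n}"
    using bordered_pfaffian[OF gen, of n 0 \<alpha>] even by simp
  also have "partition_sum (\<lambda>d. poly (F d)) u \<alpha> {..<n} = partition_sum (\<lambda>d. poly (F d)) u lam {..<n}"
    using partition_sum_append_zero[OF gen, of lam "\<lambda>d. poly (F d)"] F0 by (simp add: \<alpha>_def)
  finally have "pfaffian M = ordered_product (schur_entry u) {..<n} * partition_sum (\<lambda>d. poly (F d)) u lam {..<n}" .
  moreover have "schur_product n u = ordered_product (schur_entry u) {..<n}"
    unfolding schur_product_def ordered_product_def schur_entry_def
    by (intro prod.cong) auto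
  ultimately show ?thesis
    using ordered_product_nonzero[OF gen]
    unfolding generalized_P_def Let_def \<alpha>_def[symmetric] V_def[symmetric] M_def[symmetric] by simp
qed

lemma wexp_add_nonzero:
  "wexp \<mu> + wexp \<nu> \<noteq> (0 :: (weight \<Rightarrow>\<^sub>0 'a::{idom, ring_char_0}) fract)"
proof
  assume "wexp \<mu> + wexp \<nu> = (0 :: (weight \<Rightarrow>\<^sub>0 'a) fract)"
  then have "Poly_Mapping.single \<mu> (1::'a) + Poly_Mapping.single \<nu> 1 = 0"
    by (simp add: wexp_def flip: to_fract_add)
  from arg_cong[OF this, of "\<lambda>p. Poly_Mapping.lookup p \<mu>"]
  have "(1::'a) + (if \<nu> = \<mu> then 1 else 0) = 0"
    by (simp add: lookup_add lookup_single when_def)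
  then show False by (simp split: if_splits)
qed

text \<open>The sums and the differences of two \<open>x\<^sub>i + 1/x\<^sub>i\<close> factor into sums and differences of monomials.\<close>

lemma schur_generic_var:
  "schur_generic (\<lambda>i. var i + inverse (var i) :: (weight \<Rightarrow>\<^sub>0 'a::{idom, ring_char_0}) fract) {..<n}"
proof -
  have eq: "((a + inverse a) - (b + inverse b)) * a = (a - b) * (a - inverse b)"
    if "a \<noteq> 0" "b \<noteq> 0" for a b :: "(weight \<Rightarrow>\<^sub>0 'a) fract"
    using that by (simp add: field_simps)
  have neq: "var i + inverse (var i) \<noteq> (var j + inverse (var j) :: (weight \<Rightarrow>\<^sub>0 'a) fract)" if "i \<noteq> j" for i j
    using eq[of "var i" "var j"] nodes_var_neq(4,5)[of "(i, True)" j, where ?'a = 'a] that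
    by (auto simp: signed_def)
  have pos: "(var i + inverse (var i)) + (var j + inverse (var j)) \<noteq> (0 :: (weight \<Rightarrow>\<^sub>0 'a) fract)" for i j
  proof
    have "((a + inverse a) + (b + inverse b)) * a = (a + b) * (a + inverse b)"
      if "a \<noteq> 0" "b \<noteq> 0" for a b :: "(weight \<Rightarrow>\<^sub>0 'a) fract"
      using that by (simp add: field_simps)
    moreover assume "(var i + inverse (var i)) + (var j + inverse (var j)) = (0 :: (weight \<Rightarrow>\<^sub>0 'a) fract)"
    ultimately have "(var i + var j) * (var i + inverse (var j)) = (0 :: (weight \<Rightarrow>\<^sub>0 'a) fract)"
      by (metis wexp_nonzero mult_zero_left)
    then show False unfolding wexp_uminus[symmetric] by (simp add: wexp_add_nonzero)
  qed
  show ?thesis using neq pos by (auto simp: schur_generic_def inj_on_def)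
qed


lemma P_symmetrized_eq:
  "P_symmetrized (f_polys X) n lam =
    partition_sum (\<lambda>d. poly (rat_poly (f_polys X d))) (\<lambda>i. var i + inverse (var i)) lam {..<n}"
  unfolding P_symmetrized_def
  by (rule generalized_P_eq_partition_sum[OF schur_generic_var]) (simp add: f_polys_def)

lemma specializes_to_P_symmetrized:
  assumes "strict_partition lam"
  shows "specializes_to (-1) (hl_coset_sum X lam n) (P_symmetrized (f_polys X) n lam)"
proof -
  have "coset_sum (self_factor X (-1) var) (pair_factor (-1) var) (node_power var) lam {..<n} =
      P_symmetrized (f_polys X) n lam"
    unfolding P_symmetrized_eq
  proof (rule coset_sum_minus_one)
    show "var i \<noteq> (0 :: (weight \<Rightarrow>\<^sub>0 rat) fract) \<and> (var i)\<^sup>2 \<noteq> (1 :: (weight \<Rightarrow>\<^sub>0 rat) fract)" for i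
      using nodes_var_neq(1,3)[of "(i, True)", where ?'a = rat] by (simp add: signed_def)
    show "\<forall>d\<in>set lam. d \<ge> 1" using assms by (auto simp: strict_partition_def)
  qed
  then show ?thesis using specializes_to_coset_sum[of X lam "{..<n}"] by (simp add: hl_coset_sum_def)
qed

theorem theorem7p2:
  fixes n :: nat and lam :: "nat list"
  assumes "n \<ge> 1" and "strict_partition lam"
  shows
    "(length lam \<le> n \<longrightarrow>
       hall_littlewood_minus_one Type_B n (partition_weight lam) = P_symmetrized fB n lam) \<and>
     (length lam \<le> n \<longrightarrow>
       hall_littlewood_minus_one Type_C n (partition_weight lam) = P_symmetrized fC n lam) \<and>
     (length lam < n \<longrightarrow>
       hall_littlewood_minus_one Type_D n (partition_weight lam) = P_symmetrized fD n lam) \<and>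
     (length lam = n \<longrightarrow>
       hall_littlewood_minus_one Type_D n (partition_weight lam) +
       hall_littlewood_minus_one Type_D n
         (partition_weight (butlast lam) - Poly_Mapping.single (n - 1) (int (last lam))) =
       P_symmetrized fD n lam)"
proof (intro conjI impI)
  have HL: "hall_littlewood_minus_one X n (partition_weight lam) = P_symmetrized (f_polys X) n lam"
    if "length lam \<le> n" "X = Type_D \<Longrightarrow> length lam < n" for X
  proof -
    have "hall_littlewood X n (partition_weight lam) = hl_coset_sum X lam n"
      by (rule hall_littlewood_eq_hl_coset_sum) (use assms(2) that in auto)
    then show ?thesis
      unfolding hall_littlewood_minus_one_def
      by (simp only: specialize_eqI[OF specializes_to_P_symmetrized[OF assms(2)]])
  qed
  show "hall_littlewood_minus_one Type_B n (partition_weight lam) = P_symmetrized fB n lam"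
    if "length lam \<le> n" using HL[OF that, of Type_B] by (simp add: f_polys_eq)
  show "hall_littlewood_minus_one Type_C n (partition_weight lam) = P_symmetrized fC n lam"
    if "length lam \<le> n" using HL[OF that, of Type_C] by (simp add: f_polys_eq)
  show "hall_littlewood_minus_one Type_D n (partition_weight lam) = P_symmetrized fD n lam"
    if "length lam < n" using HL[of Type_D] that by (simp add: f_polys_eq)
  show "hall_littlewood_minus_one Type_D n (partition_weight lam) +
       hall_littlewood_minus_one Type_D n
         (partition_weight (butlast lam) - Poly_Mapping.single (n - 1) (int (last lam))) =
       P_symmetrized fD n lam" if l: "length lam = n"
  proof -
    note full = hall_littlewood_D_full_length[OF assms(2) l assms(1)]
    have fst_distinct: "distinct (map fst ys)" "distinct (map fst (flip_end ys))"
      if "ys \<in> weyl_arrangements Type_D {..<n}" for ys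
    proof -
      have arr: "ys \<in> arrangements {..<n}" using that by (simp add: weyl_arrangements_def)
      then show "distinct (map fst ys)" by (simp add: arrangements_def)
      obtain xs a where "ys = xs @ [a]"
        using length_arrangement[OF arr] assms(1) by (cases ys rule: rev_cases) auto
      with \<open>distinct (map fst ys)\<close> show "distinct (map fst (flip_end ys))" by simp
    qed
    \<comment> \<open>the two functions are specialized separately, so each of the two sums has to be regular\<close>
    define g where "g ys = (SOME v. specializes_to (-1) (hl_summand Type_D lam ys) v)" for ys
    have g: "specializes_to (-1) (hl_summand Type_D lam ys) (g ys)" if "distinct (map fst ys)" for ys
      unfolding g_def by (rule someI_ex[OF summand_regular[OF that]])
    let ?E = "weyl_arrangements Type_D {..<n}"
    have G: "specializes_to (-1) (\<Sum>ys\<in>?E. hl_summand Type_D lam ys) (\<Sum>ys\<in>?E. g ys)"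
      by (intro specializes_to_sum g fst_distinct(1))
    have G': "specializes_to (-1) (\<Sum>ys\<in>?E. hl_summand Type_D lam (flip_end ys)) (\<Sum>ys\<in>?E. g (flip_end ys))"
      by (intro specializes_to_sum g fst_distinct(2))
    have "(\<Sum>ys\<in>?E. g ys) + (\<Sum>ys\<in>?E. g (flip_end ys)) = P_symmetrized fD n lam"
      using specializes_to_unique[OF specializes_to_add[OF G G', unfolded full(3)]
          specializes_to_P_symmetrized[OF assms(2)]] by (simp add: f_polys_eq)
    then show ?thesis
      unfolding hall_littlewood_minus_one_def full(1,2) specialize_eqI[OF G] specialize_eqI[OF G'] .
  qed
qed

end
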